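(* Let $q$ be a power of a prime, let $S$ be a maximal partial spread of $\mathbb{P}^3_{\mathbb{F}_q}$ of deficiency $d$, and let $Z\subseteq\mathbb{P}^3_{\mathbb{F}_q}$ be its complement, i.e. $Z=\mathbb{P}^3_{\mathbb{F}_q}\setminus\mathcal{P}(S)$, where $\mathcal{P}(S)$ is the set of points of $\mathbb{P}^3_{\mathbb{F}_q}$ lying on the lines of $S$. Then $Z$, regarded as a finite set of points in $\mathbb{P}^3_{\overline{\mathbb{F}}_q}$, is a nontrivial $\{q+1,d\}$-geproci set. Furthermore, when $d>q+1$, $Z$ is also not a half grid.
   Context: $\mathbb{F}_q$ is the field with $q$ elements, $K=\overline{\mathbb{F}}_q$ is its algebraic closure, and $\mathbb{P}^3_{\mathbb{F}_q}$ is regarded as the finite set of $\mathbb{F}_q$-rational points of $\mathbb{P}^3_K$. "General point" means any point of some nonempty Zariski open subset. Partial spreads: a partial spread of $\mathbb{P}^3_{\mathbb{F}_q}$ with deficiency $d$ is a set of $q^2+1-d$ mutually skew lines of $\mathbb{P}^3_{\mathbb{F}_q}$ (lines defined over $\mathbb{F}_q$). A maximal partial spread is a partial spread of positive deficiency that is not contained in any larger partial spread. Geproci: for positive integers $a,b$ (in no particular order), a finite set $Z\subseteq\mathbb{P}^3_K$ is $\{a,b\}$-geproci if, for a general point $P\in\mathbb{P}^3_K$, the image $\overline{Z}$ of $Z$ under projection from $P$ to a plane $H\cong\mathbb{P}^2_K$ (with $P\notin H$) is a complete intersection in $H$ of a curve of degree $a$ and a curve of degree $b$, i.e. the homogeneous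 ideal of the (reduced) set of points $\overline{Z}$ is generated by two forms of degrees $a$ and $b$ with no common factor. Grid: given a set of $a$ pairwise disjoint lines and a set of $b$ pairwise disjoint lines in $\mathbb{P}^3_K$ such that every line of the first set meets every line of the second set transversely, the $ab$ points of intersection form an $(a,b)$-grid. A geproci set in $\mathbb{P}^3_K$ is called trivial if it is contained in a plane or is a grid, and nontrivial otherwise. Half grid: a set $Z\subseteq\mathbb{P}^3_K$ is a $\{\mu,\lambda\}$-half grid if $Z$ is a nontrivial $\{\mu,\lambda\}$-geproci set contained in a set of $\mu$ mutually skew lines, with each line containing $\lambda$ points of $Z$. A half grid is a $\{\mu,\lambda\}$-half grid for some $\mu,\lambda$. *)

theory Defs
  imports
    "HOL-Algebra.Algebraic_Closure_Type"
    "HOL-Analysis.Cartesian_Space"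
    "HOL-Library.Poly_Mapping"
begin

section \<open>Projective spaces\<close>

text \<open>
  Points, lines and planes of the projective space of \<^typ>\<open>'a ^ 'n\<close> are represented by the linear
  subspaces of dimension 1, 2 and 3. Projective 3-space is thus the case \<^typ>\<open>'a ^ 4\<close>, and
  incidence is inclusion.
\<close>

definition proj_points :: "('a::field ^ 'n) set set" where
  "proj_points = {P. vec.subspace P \<and> vec.dim P = 1}"

definition proj_lines :: "('a::field ^ 'n) set set" where
  "proj_lines = {L. vec.subspace L \<and> vec.dim L = 2}"

definition proj_planes :: "('a::field ^ 'n) set set" where
  "proj_planes = {H. vec.subspace H \<and> vec.dim H = 3}"

text \<open>Two lines without a common projective point intersect in the zero vector only.\<close>

definition skew :: "('a::field ^ 'n) set \<Rightarrow> ('a ^ 'n) set \<Rightarrow> bool" where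
  "skew L M \<longleftrightarrow> L \<inter> M = {0}"

definition points_on :: "('a::field ^ 'n) set set \<Rightarrow> ('a ^ 'n) set set" where
  "points_on S = {P \<in> proj_points. \<exists>L\<in>S. P \<subseteq> L}"

text \<open>
  The inclusion of the projective space over a field into the one over its algebraic closure; its
  values on \<^const>\<open>proj_points\<close> are the rational points.
\<close>

definition base_change :: "('f::field ^ 'n) set \<Rightarrow> ('f alg_closure ^ 'n) set" where
  "base_change U = vec.span ((\<lambda>v. \<chi> i. to_ac (v $ i)) ` U)"


section \<open>Partial spreads\<close>

text \<open>
  The lines are those of the projective space over the finite field itself. Its
  \<open>(q\<^sup>2 + 1) (q + 1)\<close> points bound the number of mutually skew lines by \<open>q\<^sup>2 + 1\<close>, so it is no
  restriction that the deficiency is a natural number.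
\<close>

definition partial_spread :: "nat \<Rightarrow> ('f::{field,finite} ^ 4) set set \<Rightarrow> bool" where
  "partial_spread d S \<longleftrightarrow>
     S \<subseteq> proj_lines \<and> pairwise skew S \<and> card S + d = CARD('f) ^ 2 + 1"

definition maximal_partial_spread :: "nat \<Rightarrow> ('f::{field,finite} ^ 4) set set \<Rightarrow> bool" where
  "maximal_partial_spread d S \<longleftrightarrow>
     partial_spread d S \<and> d > 0 \<and> \<not> (\<exists>d' S'. partial_spread d' S' \<and> S \<subset> S')"


section \<open>Forms and homogeneous ideals\<close>

text \<open>Polynomials in variables indexed by \<^typ>\<open>'n\<close>: finitely supported maps from exponents to coefficients.\<close>

type_synonym ('a, 'n) mpoly = "('n \<Rightarrow>\<^sub>0 nat) \<Rightarrow>\<^sub>0 'a"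

definition mpoly_eval :: "('a::field, 'n::finite) mpoly \<Rightarrow> 'a ^ 'n \<Rightarrow> 'a" where
  "mpoly_eval f v =
     (\<Sum>m\<in>Poly_Mapping.keys f. Poly_Mapping.lookup f m * (\<Prod>i\<in>UNIV. v $ i ^ Poly_Mapping.lookup m i))"

text \<open>The zero polynomial counts as a form of every degree.\<close>

definition is_form :: "nat \<Rightarrow> ('a::field, 'n::finite) mpoly \<Rightarrow> bool" where
  "is_form k f \<longleftrightarrow> (\<forall>m\<in>Poly_Mapping.keys f. (\<Sum>i\<in>UNIV. Poly_Mapping.lookup m i) = k)"

definition vanishes_at :: "('a::field, 'n::finite) mpoly \<Rightarrow> ('a ^ 'n) set \<Rightarrow> bool" where
  "vanishes_at f P \<longleftrightarrow> (\<forall>v\<in>P. mpoly_eval f v = 0)"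

text \<open>The ideal generated by a subset of a ring: its span in the ring as a module over itself.\<close>

definition ideal_gen :: "'r::comm_ring_1 set \<Rightarrow> 'r set" where
  "ideal_gen B = Modules.module.span (*) B"

definition homogeneous_ideal :: "('a::field ^ 'n) set set \<Rightarrow> ('a, 'n::finite) mpoly set" where
  "homogeneous_ideal V = ideal_gen {f. (\<exists>k. is_form k f) \<and> (\<forall>P\<in>V. vanishes_at f P)}"

definition zariski_open :: "('k::alg_closed_field ^ 'n) set set \<Rightarrow> bool" where
  "zariski_open U \<longleftrightarrow>
     (\<exists>F :: ('k, 'n) mpoly set. (\<forall>f\<in>F. \<exists>k. is_form k f) \<and>
        U = {P \<in> proj_points. \<exists>f\<in>F. \<not> vanishes_at f P})"


section \<open>Geproci sets\<close>

definition complete_intersection :: "nat \<Rightarrow> nat \<Rightarrow> ('k::alg_closed_field ^ 3) set set \<Rightarrow> bool" where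
  "complete_intersection a b V \<longleftrightarrow>
     (\<exists>f g. is_form a f \<and> is_form b g \<and> (\<forall>h. h dvd f \<and> h dvd g \<longrightarrow> h dvd 1) \<and>
        homogeneous_ideal V = ideal_gen {f, g})"

text \<open>
  A plane \<open>H\<close> is identified with the projective plane by a matrix whose column space is \<open>H\<close>;
  being 3-dimensional, \<open>H\<close> is the isomorphic image of the coordinate space. Which
  coordinates are chosen is immaterial, since they differ by a linear change of variables.
\<close>

definition complete_intersection_in ::
    "('k::alg_closed_field ^ 4) set \<Rightarrow> nat \<Rightarrow> nat \<Rightarrow> ('k ^ 4) set set \<Rightarrow> bool" where
  "complete_intersection_in H a b V \<longleftrightarrow>
     (\<exists>A :: 'k ^ 3 ^ 4. range ((*v) A) = H \<and>
        complete_intersection a b {Q \<in> proj_points. (*v) A ` Q \<in> V})"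

text \<open>The join of \<open>P\<close> and \<open>z\<close> meets \<open>H\<close> in the projection of \<open>z\<close>, if \<open>z \<noteq> P\<close> and \<open>P\<close> is not on \<open>H\<close>.\<close>

definition proj_from :: "('a::field ^ 'n) set \<Rightarrow> ('a ^ 'n) set \<Rightarrow> ('a ^ 'n) set \<Rightarrow> ('a ^ 'n) set" where
  "proj_from P H z = vec.span (P \<union> z) \<inter> H"

definition geproci :: "nat \<Rightarrow> nat \<Rightarrow> ('k::alg_closed_field ^ 4) set set \<Rightarrow> bool" where
  "geproci a b Z \<longleftrightarrow>
     a > 0 \<and> b > 0 \<and> finite Z \<and> Z \<subseteq> proj_points \<and>
     (\<exists>U. zariski_open U \<and> U \<noteq> {} \<and>
        (\<forall>P\<in>U. P \<notin> Z \<and>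
           (\<forall>H\<in>proj_planes. \<not> P \<subseteq> H \<longrightarrow> complete_intersection_in H a b (proj_from P H ` Z))))"

text \<open>Two lines meet transversely if their intersection is a single point.\<close>

definition grid :: "nat \<Rightarrow> nat \<Rightarrow> ('k::alg_closed_field ^ 4) set set \<Rightarrow> bool" where
  "grid a b Z \<longleftrightarrow>
     (\<exists>A B. A \<subseteq> proj_lines \<and> finite A \<and> card A = a \<and> pairwise skew A \<and>
            B \<subseteq> proj_lines \<and> finite B \<and> card B = b \<and> pairwise skew B \<and>
            (\<forall>L\<in>A. \<forall>M\<in>B. L \<inter> M \<in> proj_points) \<and>
            Z = {L \<inter> M | L M. L \<in> A \<and> M \<in> B})"

definition nontrivial_geproci :: "nat \<Rightarrow> nat \<Rightarrow> ('k::alg_closed_field ^ 4) set set \<Rightarrow> bool" where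
  "nontrivial_geproci a b Z \<longleftrightarrow>
     geproci a b Z \<and> \<not> (\<exists>H\<in>proj_planes. \<forall>P\<in>Z. P \<subseteq> H) \<and> \<not> (\<exists>m n. grid m n Z)"

definition half_grid :: "nat \<Rightarrow> nat \<Rightarrow> ('k::alg_closed_field ^ 4) set set \<Rightarrow> bool" where
  "half_grid m l Z \<longleftrightarrow>
     nontrivial_geproci m l Z \<and>
     (\<exists>M. M \<subseteq> proj_lines \<and> finite M \<and> card M = m \<and> pairwise skew M \<and>
          Z \<subseteq> points_on M \<and> (\<forall>L\<in>M. card {P \<in> Z. P \<subseteq> L} = l))"

end

theory Submission
  imports Defs
begin

text \<open>
  Project from a point \<open>p\<close> that lies on no rational plane. The join of \<open>p\<close> with a rational line \<open>L\<close>
  projects to a linear form \<open>l\<^sub>L\<close> on the target plane, and the rational points project into the curve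
  \<open>f = det (x, p, x\<^sup>q, p\<^sup>q) = 0\<close> of degree \<open>q + 1\<close>. Restricted to the projection of \<open>L\<close>, \<open>f\<close> is a
  nonzero constant times the product of the linear forms of the \<open>q + 1\<close> rational points of \<open>L\<close>. Hence
  forms vanishing on the rational points of pairwise skew lines \<open>L \<in> T\<close> are exactly the
  combinations of \<open>f\<close> and the product of the \<open>l\<^sub>L\<close>, \<open>L \<in> T\<close>.
  The product \<open>g\<close> over a full spread, of degree \<open>q\<^sup>2 + 1\<close>, vanishes on all rational points. So it is
  congruent modulo \<open>f\<close> to \<open>h\<close> times the product over \<open>S\<close>, for a form \<open>h\<close> of degree \<open>d\<close>, and \<open>f\<close>
  and \<open>h\<close> generate the ideal of the projection of the complement \<open>Z\<close> of \<open>S\<close>.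

  A rational plane that contains \<open>j \<le> 1\<close> lines of \<open>S\<close> contains \<open>q + d - j q\<close> points of \<open>Z\<close>, and by
  maximality no line contains more than \<open>q\<close> of them. These counts show that \<open>Z\<close> is neither planar nor
  a grid. In a half grid, the second generator of the ideal would be a nonzero form whose degree is
  the number of points on a line, at most \<open>q\<close>; this is impossible if \<open>f\<close> and \<open>h\<close> have larger degrees.
\<close>

text \<open>The origin of \<open>f\<close>: a line through \<open>p\<close> and \<open>x\<close>
  meets its Frobenius conjugate, the line through \<open>p^q\<close> and \<open>x^q\<close>, exactly
  when the four points are coplanar, and the join of \<open>p\<close> with a rational point meets
  its conjugate in that point. Since \<open>p\<close> is on no rational plane, the two equations of
  a rational line \<open>L\<close> have values at \<open>p\<close> with an irrational ratio. Hence
  no rational point off \<open>L\<close> projects into the image of \<open>L\<close>, and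
  \<open>f\<close> is not identically zero on that image. The spread is auxiliary: \<open>S\<close>
  itself cannot be completed to one. A form that vanishes on \<open>Z\<close> is multiplied by the
  product over \<open>S\<close>, so that it vanishes on all rational points, is expanded with
  respect to the spread, and the product is cancelled modulo \<open>f\<close>. This cancellation and
  the coprimality of \<open>f\<close> and \<open>h\<close> rest only on linear forms being prime;
  neither unique factorization nor an intersection count enters. The lines and planes that a
  hypothetical grid or half grid supplies are defined over the closure. The counts apply to the
  subspace of rational vectors in them.\<close>

no_notation fps_nth (infixl \<open>$\<close> 75)

section \<open>Polynomial functions\<close>

text \<open>Over a finite field, the product of all \<open>X - a\<close>, plus 1, is a nonconstant
  polynomial without roots.\<close>

lemma infinite_UNIV_alg_closed: "infinite (UNIV :: 'a::alg_closed_field set)"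
proof
  assume fin: "finite (UNIV :: 'a set)"
  define p :: "'a poly" where "p = (\<Prod>a\<in>UNIV. [:- a, 1:]) + 1"
  have ev: "poly p x = 1" for x
    using fin by (auto simp: p_def poly_prod intro!: exI[of _ x])
  have "degree (\<Prod>a\<in>UNIV. [:- a, 1 :: 'a:]) = card (UNIV :: 'a set)"
    by (subst degree_prod_eq_sum_degree) auto
  moreover have "card (UNIV :: 'a set) > 0"
    using fin by (simp add: finite_UNIV_card_ge_0)
  ultimately have "degree p > 0"
    unfolding p_def by (subst degree_add_eq_left) auto
  then obtain x where "poly p x = 0"
    using alg_closed_imp_poly_has_root by blast
  then show False
    using ev by simp
qed

text \<open>The degree is an integer, so that quotients of forms by forms of larger degree need no case
  distinction: the zero function is the only form of negative degree.\<close>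

inductive form_fun :: "int \<Rightarrow> ('a::field ^ 'n::finite \<Rightarrow> 'a) \<Rightarrow> bool" where
  form_fun_zero: "form_fun k (\<lambda>_. 0)"
| form_fun_const: "form_fun 0 (\<lambda>_. c)"
| form_fun_coord: "form_fun 1 (\<lambda>v. v $ i)"
| form_fun_add: "form_fun k u \<Longrightarrow> form_fun k v \<Longrightarrow> form_fun k (\<lambda>x. u x + v x)"
| form_fun_mult: "form_fun k u \<Longrightarrow> form_fun l v \<Longrightarrow> form_fun (k + l) (\<lambda>x. u x * v x)"

text \<open>The divisors in the coprimality condition are arbitrary polynomials, so functions
  without a degree are needed beside \<open>form_fun\<close>.\<close>

inductive poly_fun :: "('a::field ^ 'n::finite \<Rightarrow> 'a) \<Rightarrow> bool" where
  poly_fun_const: "poly_fun (\<lambda>_. c)"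
| poly_fun_coord: "poly_fun (\<lambda>v. v $ i)"
| poly_fun_add: "poly_fun u \<Longrightarrow> poly_fun v \<Longrightarrow> poly_fun (\<lambda>x. u x + v x)"
| poly_fun_mult: "poly_fun u \<Longrightarrow> poly_fun v \<Longrightarrow> poly_fun (\<lambda>x. u x * v x)"

lemma form_fun_mult': "form_fun k u \<Longrightarrow> form_fun l v \<Longrightarrow> j = k + l \<Longrightarrow> form_fun j (\<lambda>x. u x * v x)"
  by (simp add: form_fun_mult)

lemma form_fun_cmult: "form_fun k u \<Longrightarrow> form_fun k (\<lambda>x. c * u x)"
  using form_fun_mult'[OF form_fun_const, of k u k c] by simp

lemma form_fun_diff: "form_fun k u \<Longrightarrow> form_fun k v \<Longrightarrow> form_fun k (\<lambda>x. u x - v x)"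
  using form_fun_add[of k u "\<lambda>x. (- 1) * v x"] form_fun_cmult[of k v "- 1"] by simp

lemma form_fun_sum: "(\<And>i. i \<in> A \<Longrightarrow> form_fun k (u i)) \<Longrightarrow> form_fun k (\<lambda>x. \<Sum>i\<in>A. u i x)"
  by (induction A rule: infinite_finite_induct) (auto intro: form_fun_zero form_fun_add)

lemma form_fun_prod:
  "(\<And>i. i \<in> A \<Longrightarrow> form_fun (k i) (u i)) \<Longrightarrow> form_fun (\<Sum>i\<in>A. k i) (\<lambda>x. \<Prod>i\<in>A. u i x)"
  by (induction A rule: infinite_finite_induct) (auto intro: form_fun_const form_fun_mult)

lemma form_fun_power: "form_fun k u \<Longrightarrow> form_fun (int n * k) (\<lambda>x. u x ^ n)"
  by (induction n) (auto intro: form_fun_const form_fun_mult' simp: algebra_simps)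

lemma form_fun_linear: "form_fun 1 (\<lambda>x. \<Sum>i\<in>UNIV. a i * x $ i)"
  by (intro form_fun_sum form_fun_cmult form_fun_coord)

lemma form_fun_poly_fun: "form_fun k u \<Longrightarrow> poly_fun u"
  by (induction rule: form_fun.induct) (auto intro: poly_fun.intros)

lemma poly_fun_diff: "poly_fun u \<Longrightarrow> poly_fun v \<Longrightarrow> poly_fun (\<lambda>x. u x - v x)"
  using poly_fun_add[of u "\<lambda>x. (- 1) * v x"] poly_fun_mult[OF poly_fun_const, of v "- 1"] by simp

lemma poly_fun_prod: "(\<And>i. i \<in> A \<Longrightarrow> poly_fun (u i)) \<Longrightarrow> poly_fun (\<lambda>x. \<Prod>i\<in>A. u i x)"
  by (induction A rule: infinite_finite_induct) (auto intro: poly_fun_const poly_fun_mult)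

lemma form_fun_neg: "form_fun k u \<Longrightarrow> k < 0 \<Longrightarrow> u x = 0"
proof (induction arbitrary: x rule: form_fun.induct)
  case (form_fun_mult k u l v)
  then have "k < 0 \<or> l < 0"
    by linarith
  then show ?case
    using form_fun_mult.IH by auto
qed auto

lemma form_fun_scale: "form_fun k u \<Longrightarrow> k \<ge> 0 \<Longrightarrow> u (c *s x) = c ^ nat k * u x"
proof (induction rule: form_fun.induct)
  case (form_fun_mult k u l v)
  show ?case
  proof (cases "k \<ge> 0 \<and> l \<ge> 0")
    case True
    then show ?thesis
      using form_fun_mult by (simp add: nat_add_distrib power_add)
  next
    \<comment> \<open>A product of nonnegative degree may have a factor of negative degree, which is
      the zero function.\<close>
    case False
    then have "(\<forall>y. u y = 0) \<or> (\<forall>y. v y = 0)"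
      using form_fun_mult.hyps form_fun_neg by (metis not_le)
    then show ?thesis
      by auto
  qed
qed (auto simp: algebra_simps)

lemma form_fun_compose:
  "form_fun k u \<Longrightarrow> (\<And>i. form_fun 1 (\<lambda>x. g x $ i)) \<Longrightarrow> form_fun k (\<lambda>x. u (g x))"
  by (induction rule: form_fun.induct) (auto intro: form_fun.intros)

lemma poly_fun_compose:
  "poly_fun u \<Longrightarrow> (\<And>i. poly_fun (\<lambda>x. g x $ i)) \<Longrightarrow> poly_fun (\<lambda>x. u (g x))"
  by (induction rule: poly_fun.induct) (auto intro: poly_fun.intros)

lemma form_fun_shift:
  assumes "form_fun 1 l"
  shows "form_fun 1 (\<lambda>x. (x - l x *s e) $ i)"
proof -
  have "form_fun 1 (\<lambda>x. x $ i - e $ i * l x)"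
    by (intro form_fun_diff form_fun_coord form_fun_cmult assms)
  then show ?thesis
    by (simp add: mult.commute)
qed

text \<open>Division with remainder by a linear form \<open>l\<close>: modulo \<open>l\<close>, a point may be moved along any
  vector \<open>e\<close> by a multiple of \<open>l\<close>.\<close>

lemma form_fun_shift_diff:
  assumes "form_fun k u" and l: "form_fun 1 l"
  shows "\<exists>b. form_fun (k - 1) b \<and> (\<forall>x. u x - u (x - l x *s e) = l x * b x)"
  using assms(1)
proof (induction rule: form_fun.induct)
  case (form_fun_coord i)
  show ?case
    by (rule exI[of _ "\<lambda>_. e $ i"]) (auto intro: form_fun_const)
next
  case (form_fun_add k u v)
  obtain a where a: "form_fun (k - 1) a" "\<forall>x. u x - u (x - l x *s e) = l x * a x"
    using form_fun_add.IH(1) by blast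
  obtain b where b: "form_fun (k - 1) b" "\<forall>x. v x - v (x - l x *s e) = l x * b x"
    using form_fun_add.IH(2) by blast
  have "u x + v x - (u (x - l x *s e) + v (x - l x *s e)) = l x * (a x + b x)" for x
    using a(2)[rule_format, of x] b(2)[rule_format, of x] by (simp only: distrib_left add_diff_add)
  moreover have "form_fun (k - 1) (\<lambda>x. a x + b x)"
    using a(1) b(1) by (rule form_fun.form_fun_add)
  ultimately show ?case
    by blast
next
  case (form_fun_mult k u j v)
  obtain a where a: "form_fun (k - 1) a" "\<forall>x. u x - u (x - l x *s e) = l x * a x"
    using form_fun_mult.IH(1) by blast
  obtain b where b: "form_fun (j - 1) b" "\<forall>x. v x - v (x - l x *s e) = l x * b x"
    using form_fun_mult.IH(2) by blast
  have v': "form_fun j (\<lambda>x. v (x - l x *s e))"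
    by (rule form_fun_compose[OF form_fun_mult.hyps(2)]) (rule form_fun_shift[OF l])
  have "u x * v x - u (x - l x *s e) * v (x - l x *s e)
      = l x * (u x * b x + a x * v (x - l x *s e))" for x
  proof -
    have "u x * v x - u (x - l x *s e) * v (x - l x *s e)
      = u x * (v x - v (x - l x *s e)) + (u x - u (x - l x *s e)) * v (x - l x *s e)"
      by (simp add: algebra_simps)
    then show ?thesis
      unfolding a(2)[rule_format, of x] b(2)[rule_format, of x]
      by (simp only: distrib_left mult.assoc mult.left_commute)
  qed
  moreover have "form_fun (k + j - 1) (\<lambda>x. u x * b x + a x * v (x - l x *s e))"
    by (rule form_fun_add, rule form_fun_mult'[OF form_fun_mult.hyps(1) b(1)], simp,
        rule form_fun_mult'[OF a(1) v'], simp)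
  ultimately show ?case
    by blast
qed (auto intro: form_fun_zero)

lemma poly_fun_shift_diff:
  assumes "poly_fun u" and l: "form_fun 1 l"
  shows "\<exists>b. poly_fun b \<and> (\<forall>x. u x - u (x - l x *s e) = l x * b x)"
  using assms(1)
proof (induction rule: poly_fun.induct)
  case (poly_fun_const c)
  show ?case
    by (rule exI[of _ "\<lambda>_. 0"]) (auto intro: poly_fun.poly_fun_const)
next
  case (poly_fun_coord i)
  show ?case
    by (rule exI[of _ "\<lambda>_. e $ i"]) (auto intro: poly_fun_const)
next
  case (poly_fun_add u v)
  obtain a where a: "poly_fun a" "\<forall>x. u x - u (x - l x *s e) = l x * a x"
    using poly_fun_add.IH(1) by blast
  obtain b where b: "poly_fun b" "\<forall>x. v x - v (x - l x *s e) = l x * b x"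
    using poly_fun_add.IH(2) by blast
  have "u x + v x - (u (x - l x *s e) + v (x - l x *s e)) = l x * (a x + b x)" for x
    using a(2)[rule_format, of x] b(2)[rule_format, of x] by (simp only: distrib_left add_diff_add)
  moreover have "poly_fun (\<lambda>x. a x + b x)"
    using a(1) b(1) by (rule poly_fun.poly_fun_add)
  ultimately show ?case
    by blast
next
  case (poly_fun_mult u v)
  obtain a where a: "poly_fun a" "\<forall>x. u x - u (x - l x *s e) = l x * a x"
    using poly_fun_mult.IH(1) by blast
  obtain b where b: "poly_fun b" "\<forall>x. v x - v (x - l x *s e) = l x * b x"
    using poly_fun_mult.IH(2) by blast
  have v': "poly_fun (\<lambda>x. v (x - l x *s e))"
    by (rule poly_fun_compose[OF poly_fun_mult.hyps(2)])
      (rule form_fun_poly_fun[OF form_fun_shift[OF l]])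
  have "u x * v x - u (x - l x *s e) * v (x - l x *s e)
      = l x * (u x * b x + a x * v (x - l x *s e))" for x
  proof -
    have "u x * v x - u (x - l x *s e) * v (x - l x *s e)
      = u x * (v x - v (x - l x *s e)) + (u x - u (x - l x *s e)) * v (x - l x *s e)"
      by (simp add: algebra_simps)
    then show ?thesis
      unfolding a(2)[rule_format, of x] b(2)[rule_format, of x]
      by (simp only: distrib_left mult.assoc mult.left_commute)
  qed
  moreover have "poly_fun (\<lambda>x. u x * b x + a x * v (x - l x *s e))"
    by (rule poly_fun_add; rule poly_fun.poly_fun_mult) (rule poly_fun_mult.hyps a(1) b(1) v')+
  ultimately show ?case
    by blast
qed

text \<open>Scaling by 0 compares every value with the one at the origin, because
  \<open>0 ^ 0 = 1\<close>.\<close>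

lemma form_fun_0_constant: "form_fun 0 u \<Longrightarrow> u x = u y"
  using form_fun_scale[of 0 u 0 x] form_fun_scale[of 0 u 0 y] by simp

text \<open>In a product of degree 1, either some factor has negative degree and is zero, or one
  factor is constant and the other linear. The induction therefore keeps the degree
  variable.\<close>

lemma linear_form_fun_add_scale:
  assumes "form_fun 1 l"
  shows "l (x + c *s y) = l x + c * l y"
proof -
  have "l (x + c *s y) = l x + c * l y" if "form_fun k l" "k = 1" for k
    using that
  proof (induction arbitrary: x y c rule: form_fun.induct)
    case (form_fun_add k u v)
    show ?case
      unfolding form_fun_add.IH[OF form_fun_add.prems] by (simp add: distrib_left)
  next
    case (form_fun_mult k u j v)
    consider "k < 0" | "j < 0" | "k = 0" "j = 1" | "k = 1" "j = 0"
      using form_fun_mult.prems by linarith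
    then show ?case
    proof cases
      case 1
      then show ?thesis using form_fun_neg[OF form_fun_mult.hyps(1)] by simp
    next
      case 2
      then show ?thesis using form_fun_neg[OF form_fun_mult.hyps(2)] by simp
    next
      case 3
      then have "u x = u 0" "u y = u 0" "u (x + c *s y) = u 0"
        using form_fun_0_constant form_fun_mult.hyps(1) by blast+
      then show ?thesis
        unfolding form_fun_mult.IH(2)[OF 3(2)] by (simp add: distrib_left)
    next
      case 4
      then have "v x = v 0" "v y = v 0" "v (x + c *s y) = v 0"
        using form_fun_0_constant form_fun_mult.hyps(2) by blast+
      then show ?thesis
        unfolding form_fun_mult.IH(1)[OF 4(1)] by (simp add: distrib_right mult.assoc)
    qed
  qed simp_all
  then show ?thesis
    using assms by blast
qed

lemma linear_form_fun_kernel_shift: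
  assumes "form_fun 1 l" "l e = 1"
  shows "l (x - l x *s e) = 0"
  using linear_form_fun_add_scale[OF assms(1), of x "- l x" e] assms(2)
  by (simp add: vec.scale_minus_left)

lemma linear_form_fun_normalize:
  assumes "form_fun 1 l" "l e \<noteq> 0"
  obtains e' where "l e' = 1"
proof
  show "l (inverse (l e) *s e) = 1"
    using form_fun_scale[OF assms(1)] assms(2) by simp
qed

text \<open>The factor theorem for a nonzero linear form: the remainder
  \<open>u (x - l x *s e')\<close> is a value of \<open>u\<close> on the kernel of \<open>l\<close>,
  hence zero.\<close>

lemma form_fun_divisible:
  assumes "form_fun k u" "form_fun 1 l" "l e \<noteq> 0" "\<And>x. l x = 0 \<Longrightarrow> u x = 0"
  obtains b where "form_fun (k - 1) b" "\<And>x. u x = l x * b x"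
proof -
  obtain e' where e': "l e' = 1"
    using linear_form_fun_normalize assms by blast
  obtain b where "form_fun (k - 1) b" "\<forall>x. u x - u (x - l x *s e') = l x * b x"
    using form_fun_shift_diff[OF assms(1,2)] by blast
  then show ?thesis
    using that assms(4) linear_form_fun_kernel_shift[OF assms(2) e'] by simp
qed

lemma poly_fun_divisible:
  assumes "poly_fun u" "form_fun 1 l" "l e \<noteq> 0" "\<And>x. l x = 0 \<Longrightarrow> u x = 0"
  obtains b where "poly_fun b" "\<And>x. u x = l x * b x"
proof -
  obtain e' where e': "l e' = 1"
    using linear_form_fun_normalize assms by blast
  obtain b where "poly_fun b" "\<forall>x. u x - u (x - l x *s e') = l x * b x"
    using poly_fun_shift_diff[OF assms(1,2)] by blast
  then show ?thesis
    using that assms(4) linear_form_fun_kernel_shift[OF assms(2) e'] by simp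
qed

section \<open>Absence of zero divisors, and primality of linear forms\<close>

lemma poly_fun_on_line:
  "poly_fun u \<Longrightarrow> \<exists>p. \<forall>t. u (y + t *s z) = poly p t"
proof (induction rule: poly_fun.induct)
  case (poly_fun_const c)
  show ?case by (rule exI[of _ "[:c:]"]) auto
next
  case (poly_fun_coord i)
  show ?case by (rule exI[of _ "[:y $ i, z $ i:]"]) auto
next
  case (poly_fun_add u v)
  then show ?case by (metis poly_add)
next
  case (poly_fun_mult u v)
  then show ?case by (metis poly_mult)
qed

text \<open>On the line through a point where \<open>u\<close> is nonzero and a point where
  \<open>v\<close> is nonzero, both restrict to nonzero univariate polynomials, and their product
  cannot vanish everywhere on an infinite field.\<close>

lemma poly_fun_mult_eq_0:
  fixes u v :: "'a::field ^ 'n::finite \<Rightarrow> 'a"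
  assumes inf: "infinite (UNIV :: 'a set)" and "poly_fun u" "poly_fun v" "\<And>x. u x * v x = 0"
  shows "(\<forall>x. u x = 0) \<or> (\<forall>x. v x = 0)"
proof (rule ccontr)
  assume "\<not> ?thesis"
  then obtain y z where yz: "u y \<noteq> 0" "v z \<noteq> 0"
    by auto
  obtain p where p: "\<forall>t. u (y + t *s (z - y)) = poly p t"
    using poly_fun_on_line[OF assms(2)] by blast
  obtain r where r: "\<forall>t. v (y + t *s (z - y)) = poly r t"
    using poly_fun_on_line[OF assms(3)] by blast
  have "poly (p * r) t = 0" for t
    using assms(4) p r by (metis poly_mult)
  then have "p * r = 0"
    using inf poly_roots_finite[of "p * r"] by (metis (mono_tags, lifting) UNIV_eq_I mem_Collect_eq)
  moreover have "poly p 0 \<noteq> 0"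
    using p[rule_format, of 0] yz by simp
  moreover have "poly r 1 \<noteq> 0"
    using r[rule_format, of 1] yz by simp
  ultimately show False
    by auto
qed

text \<open>A linear form is prime.\<close>

lemma poly_fun_mult_eq_0_on_kernel:
  fixes u v :: "'a::field ^ 'n::finite \<Rightarrow> 'a"
  assumes inf: "infinite (UNIV :: 'a set)" and uv: "poly_fun u" "poly_fun v"
    and l: "form_fun 1 l" "l e \<noteq> 0" and "\<And>x. l x = 0 \<Longrightarrow> u x * v x = 0"
  shows "(\<forall>x. l x = 0 \<longrightarrow> u x = 0) \<or> (\<forall>x. l x = 0 \<longrightarrow> v x = 0)"
proof -
  obtain e' where e': "l e' = 1"
    using linear_form_fun_normalize l by blast
  \<comment> \<open>Composition with the projection to the kernel of \<open>l\<close> along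
    \<open>e'\<close> turns vanishing on the kernel into vanishing everywhere.\<close>
  have "poly_fun (\<lambda>x. u (x - l x *s e'))" "poly_fun (\<lambda>x. v (x - l x *s e'))"
    using uv l by (auto intro!: poly_fun_compose form_fun_poly_fun[OF form_fun_shift]
        simp del: vector_minus_component)
  from poly_fun_mult_eq_0[OF inf this]
  have "(\<forall>x. u (x - l x *s e') = 0) \<or> (\<forall>x. v (x - l x *s e') = 0)"
    using assms(6) linear_form_fun_kernel_shift[OF l(1) e'] by blast
  moreover have "x - l x *s e' = x" if "l x = 0" for x
    using that by simp
  ultimately show ?thesis
    by metis
qed

subsection \<open>Polynomials and polynomial functions\<close>

lemma mpoly_eval_superset:
  assumes "finite A" "Poly_Mapping.keys f \<subseteq> A"
  shows "mpoly_eval f v =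
    (\<Sum>m\<in>A. Poly_Mapping.lookup f m * (\<Prod>i\<in>UNIV. v $ i ^ Poly_Mapping.lookup m i))"
  unfolding mpoly_eval_def
  by (rule sum.mono_neutral_left) (use assms in \<open>auto simp: in_keys_iff\<close>)

lemma mpoly_eval_zero [simp]: "mpoly_eval 0 v = 0"
  by (simp add: mpoly_eval_def)

lemma mpoly_eval_add: "mpoly_eval (f + g) v = mpoly_eval f v + mpoly_eval g v"
proof -
  let ?A = "Poly_Mapping.keys f \<union> Poly_Mapping.keys g"
  have "Poly_Mapping.keys (f + g) \<subseteq> ?A"
    by (rule Poly_Mapping.keys_add)
  then show ?thesis
    by (simp add: mpoly_eval_superset[of ?A] lookup_add algebra_simps sum.distrib)
qed

lemma mpoly_eval_single:
  "mpoly_eval (Poly_Mapping.single m c) v = c * (\<Prod>i\<in>UNIV. v $ i ^ Poly_Mapping.lookup m i)"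
  by (subst mpoly_eval_superset[of "{m}"]) auto

lemma mpoly_induct [case_names zero single add]:
  fixes f :: "('a::field, 'n::finite) mpoly"
  assumes "P 0" "\<And>m c. P (Poly_Mapping.single m c)" "\<And>f g. P f \<Longrightarrow> P g \<Longrightarrow> P (f + g)"
  shows "P f"
proof (induction f rule: Poly_Mapping.update_induct)
  case const
  then show ?case by (rule assms(1))
next
  case (update f a b)
  have "Poly_Mapping.update a b f = f + Poly_Mapping.single a b"
    using update by (intro poly_mapping_eqI)
      (auto simp: lookup_add lookup_update lookup_single when_def in_keys_iff)
  then show ?case
    using update assms(2,3) by simp
qed

lemma mpoly_eval_mult: "mpoly_eval (f * g) v = mpoly_eval f v * mpoly_eval g v"
proof (induction f rule: mpoly_induct)
  case (single m c)
  show ?case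
  proof (induction g rule: mpoly_induct)
    case (single n d)
    show ?case
      by (simp add: mult_single mpoly_eval_single lookup_add power_add prod.distrib)
  qed (auto simp: algebra_simps mpoly_eval_add)
qed (auto simp: algebra_simps mpoly_eval_add)

lemma form_fun_mpoly_eval: "is_form k f \<Longrightarrow> form_fun (int k) (mpoly_eval f)"
proof -
  assume f: "is_form k f"
  have "form_fun (int k) (\<lambda>v. Poly_Mapping.lookup f m * (\<Prod>i\<in>UNIV. v $ i ^ Poly_Mapping.lookup m i))"
    if "m \<in> Poly_Mapping.keys f" for m
  proof -
    have k: "k = (\<Sum>i\<in>UNIV. Poly_Mapping.lookup m i)"
      using f that by (simp add: is_form_def)
    have "form_fun (\<Sum>i\<in>UNIV. int (Poly_Mapping.lookup m i) * 1)
        (\<lambda>v. \<Prod>i\<in>UNIV. v $ i ^ Poly_Mapping.lookup m i)"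
      by (intro form_fun_prod form_fun_power form_fun_coord)
    then show ?thesis
      unfolding k by (intro form_fun_cmult) simp
  qed
  then show ?thesis
    unfolding mpoly_eval_def[abs_def] by (rule form_fun_sum)
qed

lemma form_fun_imp_mpoly_eval:
  fixes u :: "'a::field ^ 'n::finite \<Rightarrow> 'a"
  assumes "form_fun (int k) u"
  obtains f where "is_form k f" "mpoly_eval f = u"
proof -
  \<comment> \<open>The degree stays an integer, since the factors of a form may have negative
    degree; the condition on the exponents then forces the zero polynomial.\<close>
  have "\<exists>f. (\<forall>m\<in>Poly_Mapping.keys f. int (\<Sum>i\<in>UNIV. Poly_Mapping.lookup m i) = j) \<and> mpoly_eval f = v"
    if "form_fun j v" for j and v :: "'a ^ 'n \<Rightarrow> 'a"
    using that
  proof (induction rule: form_fun.induct)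
    case (form_fun_zero k)
    then show ?case by (intro exI[of _ 0]) auto
  next
    case (form_fun_const c)
    then show ?case
      by (intro exI[of _ "Poly_Mapping.single 0 c"]) (auto simp: mpoly_eval_single split: if_splits)
  next
    case (form_fun_coord i)
    have "(\<Sum>j\<in>UNIV. Poly_Mapping.lookup (Poly_Mapping.single i (1::nat)) j) = 1"
      by (simp add: lookup_single when_def)
    moreover have "(\<Prod>j\<in>UNIV. v $ j ^ Poly_Mapping.lookup (Poly_Mapping.single i (1::nat)) j) = v $ i"
      for v :: "'a ^ 'n"
      by (simp add: lookup_single when_def if_distrib[of "power _"] prod.delta cong: if_cong)
    ultimately show ?case
      by (intro exI[of _ "Poly_Mapping.single (Poly_Mapping.single i 1) 1"])
        (auto simp: mpoly_eval_single split: if_splits simp flip: of_nat_sum)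
  next
    case (form_fun_add k u v)
    then obtain f g where
      "\<forall>m\<in>Poly_Mapping.keys f. int (\<Sum>i\<in>UNIV. Poly_Mapping.lookup m i) = k" "mpoly_eval f = u"
      "\<forall>m\<in>Poly_Mapping.keys g. int (\<Sum>i\<in>UNIV. Poly_Mapping.lookup m i) = k" "mpoly_eval g = v"
      by blast
    then show ?case
      using Poly_Mapping.keys_add[of f g]
      by (intro exI[of _ "f + g"]) (auto simp: mpoly_eval_add fun_eq_iff)
  next
    case (form_fun_mult k u l v)
    then obtain f g where fg:
      "\<forall>m\<in>Poly_Mapping.keys f. int (\<Sum>i\<in>UNIV. Poly_Mapping.lookup m i) = k" "mpoly_eval f = u"
      "\<forall>m\<in>Poly_Mapping.keys g. int (\<Sum>i\<in>UNIV. Poly_Mapping.lookup m i) = l" "mpoly_eval g = v"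
      by blast
    have "int (\<Sum>i\<in>UNIV. Poly_Mapping.lookup m i) = k + l" if m: "m \<in> Poly_Mapping.keys (f * g)" for m
    proof -
      obtain a b where "a \<in> Poly_Mapping.keys f" "b \<in> Poly_Mapping.keys g" "m = a + b"
        using m Poly_Mapping.keys_mult[of f g] by blast
      then show ?thesis
        using fg(1,3) by (auto simp: lookup_add sum.distrib)
    qed
    then show ?case
      using fg(2,4) by (intro exI[of _ "f * g"]) (auto simp: mpoly_eval_mult fun_eq_iff)
  qed
  from this[OF assms] obtain f where
    "\<forall>m\<in>Poly_Mapping.keys f. int (\<Sum>i\<in>UNIV. Poly_Mapping.lookup m i) = int k" "mpoly_eval f = u"
    by blast
  then show ?thesis
    using that unfolding is_form_def by (metis of_nat_eq_iff)
qed

lemma poly_fun_mpoly_eval: "poly_fun (mpoly_eval f)"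
proof (induction f rule: mpoly_induct)
  case zero
  then show ?case using poly_fun_const[of 0] by (simp add: mpoly_eval_def[abs_def])
next
  case (single m c)
  have "poly_fun (\<lambda>v. v $ i ^ n)" for i n
    using form_fun_poly_fun[OF form_fun_power[OF form_fun_coord]] .
  then show ?case
    unfolding mpoly_eval_single[abs_def] by (intro poly_fun_mult poly_fun_const poly_fun_prod)
next
  case (add f g)
  then show ?case
    using poly_fun_add[OF add] by (simp add: mpoly_eval_add[abs_def])
qed

lemma poly_fun_imp_mpoly_eval:
  fixes u :: "'a::field ^ 'n::finite \<Rightarrow> 'a"
  assumes "poly_fun u"
  obtains f where "mpoly_eval f = u"
proof -
  from assms have "\<exists>f. mpoly_eval f = u"
  proof (induction rule: poly_fun.induct)
    case (poly_fun_const c)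
    then show ?case using form_fun_imp_mpoly_eval[of 0] form_fun_const by (metis of_nat_0)
  next
    case (poly_fun_coord i)
    then show ?case using form_fun_imp_mpoly_eval[of 1] form_fun_coord by (metis of_nat_1)
  next
    case (poly_fun_add u v)
    then show ?case by (metis (no_types) mpoly_eval_add[abs_def])
  next
    case (poly_fun_mult u v)
    then show ?case by (metis (no_types) mpoly_eval_mult[abs_def])
  qed
  then show ?thesis
    using that by blast
qed

text \<open>Substituting \<open>t ^ w i\<close> for the variables, with weights \<open>w i\<close> that separate the monomials of
  \<open>f\<close>, turns \<open>f\<close> into a univariate polynomial with the same coefficients. The weights are powers of
  a number that is not a root of any difference of two monomials, read as a polynomial.\<close>

lemma separating_weights:
  fixes A :: "('n::finite \<Rightarrow>\<^sub>0 nat) set"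
  assumes "finite A"
  obtains w :: "'n \<Rightarrow> nat" where "inj_on (\<lambda>m. \<Sum>i\<in>UNIV. w i * Poly_Mapping.lookup m i) A"
proof -
  obtain e :: "'n \<Rightarrow> nat" where e: "inj e"
    using finite_imp_inj_to_nat_seg[of "UNIV :: 'n set"] by auto
  define P :: "('n \<Rightarrow>\<^sub>0 nat) \<Rightarrow> int poly" where
    "P m = (\<Sum>i\<in>UNIV. monom (int (Poly_Mapping.lookup m i)) (e i))" for m
  have cf: "Polynomial.coeff (P m) (e i) = int (Poly_Mapping.lookup m i)" for m i
    using e by (simp add: P_def coeff_sum coeff_monom inj_eq)
  have "P m \<noteq> P n" if "m \<noteq> n" for m n
    using that cf by (metis of_nat_eq_iff poly_mapping_eqI)
  then have "finite {x. poly (P m - P n) x = 0}" if "m \<noteq> n" for m n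
    using that poly_roots_finite by (metis right_minus_eq)
  then have "finite (\<Union>m\<in>A. \<Union>n\<in>A - {m}. {x. poly (P m - P n) x = 0})"
    using assms by (intro finite_UN_I) auto
  then have "finite (int -` (\<Union>m\<in>A. \<Union>n\<in>A - {m}. {x. poly (P m - P n) x = 0}))"
    by (rule finite_vimageI) (auto simp: inj_def)
  then obtain x :: nat where
    x: "x \<notin> int -` (\<Union>m\<in>A. \<Union>n\<in>A - {m}. {x. poly (P m - P n) x = 0})"
    using ex_new_if_finite infinite_UNIV_nat by blast
  have ev: "poly (P m) (int x) = int (\<Sum>i\<in>UNIV. x ^ e i * Poly_Mapping.lookup m i)" for m
    by (simp add: P_def poly_sum poly_monom mult.commute)
  have "inj_on (\<lambda>m. \<Sum>i\<in>UNIV. x ^ e i * Poly_Mapping.lookup m i) A"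
  proof (rule inj_onI, rule ccontr)
    fix m n assume "m \<in> A" "n \<in> A" "m \<noteq> n"
      "(\<Sum>i\<in>UNIV. x ^ e i * Poly_Mapping.lookup m i) = (\<Sum>i\<in>UNIV. x ^ e i * Poly_Mapping.lookup n i)"
    then have "poly (P m - P n) (int x) = 0"
      by (simp only: poly_diff ev)
    then show False
      using x \<open>m \<in> A\<close> \<open>n \<in> A\<close> \<open>m \<noteq> n\<close> by blast
  qed
  then show ?thesis
    by (rule that)
qed

lemma mpoly_eval_eq_0_imp:
  fixes f :: "('a::field, 'n::finite) mpoly"
  assumes inf: "infinite (UNIV :: 'a set)" and "\<And>v. mpoly_eval f v = 0"
  shows "f = 0"
proof -
  obtain w :: "'n \<Rightarrow> nat" where
    w: "inj_on (\<lambda>m. \<Sum>i\<in>UNIV. w i * Poly_Mapping.lookup m i) (Poly_Mapping.keys f)"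
    using separating_weights[OF finite_keys] by blast
  define s where "s = (\<lambda>m :: 'n \<Rightarrow>\<^sub>0 nat. \<Sum>i\<in>UNIV. w i * Poly_Mapping.lookup m i)"
  define p where "p = (\<Sum>m\<in>Poly_Mapping.keys f. monom (Poly_Mapping.lookup f m) (s m))"
  have "poly p t = mpoly_eval f (\<chi> i. t ^ w i)" for t
    by (simp add: p_def s_def mpoly_eval_def poly_sum poly_monom power_sum power_mult)
  then have "p = 0"
    using assms poly_roots_finite[of p] by (metis (mono_tags, lifting) UNIV_eq_I mem_Collect_eq)
  have "Poly_Mapping.lookup f m = 0" if m: "m \<in> Poly_Mapping.keys f" for m
  proof -
    have "Polynomial.coeff p (s m) = (\<Sum>n\<in>Poly_Mapping.keys f. if n = m then Poly_Mapping.lookup f n else 0)"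
      unfolding p_def coeff_sum coeff_monom
      using w m by (intro sum.cong) (auto simp: s_def inj_on_def)
    then show ?thesis
      using m \<open>p = 0\<close> by simp
  qed
  then show ?thesis
    by (metis in_keys_iff lookup_zero poly_mapping_eqI)
qed

lemma mpoly_eval_inject:
  fixes f g :: "('a::field, 'n::finite) mpoly"
  assumes inf: "infinite (UNIV :: 'a set)" and "mpoly_eval f = mpoly_eval g"
  shows "f = g"
proof -
  have "mpoly_eval (f - g) v = 0" for v
    using mpoly_eval_add[of "f - g" g v] assms(2) by simp
  then show ?thesis
    using mpoly_eval_eq_0_imp[OF inf, of "f - g"] by simp
qed

section \<open>Rational vectors and functionals\<close>

text \<open>Functionals are given by coefficient vectors, so that \<open>ext\<close> extends them to
  the closure in the same way as points.\<close>

definition dot :: "'a::comm_ring_1 ^ 'n \<Rightarrow> 'a ^ 'n \<Rightarrow> 'a" where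
  "dot a x = (\<Sum>i\<in>UNIV. a $ i * x $ i)"

definition ext :: "'f::field ^ 'n \<Rightarrow> 'f alg_closure ^ 'n" where
  "ext v = (\<chi> i. to_ac (v $ i))"

lemma dot_add_right [simp]: "dot a (x + y) = dot a x + dot a y"
  by (simp add: dot_def algebra_simps sum.distrib)

lemma dot_diff_right [simp]: "dot a (x - y) = dot a x - dot a y"
  by (simp add: dot_def algebra_simps sum_subtractf)

lemma dot_scale_right [simp]: "dot a (c *s x) = c * dot a x"
  by (simp add: dot_def algebra_simps sum_distrib_left)

lemma dot_diff_left [simp]: "dot (a - b) x = dot a x - dot b x"
  by (simp add: dot_def algebra_simps sum_subtractf)

lemma dot_scale_left [simp]: "dot (c *s a) x = c * dot a x"
  by (simp add: dot_def algebra_simps sum_distrib_left)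

lemma dot_zero_right [simp]: "dot a 0 = 0"
  by (simp add: dot_def)

lemma dot_zero_left [simp]: "dot 0 x = 0"
  by (simp add: dot_def)

lemma dot_sum_right: "dot a (\<Sum>b\<in>B. x b) = (\<Sum>b\<in>B. dot a (x b))"
  by (induction B rule: infinite_finite_induct) auto

lemma ext_nth [simp]: "ext v $ i = to_ac (v $ i)"
  by (simp add: ext_def)

lemma ext_add [simp]: "ext (v + w) = ext v + ext w"
  by (simp add: vec_eq_iff)

lemma ext_diff [simp]: "ext (v - w) = ext v - ext w"
  by (simp add: vec_eq_iff)

lemma ext_scale [simp]: "ext (c *s v) = to_ac c *s ext v"
  by (simp add: vec_eq_iff)

lemma ext_zero [simp]: "ext 0 = 0"
  by (simp add: vec_eq_iff)

lemma ext_eq_iff [simp]: "ext v = ext w \<longleftrightarrow> v = w"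
  by (simp add: vec_eq_iff)

lemma ext_eq_0_iff [simp]: "ext v = 0 \<longleftrightarrow> v = 0"
  by (simp add: vec_eq_iff)

lemma dot_ext [simp]: "dot (ext a) (ext x) = to_ac (dot a x)"
  by (simp add: dot_def to_ac_sum)

text \<open>The dual basis, as coefficient vectors: the entries of \<open>\<phi> b\<close> are the
  \<open>b\<close>-coordinates of the standard unit vectors.\<close>

lemma coordinate_functionals:
  fixes B :: "('a::field ^ 'n) set"
  assumes B: "vec.independent B" "vec.span B = UNIV"
  obtains \<phi> :: "'a ^ 'n \<Rightarrow> 'a ^ 'n" where "\<And>x. x = (\<Sum>b\<in>B. dot (\<phi> b) x *s b)"
    "\<And>b c. b \<in> B \<Longrightarrow> c \<in> B \<Longrightarrow> dot (\<phi> b) c = (if b = c then 1 else 0)"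
proof
  define \<phi> :: "'a ^ 'n \<Rightarrow> 'a ^ 'n" where "\<phi> b = (\<chi> i. vec.representation B (axis i 1) b)" for b
  have fin: "finite B"
    using B(1) vec.finiteI_independent by blast
  have rep: "dot (\<phi> b) x = vec.representation B x b" for b x
  proof -
    have "vec.representation B x b = vec.representation B (\<Sum>i\<in>UNIV. x $ i *s axis i 1) b"
      by (simp add: basis_expansion)
    also have "\<dots> = (\<Sum>i\<in>UNIV. vec.representation B (x $ i *s axis i 1) b)"
      using B by (subst vec.representation_sum) auto
    also have "\<dots> = (\<Sum>i\<in>UNIV. x $ i * vec.representation B (axis i 1) b)"
      using B by (subst vec.representation_scale) auto
    finally show ?thesis
      by (simp add: dot_def \<phi>_def mult.commute)
  qed
  show "x = (\<Sum>b\<in>B. dot (\<phi> b) x *s b)" for x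
    unfolding rep using vec.sum_representation_eq[of B x B] B fin by simp
  show "dot (\<phi> b) c = (if b = c then 1 else 0)" if "b \<in> B" "c \<in> B" for b c
    unfolding rep using vec.representation_basis[OF B(1) that(2)] by auto
qed

text \<open>The expansion is equivalent to a matrix identity between base field elements, and
  \<open>to_ac\<close> preserves it.\<close>

lemma ext_coordinates:
  fixes \<phi> :: "'f::field ^ 'n \<Rightarrow> 'f ^ 'n"
  assumes "\<And>x. x = (\<Sum>b\<in>B. dot (\<phi> b) x *s b)"
  shows "y = (\<Sum>b\<in>B. dot (ext (\<phi> b)) y *s ext b)"
proof -
  have "(\<Sum>b\<in>B. to_ac (\<phi> b $ j) * to_ac (b $ i)) = (if i = j then 1 else 0)" for i j
  proof -
    have "(\<Sum>b\<in>B. \<phi> b $ j * b $ i) = (\<Sum>b\<in>B. dot (\<phi> b) (axis j 1) *s b) $ i"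
      by (simp add: dot_def axis_def if_distrib[of "(*) _"] cong: if_cong)
    also have "\<dots> = axis j 1 $ i"
      using assms[of "axis j 1"] by simp
    finally show ?thesis
      by (simp add: axis_def flip: to_ac_sum to_ac_mult)
  qed
  note delta = this
  have "(\<Sum>b\<in>B. dot (ext (\<phi> b)) y *s ext b) $ i = y $ i" for i
  proof -
    have "(\<Sum>b\<in>B. dot (ext (\<phi> b)) y *s ext b) $ i
        = (\<Sum>b\<in>B. \<Sum>j\<in>UNIV. y $ j * (to_ac (\<phi> b $ j) * to_ac (b $ i)))"
      by (simp add: dot_def sum_distrib_left sum_distrib_right algebra_simps)
    also have "\<dots> = (\<Sum>j\<in>UNIV. y $ j * (\<Sum>b\<in>B. to_ac (\<phi> b $ j) * to_ac (b $ i)))"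
      by (subst sum.swap) (simp add: sum_distrib_left)
    also have "\<dots> = y $ i"
      by (simp add: delta if_distrib[of "(*) _"] cong: if_cong)
    finally show ?thesis .
  qed
  then show ?thesis
    by (simp add: vec_eq_iff)
qed

text \<open>A basis \<open>v\<close>, \<open>w\<close> of \<open>L\<close> is extended to one of the
  whole space. Of the dual basis, \<open>s\<close>, \<open>t\<close> belong to \<open>v\<close>,
  \<open>w\<close> and give coordinates on \<open>L\<close>, while \<open>m\<close>,
  \<open>n\<close> belong to the two new vectors and are the equations of \<open>L\<close>. The last
  clause is the decomposition over the closure.\<close>

lemma proj_line_coordinates:
  fixes L :: "('f::field ^ 4) set"
  assumes "L \<in> proj_lines"
  obtains v w s t m n :: "'f ^ 4" where
    "L = vec.span {v, w}" "\<And>x. x \<in> L \<longleftrightarrow> dot m x = 0 \<and> dot n x = 0"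
    "\<And>a b. a *s m = b *s n \<Longrightarrow> a = 0 \<and> b = 0"
    "dot s v = 1" "dot s w = 0" "dot t v = 0" "dot t w = 1"
    "\<And>y. dot (ext m) y = 0 \<Longrightarrow> dot (ext n) y = 0 \<Longrightarrow>
       y = dot (ext s) y *s ext v + dot (ext t) y *s ext w"
proof -
  have L: "vec.subspace L" "vec.dim L = 2"
    using assms by (auto simp: proj_lines_def)
  obtain B where B: "B \<subseteq> L" "vec.independent B" "L \<subseteq> vec.span B" "card B = 2"
    using vec.basis_exists[of L] L(2) by metis
  then have spB: "L = vec.span B"
    by (metis L(1) antisym vec.span_minimal)
  obtain v w where vw: "B = {v, w}" "v \<noteq> w"
    using B(4) by (auto simp: card_2_iff)
  define C where "C = vec.extend_basis B"
  have C: "B \<subseteq> C" "vec.independent C" "vec.span C = UNIV"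
    unfolding C_def using B(2)
    by (auto simp: vec.extend_basis_superset vec.independent_extend_basis)
  have finC: "finite C"
    using C(2) vec.finiteI_independent by blast
  have "card C = 4"
    using vec.dim_span_eq_card_independent[OF C(2)] unfolding C(3) vec_dim_card by simp
  then have "card (C - B) = 2"
    using C(1) B(4) finC by (simp add: card_Diff_subset finite_subset)
  then obtain c d where cd: "C - B = {c, d}" "c \<noteq> d"
    by (auto simp: card_2_iff)
  have C_eq: "C = {v, w, c, d}"
    using cd vw C(1) by auto
  have ne: "v \<noteq> c" "v \<noteq> d" "w \<noteq> c" "w \<noteq> d"
    using cd vw by auto
  obtain \<phi> where \<phi>: "\<And>x. x = (\<Sum>b\<in>C. dot (\<phi> b) x *s b)"
    "\<And>b c. b \<in> C \<Longrightarrow> c \<in> C \<Longrightarrow> dot (\<phi> b) c = (if b = c then 1 else 0)"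
    using coordinate_functionals[OF C(2,3)] by blast
  have sum_C: "(\<Sum>b\<in>C. g b) = g v + g w + g c + g d" for g :: "_ \<Rightarrow> 'b::comm_monoid_add"
    using ne vw(2) cd(2) by (simp add: C_eq add.assoc)
  show thesis
  proof (rule that)
    show "L = vec.span {v, w}"
      using spB vw by simp
    show "x \<in> L \<longleftrightarrow> dot (\<phi> c) x = 0 \<and> dot (\<phi> d) x = 0" for x
    proof
      assume "x \<in> L"
      then obtain a b where "x = a *s v + b *s w"
        unfolding spB vw by (auto simp: vec.span_insert eq_diff_eq algebra_simps vec.span_singleton)
      then show "dot (\<phi> c) x = 0 \<and> dot (\<phi> d) x = 0"
        using \<phi>(2) ne by (simp add: C_eq)
    next
      assume "dot (\<phi> c) x = 0 \<and> dot (\<phi> d) x = 0"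
      then have "x = dot (\<phi> v) x *s v + dot (\<phi> w) x *s w"
        using \<phi>(1)[of x] unfolding sum_C by simp
      also have "\<dots> \<in> L"
        unfolding spB vw by (intro vec.span_add vec.span_scale vec.span_base) auto
      finally show "x \<in> L" .
    qed
    show "a = 0 \<and> b = 0" if "a *s \<phi> c = b *s \<phi> d" for a b
    proof -
      have "a * dot (\<phi> c) x = b * dot (\<phi> d) x" for x
        using arg_cong[OF that, of "\<lambda>z. dot z x"] by simp
      from this[of c] this[of d] show ?thesis
        using \<phi>(2) cd(2) by (simp add: C_eq)
    qed
    show "dot (\<phi> v) v = 1" "dot (\<phi> v) w = 0" "dot (\<phi> w) v = 0" "dot (\<phi> w) w = 1"
      using \<phi>(2) vw(2) by (auto simp: C_eq)
    show "y = dot (ext (\<phi> v)) y *s ext v + dot (ext (\<phi> w)) y *s ext w"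
      if "dot (ext (\<phi> c)) y = 0" "dot (ext (\<phi> d)) y = 0" for y
      using ext_coordinates[OF \<phi>(1), of y] that unfolding sum_C by simp
  qed
qed

section \<open>The Frobenius map\<close>

text \<open>Multiplication by \<open>a\<close> permutes the nonzero elements, so it leaves their
  product unchanged.\<close>

lemma finite_field_power_card: "(a :: 'f::{field,finite}) ^ CARD('f) = a"
proof (cases "a = 0")
  case False
  let ?U = "UNIV - {0 :: 'f}"
  have "(\<Prod>x\<in>?U. x) = (\<Prod>x\<in>?U. a * x)"
    by (rule prod.reindex_bij_witness[of _ "\<lambda>x. a * x" "\<lambda>x. inverse a * x"])
      (use False in \<open>auto simp: field_simps\<close>)
  also have "\<dots> = a ^ (CARD('f) - 1) * (\<Prod>x\<in>?U. x)"
    by (simp add: prod.distrib card_Diff_subset)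
  finally have "a ^ (CARD('f) - 1) = 1"
    by simp
  moreover have "CARD('f) = Suc (CARD('f) - 1)"
    by simp
  ultimately show ?thesis
    by (metis mult.right_neutral power_Suc)
qed (simp add: zero_power)

lemma card_range_to_ac: "card (range (to_ac :: 'f::{field,finite} \<Rightarrow> _)) = CARD('f)"
  by (rule card_image[OF inj_to_ac])

text \<open>For fixed \<open>y\<close>, the polynomial \<open>(X + y)^q - X^q - y^q\<close> has degree less than \<open>q\<close>, so it is
  zero if it vanishes on the field with \<open>q\<close> elements. This is applied first for rational \<open>y\<close>, and
  then, since the polynomial is symmetric in \<open>X\<close> and \<open>y\<close>, for all \<open>y\<close>.\<close>

lemma frobenius_add:
  fixes x y :: "'f::{field,finite} alg_closure"
  shows "(x + y) ^ CARD('f) = x ^ CARD('f) + y ^ CARD('f)"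
proof -
  let ?q = "CARD('f)"
  have step: "(x + y) ^ ?q = x ^ ?q + y ^ ?q"
    if *: "\<And>a :: 'f. (to_ac a + y) ^ ?q = to_ac a ^ ?q + y ^ ?q" for x y
  proof -
    define D where "D = [:y, 1:] ^ ?q - monom 1 ?q - [:y ^ ?q:]"
    have ev: "poly D x = (x + y) ^ ?q - x ^ ?q - y ^ ?q" for x
      by (simp add: D_def poly_monom add.commute)
    have deg: "degree ([:y, 1:] ^ ?q) = ?q" and "lead_coeff ([:y, 1:] ^ ?q) = 1"
      using lead_coeff_power[of "[:y, 1:]" ?q] by (simp_all add: degree_power_eq)
    then have "Polynomial.coeff D ?q = 0"
      by (simp add: D_def coeff_pCons split: nat.split)
    moreover have "degree D \<le> ?q"
      unfolding D_def using deg by (intro degree_diff_le) (auto simp: degree_monom_le)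
    ultimately have "degree D < ?q \<or> D = 0"
      by (metis le_neq_implies_less leading_coeff_0_iff)
    then have "D = 0"
    proof
      assume "degree D < ?q"
      then show ?thesis
        by (intro poly_eqI_degree[of "range (to_ac :: 'f \<Rightarrow> _)"])
          (use * in \<open>auto simp: ev card_range_to_ac\<close>)
    qed
    then show ?thesis
      using ev[of x] by (simp add: algebra_simps)
  qed
  have "(to_ac a + to_ac b) ^ ?q = to_ac a ^ ?q + to_ac b ^ ?q" for a b :: 'f
    by (metis finite_field_power_card to_ac_add to_ac_power)
  then have "(to_ac b + y) ^ ?q = to_ac b ^ ?q + y ^ ?q" for b :: 'f and y
    using step[of "to_ac b" y] by (simp add: add.commute)
  then show ?thesis
    by (rule step)
qed

text \<open>The polynomial \<open>X^q - X\<close> has at most \<open>q\<close> roots, and the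
  elements of the base field already are \<open>q\<close> roots.\<close>

lemma frobenius_fixed_imp_rational:
  fixes x :: "'f::{field,finite} alg_closure"
  assumes "x ^ CARD('f) = x"
  shows "x \<in> range to_ac"
proof (rule ccontr)
  assume x: "x \<notin> range (to_ac :: 'f \<Rightarrow> _)"
  let ?q = "CARD('f)"
  let ?P = "monom 1 ?q - [:0, 1:] :: 'f alg_closure poly"
  have "card {0, 1 :: 'f} \<le> ?q"
    by (rule card_mono) auto
  then have q: "?q \<ge> 2"
    by simp
  have "degree ?P \<le> ?q"
    using q by (intro degree_diff_le) (auto simp: degree_monom_le)
  moreover have "card (insert x (range (to_ac :: 'f \<Rightarrow> _))) = Suc ?q"
    using x by (simp add: card_range_to_ac)
  moreover have "poly ?P y = 0" if "y \<in> insert x (range to_ac)" for y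
    using that assms by (auto simp: poly_monom finite_field_power_card simp flip: to_ac_power)
  ultimately have "?P = 0"
    by (intro poly_eqI_degree[of "insert x (range to_ac)"]) auto
  then have "Polynomial.coeff ?P ?q = 0"
    by simp
  then show False
    using q by (simp add: coeff_pCons split: nat.splits)
qed

definition frob :: "'f::{field,finite} alg_closure ^ 'n \<Rightarrow> 'f alg_closure ^ 'n" where
  "frob v = (\<chi> i. v $ i ^ CARD('f))"

lemma frob_nth [simp]: "frob (v :: 'f::{field,finite} alg_closure ^ 'n) $ i = v $ i ^ CARD('f)"
  by (simp add: frob_def)

lemma frob_add: "frob (v + w) = frob v + frob w"
  by (simp add: vec_eq_iff frobenius_add)

lemma frob_scale:
  fixes v :: "'f::{field,finite} alg_closure ^ 'n"
  shows "frob (c *s v) = c ^ CARD('f) *s frob v"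
  by (simp add: vec_eq_iff power_mult_distrib)

lemma frobenius_sum:
  fixes x :: "'i \<Rightarrow> 'f::{field,finite} alg_closure"
  shows "(\<Sum>i\<in>A. x i) ^ CARD('f) = (\<Sum>i\<in>A. x i ^ CARD('f))"
  by (induction A rule: infinite_finite_induct) (auto simp: frobenius_add zero_power)

lemma dot_ext_frob:
  fixes y :: "'f::{field,finite} alg_closure ^ 'n"
  shows "dot (ext a) (frob y) = dot (ext a) y ^ CARD('f)"
  by (simp add: dot_def frobenius_sum power_mult_distrib finite_field_power_card flip: to_ac_power)

section \<open>Forms on the rational points of a projective line\<close>

text \<open>The \<open>q + 1\<close> rational points of the projective line are
  \<open>(t : 1)\<close> and \<open>(1 : 0)\<close>. Their linear forms are split off one at a time,
  since those already removed are nonzero at the remaining points.\<close>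

lemma form_fun_rational_roots:
  fixes u :: "'f::{field,finite} alg_closure ^ 2 \<Rightarrow> 'f alg_closure"
  assumes "form_fun k u" and "\<And>x. u (ext x) = 0"
  obtains v where "form_fun (k - int (CARD('f) + 1)) v"
    "\<And>c. u c = c $ 2 * (\<Prod>t\<in>UNIV. c $ 1 - to_ac (t :: 'f) * c $ 2) * v c"
proof -
  have step: "\<exists>v. form_fun (k - int (card T)) v \<and>
      (\<forall>c. u c = (\<Prod>t\<in>T. c $ 1 - to_ac t * c $ 2) * v c)" if "finite T" for T :: "'f set"
    using that
  proof induction
    case empty
    then show ?case
      using assms(1) by auto
  next
    case (insert t T)
    then obtain v where v: "form_fun (k - int (card T)) v"
      "\<And>c. u c = (\<Prod>t\<in>T. c $ 1 - to_ac t * c $ 2) * v c"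
      by blast
    let ?l = "\<lambda>c :: 'f alg_closure ^ 2. c $ 1 - to_ac t * c $ 2"
    have l: "form_fun 1 ?l"
      by (intro form_fun_diff form_fun_cmult form_fun_coord)
    let ?x = "vector [t, 1] :: 'f ^ 2"
    have "(\<Prod>s\<in>T. to_ac t - to_ac s) \<noteq> 0"
      using insert.hyps by auto
    moreover have "u (ext ?x) = (\<Prod>s\<in>T. to_ac t - to_ac s) * v (ext ?x)"
      by (simp add: v(2))
    ultimately have vx: "v (ext ?x) = 0"
      using assms(2) by auto
    have "v c = 0" if "?l c = 0" for c
    proof -
      have "c = c $ 2 *s ext ?x"
        using that by (auto simp: vec_eq_iff forall_2 algebra_simps)
      then have "v c = v (c $ 2 *s ext ?x)"
        by simp
      also have "\<dots> = 0"
        using form_fun_scale[OF v(1), of "c $ 2" "ext ?x"] form_fun_neg[OF v(1)] vx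
        by (cases "k - int (card T) \<ge> 0") (auto simp: not_le)
      finally show ?thesis .
    qed
    moreover have "?l (vector [1, 0]) \<noteq> 0"
      by simp
    ultimately obtain b where b: "form_fun (k - int (card T) - 1) b" "\<And>c. v c = ?l c * b c"
      using form_fun_divisible[OF v(1) l] by blast
    have "k - int (card (insert t T)) = k - int (card T) - 1"
      using insert.hyps by simp
    moreover have "u c = (\<Prod>t\<in>insert t T. c $ 1 - to_ac t * c $ 2) * b c" for c
      using b(2)[of c] v(2)[of c] insert.hyps by (simp add: mult_ac)
    ultimately show ?case
      using b(1) by metis
  qed
  obtain v where v: "form_fun (k - int CARD('f)) v"
    "\<And>c. u c = (\<Prod>t\<in>UNIV. c $ 1 - to_ac (t :: 'f) * c $ 2) * v c"
    using step[of UNIV] by auto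
  \<comment> \<open>The point at infinity, where every factor of the product is 1, accounts for the
    remaining factor \<open>c $ 2\<close>.\<close>
  let ?x = "vector [1, 0] :: 'f ^ 2"
  have vx: "v (ext ?x) = 0"
    using v(2)[of "ext ?x"] assms(2)[of ?x] by simp
  have "v c = 0" if "c $ 2 = 0" for c :: "'f alg_closure ^ 2"
  proof -
    have "c = c $ 1 *s ext ?x"
      using that by (auto simp: vec_eq_iff forall_2 algebra_simps)
    then have "v c = v (c $ 1 *s ext ?x)"
      by simp
    also have "\<dots> = 0"
      using form_fun_scale[OF v(1), of "c $ 1" "ext ?x"] form_fun_neg[OF v(1)] vx
      by (cases "k - int CARD('f) \<ge> 0") (auto simp: not_le)
    finally show ?thesis .
  qed
  moreover have "vector [0, 1 :: 'f alg_closure] $ (2 :: 2) \<noteq> 0"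
    by simp
  ultimately obtain b where b: "form_fun (k - int CARD('f) - 1) b" "\<And>c. v c = c $ 2 * b c"
    using form_fun_divisible[OF v(1) form_fun_coord[of 2]] by blast
  show thesis
  proof (rule that)
    show "form_fun (k - int (CARD('f) + 1)) b"
      using b(1) by (simp add: algebra_simps)
    show "u c = c $ 2 * (\<Prod>t\<in>UNIV. c $ 1 - to_ac (t :: 'f) * c $ 2) * b c" for c
      using v(2)[of c] b(2)[of c] by (simp add: mult_ac)
  qed
qed

section \<open>Projection of lines from a generic point\<close>

text \<open>The projection from \<open>p\<close> is taken to the plane \<open>x\<^sub>4 = 0\<close>, which is embedded by \<open>lift\<close>.\<close>

definition lift :: "'a::zero ^ 3 \<Rightarrow> 'a ^ 4" where
  "lift y = (\<chi> i. if i = 1 then y $ 1 else if i = 2 then y $ 2 else if i = 3 then y $ 3 else 0)"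

lemma lift_nth [simp]:
  "lift y $ 1 = y $ 1" "lift y $ 2 = y $ 2" "lift y $ 3 = y $ 3" "lift y $ 4 = 0"
  by (simp_all add: lift_def)

text \<open>The determinant of the three vectors, written out so that its identities reduce to ring
  arithmetic.\<close>

definition triple :: "'a::comm_ring_1 ^ 3 \<Rightarrow> 'a ^ 3 \<Rightarrow> 'a ^ 3 \<Rightarrow> 'a" where
  "triple u v w = u $ 1 * (v $ 2 * w $ 3 - v $ 3 * w $ 2) + u $ 2 * (v $ 3 * w $ 1 - v $ 1 * w $ 3)
    + u $ 3 * (v $ 1 * w $ 2 - v $ 2 * w $ 1)"

lemma form_fun_eq_0_at_0:
  assumes "form_fun k u" "u x = 0"
  shows "u 0 = 0"
  using form_fun_scale[OF assms(1), of 0 x] form_fun_neg[OF assms(1)] assms(2)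
  by (cases "k \<ge> 0") auto

text \<open>The condition \<open>p $ 4 = 1\<close> is a normalization: the plane where the last
  coordinate vanishes is rational, so it does not contain a generic point.\<close>

locale generic_vertex =
  fixes p :: "'f::{field,finite} alg_closure ^ 4"
  assumes p_4: "p $ 4 = 1"
    and generic: "dot (ext a) p = 0 \<Longrightarrow> a = 0"
begin

definition proj :: "'f alg_closure ^ 4 \<Rightarrow> 'f alg_closure ^ 3" where
  "proj x = (\<chi> i. if i = 1 then x $ 1 - x $ 4 * p $ 1 else if i = 2 then x $ 2 - x $ 4 * p $ 2
     else x $ 3 - x $ 4 * p $ 3)"

lemma proj_nth [simp]:
  "proj x $ 1 = x $ 1 - x $ 4 * p $ 1" "proj x $ 2 = x $ 2 - x $ 4 * p $ 2"
  "proj x $ 3 = x $ 3 - x $ 4 * p $ 3"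
  by (simp_all add: proj_def)

lemma proj_lift [simp]: "proj (lift y) = y"
  by (simp add: vec_eq_iff forall_3)

lemma lift_proj: "lift (proj x) = x - x $ 4 *s p"
  using p_4 by (simp add: vec_eq_iff forall_4)

lemma proj_add: "proj (x + y) = proj x + proj y"
  by (simp add: vec_eq_iff forall_3 algebra_simps)

lemma proj_diff: "proj (x - y) = proj x - proj y"
  by (simp add: vec_eq_iff forall_3 algebra_simps)

lemma proj_scale: "proj (c *s x) = c *s proj x"
  by (simp add: vec_eq_iff forall_3 algebra_simps)

lemma proj_zero [simp]: "proj 0 = 0"
  by (simp add: vec_eq_iff forall_3)

lemma proj_vertex [simp]: "proj p = 0"
  using p_4 by (simp add: vec_eq_iff forall_3)

lemma form_fun_dot_lift:
  fixes a :: "'f alg_closure ^ 4"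
  shows "form_fun 1 (\<lambda>y. dot a (lift y))"
proof -
  have "form_fun 1 (\<lambda>y :: 'f alg_closure ^ 3. a $ 1 * y $ 1 + a $ 2 * y $ 2 + a $ 3 * y $ 3)"
    by (intro form_fun_add form_fun_cmult form_fun_coord)
  then show ?thesis
    by (simp add: dot_def sum_4)
qed

text \<open>On \<open>proj x\<close> this form is, up to sign, the determinant of \<open>x\<close>, \<open>p\<close> and their images under
  Frobenius; for rational \<open>x\<close> it has two equal columns.\<close>

definition frob_form :: "'f alg_closure ^ 3 \<Rightarrow> 'f alg_closure" where
  "frob_form y = triple (proj (frob p)) y (frob y)"

lemma form_fun_frob_form: "form_fun (int (CARD('f) + 1)) frob_form"
proof -
  have frob: "form_fun (int CARD('f)) (\<lambda>y :: 'f alg_closure ^ 3. y $ i ^ CARD('f))" for i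
    using form_fun_power[OF form_fun_coord, of "CARD('f)" i] by simp
  have m: "form_fun (int (CARD('f) + 1)) (\<lambda>y :: 'f alg_closure ^ 3. y $ i * y $ j ^ CARD('f))" for i j
    by (rule form_fun_mult'[OF form_fun_coord frob]) simp
  show ?thesis
    unfolding frob_form_def[abs_def] triple_def frob_nth
    by (intro form_fun_add form_fun_cmult form_fun_diff m)
qed

text \<open>Frobenius fixes the projections of rational vectors modulo multiples of
  \<open>proj (frob p)\<close>, and \<open>frob_form\<close> does not see these multiples, as this
  vector is a column of its determinant.\<close>

lemma frob_proj_ext: "frob (proj (ext v)) = proj (ext v) - to_ac (v $ 4) *s proj (frob p)"
proof -
  have diff: "(x - to_ac c * y) ^ CARD('f) = x ^ CARD('f) - to_ac c * y ^ CARD('f)" for x y :: "'f alg_closure" and c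
    using frobenius_add[of "x - to_ac c * y" "to_ac c * y"]
    by (simp add: power_mult_distrib finite_field_power_card flip: to_ac_power)
  have "to_ac (v $ i) ^ CARD('f) = to_ac (v $ i)" for i
    by (simp add: finite_field_power_card flip: to_ac_power)
  then show ?thesis
    using p_4 by (simp add: vec_eq_iff forall_3 diff) (simp add: algebra_simps)
qed

text \<open>By \<open>frob_proj_ext\<close> the last two columns have coordinates
  \<open>(a, b)\<close> and \<open>(a^q, b^q)\<close> in the two projected vectors; the first factor
  is the determinant of these coordinates.\<close>

lemma frob_form_on_line:
  "frob_form (a *s proj (ext v) + b *s proj (ext w))
    = (a * b ^ CARD('f) - b * a ^ CARD('f)) * triple (proj (frob p)) (proj (ext v)) (proj (ext w))"
  unfolding frob_form_def frob_add frob_scale frob_proj_ext triple_def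
  by (simp add: algebra_simps del: proj_nth)

lemma frob_form_rational: "frob_form (proj (ext x)) = 0"
  using frob_form_on_line[of 1 x 0 x] by (simp add: power_0_left)

text \<open>All facts that the later arguments use about the image of \<open>L\<close>, so that its
  coordinates can be forgotten once such a form has been chosen. The last clause says that
  \<open>frob_form\<close> and \<open>l\<close> generate the ideal of the projected rational points
  of \<open>L\<close>.\<close>

definition is_line_form :: "('f ^ 4) set \<Rightarrow> ('f alg_closure ^ 3 \<Rightarrow> 'f alg_closure) \<Rightarrow> bool" where
  "is_line_form L l \<longleftrightarrow> form_fun 1 l \<and> (\<exists>e. l e \<noteq> 0) \<and> (\<forall>x. l (proj (ext x)) = 0 \<longleftrightarrow> x \<in> L) \<and>
     (\<exists>y. l y = 0 \<and> frob_form y \<noteq> 0) \<and>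
     (\<forall>k u. form_fun k u \<longrightarrow> (\<forall>x\<in>L. u (proj (ext x)) = 0) \<longrightarrow>
        (\<exists>a b. form_fun (k - int (CARD('f) + 1)) a \<and> form_fun (k - 1) b \<and>
           (\<forall>y. u y = a y * frob_form y + l y * b y)))"

lemma is_line_form_exists:
  assumes "L \<in> proj_lines"
  shows "\<exists>l. is_line_form L l"
proof -
  obtain v w s t m n where L: "L = vec.span {v, w}" "\<And>x. x \<in> L \<longleftrightarrow> dot m x = 0 \<and> dot n x = 0"
    and indep: "\<And>a b. a *s m = b *s n \<Longrightarrow> a = 0 \<and> b = 0"
    and dual: "dot s v = 1" "dot s w = 0" "dot t v = 0" "dot t w = 1"
    and decomp: "\<And>y. dot (ext m) y = 0 \<Longrightarrow> dot (ext n) y = 0 \<Longrightarrow>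
      y = dot (ext s) y *s ext v + dot (ext t) y *s ext w"
    by (rule proj_line_coordinates[OF assms]) (rule that; assumption)
  define \<alpha> \<beta> where "\<alpha> = dot (ext m) p" and "\<beta> = dot (ext n) p"
  have "m \<noteq> 0" "n \<noteq> 0"
    using indep[of 1 0] indep[of 0 1] by auto
  then have \<alpha>\<beta>: "\<alpha> \<noteq> 0" "\<beta> \<noteq> 0"
    unfolding \<alpha>_def \<beta>_def by (auto dest: generic)
  have vw: "dot m v = 0" "dot n v = 0" "dot m w = 0" "dot n w = 0"
    using L(2)[of v] L(2)[of w] unfolding L(1) by (auto simp: vec.span_base)

  \<comment> \<open>The combination of the two equations of \<open>L\<close> that vanishes at
    \<open>p\<close>: the equation of the join of \<open>L\<close> and \<open>p\<close>. As it
    vanishes at \<open>p\<close>, projection does not change its values.\<close>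
  define l where "l = (\<lambda>y. \<beta> * dot (ext m) (lift y) - \<alpha> * dot (ext n) (lift y))"
  have l: "form_fun 1 l"
    unfolding l_def by (intro form_fun_diff form_fun_cmult form_fun_dot_lift)
  have l_proj: "l (proj x) = \<beta> * dot (ext m) x - \<alpha> * dot (ext n) x" for x
    unfolding l_def lift_proj by (simp add: \<alpha>_def \<beta>_def algebra_simps)
  have l_rational: "l (proj (ext x)) = 0 \<longleftrightarrow> x \<in> L" for x
  proof
    assume "l (proj (ext x)) = 0"
    \<comment> \<open>For fixed rational \<open>x\<close> the value is that of a rational functional
      at \<open>p\<close>, so genericity applies.\<close>
    then have "dot (ext (dot m x *s n - dot n x *s m)) p = 0"
      unfolding l_proj by (simp add: \<alpha>_def \<beta>_def mult.commute)
    then have "dot m x *s n - dot n x *s m = 0"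
      by (rule generic)
    then have "dot n x *s m = dot m x *s n"
      by simp
    from indep[OF this] show "x \<in> L"
      using L(2) by blast
  next
    assume "x \<in> L"
    then show "l (proj (ext x)) = 0"
      unfolding l_proj using L(2) by simp
  qed
  have l_line: "l (a *s proj (ext v) + b *s proj (ext w)) = 0" for a b
    using l_proj[of "a *s ext v + b *s ext w"] vw by (simp add: proj_add proj_scale)

  let ?N = "proj (frob p)"
  \<comment> \<open>Otherwise \<open>\<alpha> / \<beta>\<close> is fixed by Frobenius, hence a
    rational \<open>c\<close>, and the rational functional \<open>m - c *s n\<close> vanishes at
    \<open>p\<close>.\<close>
  have lN: "l ?N \<noteq> 0"
  proof
    assume "l ?N = 0"
    then have "\<beta> * \<alpha> ^ CARD('f) = \<alpha> * \<beta> ^ CARD('f)"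
      unfolding l_proj dot_ext_frob by (simp add: \<alpha>_def \<beta>_def)
    then have "(\<alpha> / \<beta>) ^ CARD('f) = \<alpha> / \<beta>"
      using \<alpha>\<beta> by (simp add: power_divide field_simps)
    then obtain c where "\<alpha> / \<beta> = to_ac c"
      using frobenius_fixed_imp_rational by blast
    then have "dot (ext (m - c *s n)) p = 0"
      using \<alpha>\<beta> by (simp add: \<alpha>_def \<beta>_def field_simps)
    then have "m - c *s n = 0"
      by (rule generic)
    then have "1 *s m = c *s n"
      by simp
    from indep[OF this] show False
      by simp
  qed

  \<comment> \<open>If \<open>l y = 0\<close>, the join of \<open>p\<close> and
    \<open>lift y\<close> meets the extension of \<open>L\<close> in \<open>lift y\<close> minus a
    multiple of \<open>p\<close>, the multiple being determined by the equation \<open>m\<close>.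
    The value \<open>\<sigma> r y\<close> is that of \<open>r\<close> at this point, so
    \<open>\<sigma> s\<close> and \<open>\<sigma> t\<close> are coordinates on the image of
    \<open>L\<close>.\<close>
  define \<sigma> where "\<sigma> = (\<lambda>r y. dot (ext r) (lift y) - dot (ext r) p / \<alpha> * dot (ext m) (lift y))"
  have \<sigma>: "form_fun 1 (\<sigma> r)" for r
    unfolding \<sigma>_def by (intro form_fun_diff form_fun_cmult form_fun_dot_lift)
  have param: "y = \<sigma> s y *s proj (ext v) + \<sigma> t y *s proj (ext w)" if "l y = 0" for y
  proof -
    let ?z = "lift y - (dot (ext m) (lift y) / \<alpha>) *s p"
    have "dot (ext m) ?z = 0"
      using \<alpha>\<beta> by (simp add: \<alpha>_def)
    moreover have "dot (ext n) ?z = 0"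
      using \<alpha>\<beta> that by (simp add: l_def \<beta>_def[symmetric] field_simps)
    ultimately have z: "?z = dot (ext s) ?z *s ext v + dot (ext t) ?z *s ext w"
      by (rule decomp)
    have \<sigma>z: "dot (ext r) ?z = \<sigma> r y" for r
      by (simp add: \<sigma>_def)
    have "y = proj ?z"
      by (simp add: proj_diff proj_scale)
    also have "\<dots> = \<sigma> s y *s proj (ext v) + \<sigma> t y *s proj (ext w)"
      by (subst z) (simp only: \<sigma>z proj_add proj_scale)
    finally show ?thesis .
  qed
  have \<sigma>_rational: "\<sigma> r (proj (ext x)) = to_ac (dot r x)" if "dot m x = 0" for r x
    unfolding \<sigma>_def lift_proj using that \<alpha>\<beta> by (simp add: \<alpha>_def)

  have triple_neq_0: "triple ?N (proj (ext v)) (proj (ext w)) \<noteq> 0"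
  proof
    assume N0: "triple ?N (proj (ext v)) (proj (ext w)) = 0"
    \<comment> \<open>The vector \<open>?N\<close> is off the kernel of \<open>l\<close>, which is
      spanned by the other two; so every \<open>z\<close> is a combination of the three.\<close>
    have *: "triple z (proj (ext v)) (proj (ext w)) = 0" for z
    proof -
      let ?y = "z - (l z / l ?N) *s ?N"
      have "l ?y = l z - (l z / l ?N) * l ?N"
        using linear_form_fun_add_scale[OF l, of z "- (l z / l ?N)" ?N]
        by (simp add: vec.scale_minus_left)
      then have "l ?y = 0"
        using lN by simp
      from param[OF this] obtain a b where
        ab: "z - (l z / l ?N) *s ?N = a *s proj (ext v) + b *s proj (ext w)"
        by blast
      have "z = (l z / l ?N) *s ?N + (a *s proj (ext v) + b *s proj (ext w))"
        by (simp flip: ab)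
      moreover have "triple (c *s ?N + (a *s V + b *s W)) V W = c * triple ?N V W" for c V W
        by (simp add: triple_def algebra_simps del: proj_nth)
      ultimately show ?thesis
        using N0 by (metis mult_zero_right)
    qed
    define V W where "V = proj (ext v)" and "W = proj (ext w)"
    have "triple (axis 1 1) V W = 0" "triple (axis 2 1) V W = 0" "triple (axis 3 1) V W = 0"
      using * by (simp_all add: V_def W_def)
    then have cross: "W $ i * V $ j = V $ i * W $ j" for i j
      using exhaust_3[of i] exhaust_3[of j] by (auto simp: triple_def axis_def algebra_simps)
    \<comment> \<open>The relations \<open>cross\<close> say that \<open>V\<close> and
      \<open>W\<close> are proportional, but \<open>\<sigma> t\<close> is 0 on \<open>V\<close> and
      1 on \<open>W\<close>.\<close>
    have "V $ i = 0" for i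
    proof -
      have "W $ i *s V = V $ i *s W"
        using cross by (simp add: vec_eq_iff)
      then have "W $ i * \<sigma> t V = V $ i * \<sigma> t W"
        using form_fun_scale[OF \<sigma>[of t], of "W $ i" V] form_fun_scale[OF \<sigma>[of t], of "V $ i" W]
        by simp
      then show ?thesis
        using dual vw by (simp add: V_def W_def \<sigma>_rational)
    qed
    then have "V = 0"
      by (simp add: vec_eq_iff)
    then have "\<sigma> s V = 0"
      using form_fun_scale[OF \<sigma>[of s], of 0 V] by simp
    then show False
      using dual vw by (simp add: V_def \<sigma>_rational)
  qed

  have f_line: "\<exists>y. l y = 0 \<and> frob_form y \<noteq> 0"
  proof -
    obtain a :: "'f alg_closure" where a: "a \<notin> range (to_ac :: 'f \<Rightarrow> _)"
      using infinite_UNIV_alg_closed[where 'a="'f alg_closure"]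
        ex_new_if_finite[of "range (to_ac :: 'f \<Rightarrow> _)"] by auto
    then have "a ^ CARD('f) \<noteq> a"
      using frobenius_fixed_imp_rational by blast
    then have "frob_form (a *s proj (ext v) + 1 *s proj (ext w)) \<noteq> 0"
      unfolding frob_form_on_line using triple_neq_0 by simp
    then show ?thesis
      using l_line by blast
  qed

  define \<pi> where "\<pi> = (\<lambda>c :: 'f alg_closure ^ 2. c $ 1 *s proj (ext v) + c $ 2 *s proj (ext w))"
  have \<pi>: "form_fun 1 (\<lambda>c. \<pi> c $ i)" for i
  proof -
    have "form_fun 1 (\<lambda>c :: 'f alg_closure ^ 2. proj (ext v) $ i * c $ 1 + proj (ext w) $ i * c $ 2)"
      by (intro form_fun_add form_fun_cmult form_fun_coord)
    then show ?thesis
      by (simp add: \<pi>_def mult.commute)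
  qed
  have \<pi>_rational: "\<exists>x\<in>L. \<pi> (ext c) = proj (ext x)" for c
  proof
    show "\<pi> (ext c) = proj (ext (c $ 1 *s v + c $ 2 *s w))"
      by (simp add: \<pi>_def proj_add proj_scale)
    show "c $ 1 *s v + c $ 2 *s w \<in> L"
      unfolding L(1) by (intro vec.span_add vec.span_scale vec.span_base) auto
  qed
  \<comment> \<open>The product of the linear forms of the rational points; up to sign it is the
    factor \<open>a * b^q - b * a^q\<close> of \<open>frob_form_on_line\<close>.\<close>
  define D where "D = (\<lambda>c :: 'f alg_closure ^ 2. c $ 2 * (\<Prod>t\<in>UNIV. c $ 1 - to_ac (t :: 'f) * c $ 2))"
  have divisible: "\<exists>V. form_fun (k - int (CARD('f) + 1)) V \<and> (\<forall>c. u (\<pi> c) = D c * V c)"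
    if u: "form_fun k u" "\<forall>x\<in>L. u (proj (ext x)) = 0" for k u
  proof -
    have "form_fun k (\<lambda>c. u (\<pi> c))"
      by (rule form_fun_compose[OF u(1) \<pi>])
    moreover have "u (\<pi> (ext c)) = 0" for c
      using \<pi>_rational[of c] u(2) by auto
    ultimately show ?thesis
      using form_fun_rational_roots unfolding D_def by metis
  qed
  \<comment> \<open>Numerator and divisor both have degree \<open>q + 1\<close>, so the quotient is
    constant. It is nonzero because of \<open>f_line\<close>.\<close>
  obtain K where K: "form_fun 0 K" "\<And>c. frob_form (\<pi> c) = D c * K c"
    using divisible[OF form_fun_frob_form] frob_form_rational by auto
  obtain \<kappa> where \<kappa>: "\<And>c. frob_form (\<pi> c) = D c * \<kappa>"
    using K form_fun_0_constant[OF K(1), of _ 0] by metis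
  have \<pi>_surj: "\<pi> (vector [\<sigma> s y, \<sigma> t y]) = y" if "l y = 0" for y
    using param[OF that] by (simp add: \<pi>_def)
  have \<kappa>0: "\<kappa> \<noteq> 0"
    using f_line \<pi>_surj \<kappa> by (metis mult_zero_right)

  have ideal: "\<exists>a b. form_fun (k - int (CARD('f) + 1)) a \<and> form_fun (k - 1) b \<and>
      (\<forall>y. u y = a y * frob_form y + l y * b y)"
    if u: "form_fun k u" "\<forall>x\<in>L. u (proj (ext x)) = 0" for k u
  proof -
    obtain V where V: "form_fun (k - int (CARD('f) + 1)) V" "\<And>c. u (\<pi> c) = D c * V c"
      using divisible[OF u] by blast
    \<comment> \<open>The quotient of \<open>u\<close> by \<open>frob_form\<close> is known on the
      image of \<open>L\<close> only. The coordinates \<open>\<sigma> s\<close>,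
      \<open>\<sigma> t\<close> extend it to the plane, and the resulting error is divisible by
      \<open>l\<close>.\<close>
    let ?a = "\<lambda>y. inverse \<kappa> * V (vector [\<sigma> s y, \<sigma> t y])"
    have "form_fun (k - int (CARD('f) + 1)) (\<lambda>y. V (vector [\<sigma> s y, \<sigma> t y]))"
    proof (rule form_fun_compose[OF V(1)])
      fix i :: 2
      show "form_fun 1 (\<lambda>y. (vector [\<sigma> s y, \<sigma> t y] :: 'f alg_closure ^ 2) $ i)"
        using exhaust_2[of i] \<sigma> by auto
    qed
    then have a: "form_fun (k - int (CARD('f) + 1)) ?a"
      by (rule form_fun_cmult)
    have af: "form_fun k (\<lambda>y. ?a y * frob_form y)"
      by (rule form_fun_mult'[OF a form_fun_frob_form]) simp
    have "u y - ?a y * frob_form y = 0" if "l y = 0" for y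
      using V(2)[of "vector [\<sigma> s y, \<sigma> t y]"] \<kappa>[of "vector [\<sigma> s y, \<sigma> t y]"] \<kappa>0
      unfolding \<pi>_surj[OF that] by simp
    then obtain b where b: "form_fun (k - 1) b" "\<And>y. u y - ?a y * frob_form y = l y * b y"
      using form_fun_divisible[OF form_fun_diff[OF u(1) af] l lN] by metis
    have "u y = ?a y * frob_form y + l y * b y" for y
      using b(2)[of y] by (simp only: diff_eq_eq add.commute)
    then show ?thesis
      by (intro exI conjI) (rule a, rule b(1), blast)
  qed
  show ?thesis
    unfolding is_line_form_def using l lN l_rational f_line ideal by blast
qed

definition line_form :: "('f ^ 4) set \<Rightarrow> 'f alg_closure ^ 3 \<Rightarrow> 'f alg_closure" where
  "line_form L = (SOME l. is_line_form L l)"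

lemma is_line_form: "L \<in> proj_lines \<Longrightarrow> is_line_form L (line_form L)"
  unfolding line_form_def using someI_ex[OF is_line_form_exists] .

lemma line_form:
  assumes "L \<in> proj_lines"
  shows "form_fun 1 (line_form L)" "\<exists>e. line_form L e \<noteq> 0"
    "line_form L (proj (ext x)) = 0 \<longleftrightarrow> x \<in> L" "\<exists>y. line_form L y = 0 \<and> frob_form y \<noteq> 0"
  using is_line_form[OF assms] unfolding is_line_form_def by blast+

lemma form_fun_vanishing_on_line:
  assumes "L \<in> proj_lines" "form_fun k u" "\<And>x. x \<in> L \<Longrightarrow> u (proj (ext x)) = 0"
  obtains a b where "form_fun (k - int (CARD('f) + 1)) a" "form_fun (k - 1) b"
    "\<And>y. u y = a y * frob_form y + line_form L y * b y"
  using is_line_form[OF assms(1)] assms(2,3) unfolding is_line_form_def by metis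

definition lines_form :: "('f ^ 4) set set \<Rightarrow> 'f alg_closure ^ 3 \<Rightarrow> 'f alg_closure" where
  "lines_form T y = (\<Prod>L\<in>T. line_form L y)"

lemma lines_form_insert:
  "finite T \<Longrightarrow> L \<notin> T \<Longrightarrow> lines_form (insert L T) y = line_form L y * lines_form T y"
  by (simp add: lines_form_def)

lemma form_fun_lines_form: "T \<subseteq> proj_lines \<Longrightarrow> form_fun (int (card T)) (lines_form T)"
  unfolding lines_form_def[abs_def]
  using form_fun_prod[of T "\<lambda>_. 1" line_form] line_form(1) by auto

lemma lines_form_rational:
  assumes "finite T" "T \<subseteq> proj_lines"
  shows "lines_form T (proj (ext x)) = 0 \<longleftrightarrow> x \<in> \<Union>T"
  using assms line_form(3) by (auto simp: lines_form_def)

text \<open>Induction on \<open>T\<close>: at the nonzero vectors of a further line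
  \<open>L\<close>, skew to those of \<open>T\<close>, \<open>frob_form\<close> vanishes and
  \<open>lines_form T\<close> does not. So the cofactor \<open>b\<close> vanishes on
  \<open>L\<close> and can itself be expanded there.\<close>

lemma form_fun_vanishing_on_skew_lines:
  assumes "finite T" "T \<subseteq> proj_lines" "pairwise skew T" "form_fun k u"
    "\<And>x. x \<in> \<Union>T \<Longrightarrow> u (proj (ext x)) = 0"
  shows "\<exists>a b. form_fun (k - int (CARD('f) + 1)) a \<and> form_fun (k - int (card T)) b \<and>
    (\<forall>y. u y = a y * frob_form y + lines_form T y * b y)"
  using assms
proof (induction T)
  case empty
  show ?case
    by (rule exI[of _ "\<lambda>_. 0"], rule exI[of _ u])
      (use empty in \<open>auto simp: lines_form_def intro: form_fun_zero\<close>)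
next
  case (insert L T)
  have skew: "L \<inter> M = {0}" if "M \<in> T" for M
    using insert.prems(2) insert.hyps(2) that by (auto simp: pairwise_insert skew_def)
  have L: "L \<in> proj_lines" and T: "T \<subseteq> proj_lines" and "pairwise skew T"
    using insert.prems(1,2) by (auto simp: pairwise_insert)
  then obtain a b where a: "form_fun (k - int (CARD('f) + 1)) a" and b: "form_fun (k - int (card T)) b"
    and u: "\<And>y. u y = a y * frob_form y + lines_form T y * b y"
    using insert.IH[OF T _ insert.prems(3)] insert.prems(4) by blast
  have b0: "b (proj (ext x)) = 0" if "x \<in> L" "x \<noteq> 0" for x
  proof -
    have "x \<notin> \<Union>T"
      using skew that by blast
    then have "lines_form T (proj (ext x)) \<noteq> 0"
      using lines_form_rational[OF insert.hyps(1) T] by blast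
    then show ?thesis
      using u[of "proj (ext x)"] frob_form_rational insert.prems(4) that by auto
  qed
  \<comment> \<open>The zero vector lies on all lines and is treated separately: a form with some
    zero vanishes at the origin.\<close>
  have "\<exists>x\<in>L. x \<noteq> 0"
    using L vec.dim_eq_0[of L] by (auto simp: proj_lines_def)
  then have "b (proj (ext 0)) = 0"
    using b0 form_fun_eq_0_at_0[OF b] by auto
  then have "b (proj (ext x)) = 0" if "x \<in> L" for x
    using b0 that by (cases "x = 0") auto
  then obtain a' b' where a': "form_fun (k - int (card T) - int (CARD('f) + 1)) a'"
    and b': "form_fun (k - int (card T) - 1) b'"
    and b_eq: "\<And>y. b y = a' y * frob_form y + line_form L y * b' y"
    using form_fun_vanishing_on_line[OF L b] by blast
  have "form_fun (k - int (CARD('f) + 1)) (\<lambda>y. a y + lines_form T y * a' y)"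
    by (rule form_fun_add[OF a], rule form_fun_mult'[OF form_fun_lines_form[OF T] a']) simp
  moreover have "form_fun (k - int (card (insert L T))) b'"
    using b' insert.hyps by (simp add: algebra_simps)
  moreover have "u y = (a y + lines_form T y * a' y) * frob_form y + lines_form (insert L T) y * b' y" for y
    unfolding lines_form_insert[OF insert.hyps] u[of y] b_eq[of y] by (simp add: algebra_simps)
  ultimately show ?case
    by blast
qed

end

section \<open>The ideal of the complement of a partial spread\<close>

lemma poly_fun_cancel:
  fixes u v w :: "'k::alg_closed_field ^ 'n::finite \<Rightarrow> 'k"
  assumes "poly_fun u" "poly_fun v" "poly_fun w" "w e \<noteq> 0" "\<And>x. w x * u x = w x * v x"
  shows "u x = v x"
proof -
  have "w x * (u x - v x) = 0" for x
    using assms(5) by (simp add: right_diff_distrib)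
  from poly_fun_mult_eq_0[OF infinite_UNIV_alg_closed assms(3) poly_fun_diff[OF assms(1,2)] this]
  show ?thesis
    using assms(4) by auto
qed

context generic_vertex
begin

lemma poly_fun_lines_form: "T \<subseteq> proj_lines \<Longrightarrow> poly_fun (lines_form T)"
  using form_fun_lines_form form_fun_poly_fun by blast

lemma poly_fun_frob_form: "poly_fun frob_form"
  using form_fun_frob_form form_fun_poly_fun by blast

text \<open>The product of line forms is not a zero divisor modulo \<open>frob_form\<close>: each
  line form is prime and does not divide \<open>frob_form\<close>, so it divides
  \<open>c\<close>.\<close>

lemma lines_form_cancel:
  assumes "finite T" "T \<subseteq> proj_lines" "poly_fun w" "form_fun k c"
    "\<And>y. lines_form T y * w y = c y * frob_form y"
  shows "\<exists>c'. form_fun (k - int (card T)) c' \<and> (\<forall>y. w y = c' y * frob_form y)"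
  using assms
proof (induction T arbitrary: k c)
  case empty
  then show ?case
    by (auto simp: lines_form_def)
next
  case (insert L T)
  have L: "L \<in> proj_lines" and T: "T \<subseteq> proj_lines"
    using insert.prems by auto
  obtain e where e: "line_form L e \<noteq> 0"
    using line_form(2)[OF L] by blast
  have eq: "line_form L y * (lines_form T y * w y) = c y * frob_form y" for y
    using insert.prems(4)[of y] insert.hyps by (simp add: lines_form_insert mult.assoc)
  have "c y * frob_form y = 0" if "line_form L y = 0" for y
    using eq[of y] that by simp
  from poly_fun_mult_eq_0_on_kernel[OF infinite_UNIV_alg_closed form_fun_poly_fun[OF insert.prems(3)]
      poly_fun_frob_form line_form(1)[OF L] e this]
  have "c y = 0" if "line_form L y = 0" for y
    using line_form(4)[OF L] that by blast
  then obtain b where b: "form_fun (k - 1) b" "\<And>y. c y = line_form L y * b y"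
    using form_fun_divisible[OF insert.prems(3) line_form(1)[OF L] e] by metis
  have "lines_form T y * w y = b y * frob_form y" for y
  proof (rule poly_fun_cancel)
    show "poly_fun (\<lambda>y. lines_form T y * w y)"
      by (intro poly_fun_mult poly_fun_lines_form T insert.prems(2))
    show "poly_fun (\<lambda>y. b y * frob_form y)"
      by (intro poly_fun_mult form_fun_poly_fun[OF b(1)] poly_fun_frob_form)
    show "poly_fun (line_form L)"
      by (rule form_fun_poly_fun[OF line_form(1)[OF L]])
    show "line_form L e \<noteq> 0"
      by (rule e)
    show "line_form L y * (lines_form T y * w y) = line_form L y * (b y * frob_form y)" for y
      unfolding eq b(2)[of y] by (simp only: mult.assoc)
  qed
  from insert.IH[OF T insert.prems(2) b(1) this]
  obtain c' where "form_fun (k - 1 - int (card T)) c'" "\<forall>y. w y = c' y * frob_form y"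
    by blast
  moreover have "k - 1 - int (card T) = k - int (card (insert L T))"
    using insert.hyps by simp
  ultimately show ?case
    by metis
qed

text \<open>A line form divides \<open>w * v\<close> but not \<open>w\<close>, since
  \<open>w\<close> divides \<open>frob_form\<close>. Being prime it divides \<open>v\<close> and can
  be cancelled, until \<open>w * v = 1\<close> remains.\<close>

lemma lines_form_frob_form_coprime:
  assumes "finite T" "T \<subseteq> proj_lines" "poly_fun w" "poly_fun v" "poly_fun a"
    "\<And>y. w y * v y = lines_form T y" "\<And>y. frob_form y = w y * a y"
  shows "\<exists>c. poly_fun c \<and> (\<forall>y. w y * c y = 1)"
  using assms
proof (induction T arbitrary: v)
  case empty
  then show ?case
    by (auto simp: lines_form_def)
next
  case (insert L T)
  have L: "L \<in> proj_lines" and T: "T \<subseteq> proj_lines"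
    using insert.prems by auto
  obtain e where e: "line_form L e \<noteq> 0"
    using line_form(2)[OF L] by blast
  have eq: "w y * v y = line_form L y * lines_form T y" for y
    using insert.prems(5)[of y] insert.hyps by (simp add: lines_form_insert)
  have "w y * v y = 0" if "line_form L y = 0" for y
    using eq[of y] that by simp
  from poly_fun_mult_eq_0_on_kernel[OF infinite_UNIV_alg_closed insert.prems(2,3)
      line_form(1)[OF L] e this]
  have "v y = 0" if "line_form L y = 0" for y
    using line_form(4)[OF L] insert.prems(6) that by (metis mult_zero_left)
  then obtain b where b: "poly_fun b" "\<And>y. v y = line_form L y * b y"
    using poly_fun_divisible[OF insert.prems(3) line_form(1)[OF L] e] by metis
  have "w y * b y = lines_form T y" for y
  proof (rule poly_fun_cancel)
    show "poly_fun (\<lambda>y. w y * b y)"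
      by (intro poly_fun_mult insert.prems(2) b(1))
    show "poly_fun (lines_form T)"
      by (rule poly_fun_lines_form[OF T])
    show "poly_fun (line_form L)"
      by (rule form_fun_poly_fun[OF line_form(1)[OF L]])
    show "line_form L e \<noteq> 0"
      by (rule e)
    show "line_form L y * (w y * b y) = line_form L y * lines_form T y" for y
      using eq[of y] unfolding b(2)[of y] by (simp only: mult.left_commute)
  qed
  from insert.IH[OF T insert.prems(2) b(1) insert.prems(4) this insert.prems(6)]
  show ?case .
qed

text \<open>The form \<open>g\<close> of all lines of a spread \<open>\<Sigma>\<close> and \<open>frob_form\<close> generate the ideal of all rational
  points. Since \<open>g\<close> vanishes on \<open>S\<close>, it is congruent to \<open>lines_form S * h\<close> modulo \<open>frob_form\<close>, and
  \<open>h\<close> is the second generator of the ideal of the complement of \<open>S\<close>.\<close>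

lemma complement_generators:
  fixes S \<Sigma> :: "('f ^ 4) set set"
  assumes S: "finite S" "S \<subseteq> proj_lines" "pairwise skew S"
    and \<Sigma>: "finite \<Sigma>" "\<Sigma> \<subseteq> proj_lines" "pairwise skew \<Sigma>" "\<Union>\<Sigma> = UNIV"
    and card: "card \<Sigma> = card S + d"
  obtains h where "form_fun (int d) h" "\<And>x. x \<notin> \<Union>S \<Longrightarrow> h (proj (ext x)) = 0"
    "\<And>k u. form_fun k u \<Longrightarrow> (\<And>x. x \<notin> \<Union>S \<Longrightarrow> u (proj (ext x)) = 0) \<Longrightarrow>
      \<exists>a b. form_fun (k - int (CARD('f) + 1)) a \<and> form_fun (k - int d) b \<and>
        (\<forall>y. u y = a y * frob_form y + b y * h y)"
    "\<And>w a b. poly_fun w \<Longrightarrow> poly_fun a \<Longrightarrow> poly_fun b \<Longrightarrow> (\<And>y. frob_form y = w y * a y) \<Longrightarrow>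
      (\<And>y. h y = w y * b y) \<Longrightarrow> \<exists>c. poly_fun c \<and> (\<forall>y. w y * c y = 1)"
proof -
  let ?q1 = "int (CARD('f) + 1)"
  let ?g = "lines_form \<Sigma>" and ?l = "lines_form S"
  have g: "form_fun (int (card \<Sigma>)) ?g"
    by (rule form_fun_lines_form[OF \<Sigma>(2)])
  have g0: "?g (proj (ext x)) = 0" for x
    using lines_form_rational[OF \<Sigma>(1,2)] \<Sigma>(4) by blast
  obtain A h where A: "form_fun (int (card \<Sigma>) - ?q1) A"
    and h: "form_fun (int (card \<Sigma>) - int (card S)) h"
    and g_eq: "\<And>y. ?g y = A y * frob_form y + ?l y * h y"
    using form_fun_vanishing_on_skew_lines[OF S g g0] by blast
  have h_d: "form_fun (int d) h"
    using h card by simp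
  have h0: "h (proj (ext x)) = 0" if "x \<notin> \<Union>S" for x
    using g_eq[of "proj (ext x)"] that lines_form_rational[OF S(1,2)] g0 frob_form_rational by auto
  show thesis
  proof (rule that[OF h_d h0])
    fix k u
    assume u: "form_fun k u" and u0: "\<And>x. x \<notin> \<Union>S \<Longrightarrow> u (proj (ext x)) = 0"
    \<comment> \<open>Multiplied by the form of \<open>S\<close>, \<open>u\<close> vanishes on all
      rational points, and the expansion along the spread \<open>\<Sigma>\<close> applies.\<close>
    let ?k = "k + int (card S)"
    have ul: "form_fun ?k (\<lambda>y. u y * ?l y)"
      by (rule form_fun_mult[OF u form_fun_lines_form[OF S(2)]])
    have "u (proj (ext x)) * ?l (proj (ext x)) = 0" for x
      using u0 lines_form_rational[OF S(1,2)] by auto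
    with form_fun_vanishing_on_skew_lines[OF \<Sigma>(1-3) ul]
    obtain a b where a: "form_fun (?k - ?q1) a" and b: "form_fun (?k - int (card \<Sigma>)) b"
      and u_eq: "\<And>y. u y * ?l y = a y * frob_form y + ?g y * b y"
      by blast
    have b_d: "form_fun (k - int d) b"
      using b card by simp
    have bh: "form_fun k (\<lambda>y. b y * h y)"
      by (rule form_fun_mult'[OF b_d h_d]) simp
    have c: "form_fun (?k - ?q1) (\<lambda>y. a y + b y * A y)"
      by (rule form_fun_add[OF a], rule form_fun_mult'[OF b A]) simp
    have "?l y * (u y - b y * h y) = (a y + b y * A y) * frob_form y" for y
    proof -
      have "?l y * (u y - b y * h y) = u y * ?l y - b y * (?l y * h y)"
        by (simp add: algebra_simps)
      also have "\<dots> = (a y + b y * A y) * frob_form y"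
        unfolding u_eq[of y] g_eq[of y] by (simp add: algebra_simps)
      finally show ?thesis .
    qed
    from lines_form_cancel[OF S(1,2) form_fun_poly_fun[OF form_fun_diff[OF u bh]] c this]
    obtain c' where c': "form_fun (?k - ?q1 - int (card S)) c'"
      and eq: "\<And>y. u y - b y * h y = c' y * frob_form y"
      by blast
    have "u y = c' y * frob_form y + b y * h y" for y
      using eq[of y] by (simp only: diff_eq_eq)
    moreover have "form_fun (k - ?q1) c'"
    proof -
      have "?k - ?q1 - int (card S) = k - ?q1"
        by simp
      then show ?thesis
        using c' by metis
    qed
    ultimately show "\<exists>a b. form_fun (k - ?q1) a \<and> form_fun (k - int d) b \<and>
        (\<forall>y. u y = a y * frob_form y + b y * h y)"
      using b_d by blast
  next
    fix w a b
    assume w: "poly_fun w" and a: "poly_fun a" and b: "poly_fun b"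
      and fa: "\<And>y. frob_form y = w y * a y" and hb: "\<And>y. h y = w y * b y"
    \<comment> \<open>A common divisor of \<open>frob_form\<close> and \<open>h\<close> also divides
      the product over the spread.\<close>
    have "w y * (A y * a y + ?l y * b y) = ?g y" for y
      unfolding g_eq[of y] fa[of y] hb[of y] by (simp add: algebra_simps)
    moreover have "poly_fun (\<lambda>y. A y * a y + ?l y * b y)"
      by (intro poly_fun_add poly_fun_mult form_fun_poly_fun[OF A] a poly_fun_lines_form[OF S(2)] b)
    ultimately show "\<exists>c. poly_fun c \<and> (\<forall>y. w y * c y = 1)"
      using lines_form_frob_form_coprime[OF \<Sigma>(1,2) w _ a _ fa] by blast
  qed
qed

end

section \<open>Counting in the projective space over a finite field\<close>

lemma card_field_ge_2: "CARD('f::{field,finite}) \<ge> 2"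
proof -
  have "card {0, 1 :: 'f} \<le> CARD('f)"
    by (rule card_mono) auto
  then show ?thesis
    by simp
qed

lemma card_span_independent:
  fixes B :: "('f::{field,finite} ^ 'n) set"
  assumes "vec.independent B"
  shows "card (vec.span B) = CARD('f) ^ card B"
proof -
  have "finite B" by simp
  then show ?thesis
    using assms
  proof (induction B)
    case (insert b B)
    have b: "b \<notin> vec.span B" and B: "vec.independent B"
      using insert.prems insert.hyps(2) by (auto simp: vec.independent_insert)
    have "bij_betw (\<lambda>(c, x). c *s b + x) (UNIV \<times> vec.span B) (vec.span (insert b B))"
    proof (rule bij_betwI')
      fix s t :: "'f \<times> ('f ^ 'n)"
      assume st: "s \<in> UNIV \<times> vec.span B" "t \<in> UNIV \<times> vec.span B"
      obtain c x c' x' where s: "s = (c, x)" and t: "t = (c', x')"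
        by (cases s, cases t) auto
      have x: "x \<in> vec.span B" "x' \<in> vec.span B"
        using st s t by auto
      have "s = t" if "c *s b + x = c' *s b + x'"
      proof -
        have *: "(c - c') *s b = x' - x"
          using that by (simp add: vec.scale_left_diff_distrib algebra_simps)
        have "c = c'"
        proof (rule ccontr)
          assume "c \<noteq> c'"
          then have "b = inverse (c - c') *s (x' - x)"
            by (simp flip: *)
          then show False
            using b vec.span_scale[OF vec.span_diff[OF x(2,1)]] by metis
        qed
        then show ?thesis
          using * s t by simp
      qed
      then show "((case s of (c, x) \<Rightarrow> c *s b + x) = (case t of (c, x) \<Rightarrow> c *s b + x)) = (s = t)"
        using s t by auto
    next
      fix s :: "'f \<times> ('f ^ 'n)"
      assume "s \<in> UNIV \<times> vec.span B"
      then show "(case s of (c, x) \<Rightarrow> c *s b + x) \<in> vec.span (insert b B)"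
        using vec.span_mono[OF subset_insertI, of B b]
        by (cases s) (auto intro!: vec.span_add vec.span_scale intro: vec.span_base)
    next
      fix y
      assume "y \<in> vec.span (insert b B)"
      then obtain k where "y - k *s b \<in> vec.span B"
        by (auto simp: vec.span_insert)
      then show "\<exists>s\<in>UNIV \<times> vec.span B. y = (case s of (c, x) \<Rightarrow> c *s b + x)"
        by (intro bexI[of _ "(k, y - k *s b)"]) auto
    qed
    then have "card (vec.span (insert b B)) = CARD('f) * card (vec.span B)"
      using bij_betw_same_card by (fastforce simp: card_cartesian_product)
    then show ?case
      using insert.IH[OF B] insert.hyps by simp
  qed simp
qed

lemma card_subspace:
  fixes W :: "('f::{field,finite} ^ 'n) set"
  assumes "vec.subspace W"
  shows "card W = CARD('f) ^ vec.dim W"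
proof -
  obtain B where B: "B \<subseteq> W" "vec.independent B" "W \<subseteq> vec.span B" "card B = vec.dim W"
    using vec.basis_exists by metis
  then have "W = vec.span B"
    by (metis assms antisym vec.span_minimal)
  then show ?thesis
    using card_span_independent[OF B(2)] B(4) by simp
qed

lemma subspace_hyperplane: "vec.subspace {x. dot m x = 0}"
  by (rule vec.subspaceI) auto

lemma card_subspace_hyperplane:
  fixes W :: "('f::{field,finite} ^ 'n) set"
  assumes W: "vec.subspace W" and x0: "x\<^sub>0 \<in> W" "dot m x\<^sub>0 \<noteq> 0"
  shows "card W = CARD('f) * card {x \<in> W. dot m x = 0}"
proof -
  let ?V = "{x \<in> W. dot m x = 0}"
  have "bij_betw (\<lambda>(c, x). c *s x\<^sub>0 + x) (UNIV \<times> ?V) W"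
  proof (rule bij_betw_byWitness[where f' = "\<lambda>x. (dot m x / dot m x\<^sub>0, x - (dot m x / dot m x\<^sub>0) *s x\<^sub>0)"])
    show "\<forall>a\<in>UNIV \<times> ?V. (dot m (case a of (c, x) \<Rightarrow> c *s x\<^sub>0 + x) / dot m x\<^sub>0,
        (case a of (c, x) \<Rightarrow> c *s x\<^sub>0 + x)
          - (dot m (case a of (c, x) \<Rightarrow> c *s x\<^sub>0 + x) / dot m x\<^sub>0) *s x\<^sub>0) = a"
      using x0 by auto
  qed (use W x0 in \<open>auto intro: vec.subspace_add vec.subspace_diff vec.subspace_scale\<close>)
  then show ?thesis
    using bij_betw_same_card by (fastforce simp: card_cartesian_product)
qed

lemma card_vec_4: "CARD('f::{field,finite} ^ 4) = CARD('f) ^ 4"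
  using card_subspace[of "UNIV :: ('f ^ 4) set"] by (simp add: vec_dim_card)

lemma card_hyperplane:
  fixes m :: "'f::{field,finite} ^ 4"
  assumes "m \<noteq> 0"
  shows "card {x. dot m x = 0} = CARD('f) ^ 3"
proof -
  obtain i where "m $ i \<noteq> 0"
    using assms by (auto simp: vec_eq_iff)
  then have "dot m (axis i 1) \<noteq> 0"
    by (simp add: dot_def axis_def if_distrib[of "(*) _"] cong: if_cong)
  then have "CARD('f ^ 4) = CARD('f) * card {x \<in> UNIV. dot m x = 0}"
    by (intro card_subspace_hyperplane) auto
  then show ?thesis
    unfolding card_vec_4 by (simp add: numeral_eq_Suc)
qed

lemma proper_subspace_in_hyperplane:
  fixes W :: "('a::field ^ 'n) set"
  assumes W: "vec.subspace W" "W \<noteq> UNIV"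
  obtains m where "m \<noteq> 0" "\<And>x. x \<in> W \<Longrightarrow> dot m x = 0"
proof -
  obtain B where B: "B \<subseteq> W" "vec.independent B" "W \<subseteq> vec.span B"
    using vec.basis_exists by metis
  then have WB: "W = vec.span B"
    by (metis W(1) antisym vec.span_minimal)
  define C where "C = vec.extend_basis B"
  have C: "B \<subseteq> C" "vec.independent C" "vec.span C = UNIV"
    unfolding C_def using B(2)
    by (auto simp: vec.extend_basis_superset vec.independent_extend_basis)
  obtain \<phi> where \<phi>: "\<And>b c. b \<in> C \<Longrightarrow> c \<in> C \<Longrightarrow> dot (\<phi> b) c = (if b = c then 1 else 0)"
    using coordinate_functionals[OF C(2,3)] by metis
  obtain c where c: "c \<in> C" "c \<notin> B"
    using C WB W(2) by (metis subsetI subset_antisym)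
  show thesis
  proof
    show "\<phi> c \<noteq> 0"
      using \<phi>[OF c(1) c(1)] by auto
    have "B \<subseteq> {x. dot (\<phi> c) x = 0}"
      using \<phi>[OF c(1)] c C(1) by fastforce
    then have "W \<subseteq> {x. dot (\<phi> c) x = 0}"
      unfolding WB by (rule vec.span_minimal) (rule subspace_hyperplane)
    then show "dot (\<phi> c) x = 0" if "x \<in> W" for x
      using that by blast
  qed
qed

section \<open>Lines over the finite field and their nonzero vectors\<close>

lemma proj_line_subspace: "L \<in> proj_lines \<Longrightarrow> vec.subspace L"
  by (simp add: proj_lines_def)

lemma zero_in_proj_line: "L \<in> proj_lines \<Longrightarrow> 0 \<in> L"
  by (simp add: proj_line_subspace vec.subspace_0)

lemma card_proj_line: "L \<in> proj_lines \<Longrightarrow> card (L :: ('f::{field,finite} ^ 'n) set) = CARD('f)\<^sup>2"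
  using card_subspace[of L] by (simp add: proj_lines_def)

lemma card_proj_line_nonzero:
  "L \<in> proj_lines \<Longrightarrow> card (L - {0} :: ('f::{field,finite} ^ 'n) set) = CARD('f)\<^sup>2 - 1"
  by (simp add: card_Diff_singleton zero_in_proj_line card_proj_line)

lemma span_pairE:
  assumes "y \<in> vec.span {x, z}"
  obtains a b where "y = a *s x + b *s z"
proof -
  obtain a where "y - a *s x \<in> vec.span {z}"
    using assms unfolding vec.span_insert by auto
  then obtain b where "y - a *s x = b *s z"
    by (auto simp: vec.span_singleton)
  then show thesis
    using that[of a b] by (simp add: diff_eq_eq add.commute)
qed

lemma span_pair_proj_line:
  assumes "x \<noteq> 0" "y \<notin> vec.span {x}"
  shows "vec.span {x, y} \<in> proj_lines"
proof -
  have "vec.independent {y, x}"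
    using assms by (subst vec.independent_insert) (auto simp: vec.span_base)
  moreover have "x \<noteq> y"
    using assms vec.span_base[of x "{x}"] by auto
  ultimately have "vec.dim (vec.span {x, y}) = 2"
    using vec.dim_span_eq_card_independent[of "{y, x}"] by (simp add: insert_commute del: vec.dim_span)
  then show ?thesis
    by (simp add: proj_lines_def)
qed

lemma card_Union_skew:
  fixes T :: "('f::{field,finite} ^ 'n) set set"
  assumes "\<And>L. L \<in> T \<Longrightarrow> card (L - {0}) = n" "pairwise skew T"
  shows "card (\<Union>T - {0}) = card T * n"
proof -
  have "card (\<Union>L\<in>T. L - {0}) = (\<Sum>L\<in>T. card (L - {0}))"
    using assms(2) by (intro card_UN_disjoint) (auto simp: pairwise_def skew_def)
  moreover have "(\<Union>L\<in>T. L - {0}) = \<Union>T - {0}"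
    by auto
  ultimately show ?thesis
    using assms(1) by simp
qed

text \<open>The sums of vectors from the two lines are \<open>q^4\<close> distinct vectors, too many
  for the \<open>q^3\<close> vectors of a plane.\<close>

lemma skew_lines_not_in_hyperplane:
  fixes L M :: "('f::{field,finite} ^ 4) set"
  assumes L: "L \<in> proj_lines" and M: "M \<in> proj_lines" and skew: "L \<inter> M = {0}" and "m \<noteq> 0"
    and W: "L \<subseteq> {x. dot m x = 0}" "M \<subseteq> {x. dot m x = 0}"
  shows False
proof -
  let ?q = "CARD('f)"
  have sub: "vec.subspace L" "vec.subspace M"
    using L M proj_line_subspace by auto
  have "inj_on (\<lambda>(x, y). x + y) (L \<times> M)"
  proof (rule inj_onI, clarify)
    fix x y x' y'
    assume xy: "x \<in> L" "y \<in> M" "x' \<in> L" "y' \<in> M" and eq: "x + y = x' + y'"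
    have "x - x' = y' - y"
      using eq by (simp add: algebra_simps)
    moreover have "x - x' \<in> L" "y' - y \<in> M"
      using xy sub by (auto intro: vec.subspace_diff)
    ultimately have "x - x' = 0"
      using skew by (metis IntI singletonD)
    then show "x = x' \<and> y = y'"
      using eq by simp
  qed
  then have "card ((\<lambda>(x, y). x + y) ` (L \<times> M)) = card L * card M"
    by (simp add: card_image card_cartesian_product)
  moreover have "card ((\<lambda>(x, y). x + y) ` (L \<times> M)) \<le> card {x. dot m x = 0}"
    using W by (intro card_mono) (auto dest!: subsetD)
  ultimately have "?q\<^sup>2 * ?q\<^sup>2 \<le> ?q ^ 3"
    by (simp add: card_hyperplane[OF assms(4)] card_proj_line[OF L] card_proj_line[OF M])
  then have "?q ^ 4 \<le> ?q ^ 3"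
    by (simp flip: power_add)
  then show False
    using card_field_ge_2[where 'f='f] by (simp add: power_increasing_iff)
qed

subsection \<open>A spread\<close>

text \<open>Two coordinate pairs are viewed as elements of the quadratic extension generated by a root of
  an irreducible polynomial \<open>t\<^sup>2 + t + c\<close>; the lines of the spread are the points over the
  extension, that is, the orbits of multiplication by that root.\<close>

lemma spread_exists:
  obtains \<Sigma> :: "('f::{field,finite} ^ 4) set set"
  where "\<Sigma> \<subseteq> proj_lines" "pairwise skew \<Sigma>" "\<Union>\<Sigma> = UNIV" "card \<Sigma> = CARD('f)\<^sup>2 + 1"
proof -
  \<comment> \<open>The values at 0 and -1 agree, in every characteristic; on a finite field the map
    then misses some \<open>e\<close>, and \<open>t^2 + t - e\<close> has no root.\<close>
  have "\<not> inj (\<lambda>t :: 'f. t\<^sup>2 + t)"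
  proof
    assume "inj (\<lambda>t :: 'f. t\<^sup>2 + t)"
    from injD[OF this, of 0 "- 1"] show False
      by simp
  qed
  then have "\<not> surj (\<lambda>t :: 'f. t\<^sup>2 + t)"
    using finite_UNIV_surj_inj[OF finite] by blast
  then obtain e :: 'f where e: "\<forall>t. e \<noteq> t\<^sup>2 + t"
    unfolding surj_def by auto
  then have irred: "t * t + t - e \<noteq> 0" for t
    using e[rule_format, of t] by (auto simp: power2_eq_square)
  \<comment> \<open>Multiplication by a root of \<open>t^2 + t - e\<close> on two copies of the
    quadratic extension, as \<open>T_T\<close> shows. An eigenvector of \<open>T\<close> would yield
    a root in the base field.\<close>
  define T :: "'f ^ 4 \<Rightarrow> 'f ^ 4" where
    "T x = (\<chi> i. if i = 1 then e * x $ 2 else if i = 2 then x $ 1 - x $ 2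
       else if i = 3 then e * x $ 4 else x $ 3 - x $ 4)" for x
  have T_nth: "T x $ 1 = e * x $ 2" "T x $ 2 = x $ 1 - x $ 2" "T x $ 3 = e * x $ 4"
    "T x $ 4 = x $ 3 - x $ 4" for x
    by (simp_all add: T_def)
  have T_add: "T (x + y) = T x + T y" and T_scale: "T (k *s x) = k *s T x"
    and T_T: "T (T x) = e *s x - T x" for x y k
    by (simp_all add: vec_eq_iff forall_4 T_nth algebra_simps)
  define M where "M x = vec.span {x, T x}" for x
  have line: "M x \<in> proj_lines" if "x \<noteq> 0" for x
    unfolding M_def
  proof (rule span_pair_proj_line[OF that])
    show "T x \<notin> vec.span {x}"
    proof
      assume "T x \<in> vec.span {x}"
      then obtain k where k: "T x = k *s x"
        by (auto simp: vec.span_singleton)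
      then have "(k * k + k - e) *s x = 0"
        using T_T[of x] by (simp add: T_scale vec.scale_left_diff_distrib vec.scale_left_distrib)
      then show False
        using irred that by simp
    qed
  qed
  have in_M: "x \<in> M x" for x
    by (simp add: M_def vec.span_base)
  \<comment> \<open>\<open>M x\<close> is stable under \<open>T\<close>, so it contains
    \<open>M y\<close>, and both have dimension 2.\<close>
  have M_eq: "M y = M x" if y: "y \<in> M x" "y \<noteq> 0" for x y
  proof (cases "x = 0")
    case True
    then have "M x = {0}"
      using T_scale[of 0 0] by (simp add: M_def)
    then show ?thesis
      using that by simp
  next
    case False
    obtain a b where y_eq: "y = a *s x + b *s T x"
      using y(1) unfolding M_def by (rule span_pairE)
    have T: "T y = a *s T x + b *s (e *s x - T x)"
      unfolding y_eq T_add T_scale T_T ..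
    have "x \<in> M x" "T x \<in> M x"
      by (simp_all add: M_def vec.span_base)
    then have "T y \<in> M x"
      unfolding T M_def by (intro vec.span_add vec.span_scale vec.span_diff)
    then have "M y \<subseteq> M x"
      using that(1) unfolding M_def[of y] by (intro vec.span_minimal) (auto simp: M_def)
    then show ?thesis
      using line[OF False] line[OF that(2)] by (intro vec.subspace_dim_equal) (auto simp: proj_lines_def)
  qed
  define \<Sigma> where "\<Sigma> = M ` (UNIV - {0})"
  have lines: "\<Sigma> \<subseteq> proj_lines"
    using line by (auto simp: \<Sigma>_def)
  have skew: "pairwise skew \<Sigma>"
  proof (rule pairwiseI)
    fix L L'
    assume "L \<in> \<Sigma>" "L' \<in> \<Sigma>" "L \<noteq> L'"
    moreover from this have "0 \<in> L" "0 \<in> L'"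
      using lines zero_in_proj_line by blast+
    ultimately show "skew L L'"
      using M_eq unfolding skew_def \<Sigma>_def by blast
  qed
  have "axis 1 1 \<in> UNIV - {0 :: 'f ^ 4}"
    by (simp add: axis_eq_0_iff)
  then have zero: "0 \<in> \<Union>\<Sigma>"
    using zero_in_proj_line[OF line, of "axis 1 1"] unfolding \<Sigma>_def by blast
  have cover: "\<Union>\<Sigma> = UNIV"
  proof (rule UNIV_eq_I[symmetric])
    fix x :: "'f ^ 4"
    show "x \<in> \<Union>\<Sigma>"
    proof (cases "x = 0")
      case True
      then show ?thesis
        using zero by (simp only:)
    next
      case False
      then show ?thesis
        unfolding \<Sigma>_def using in_M[of x] by blast
    qed
  qed
  have "card (UNIV - {0 :: 'f ^ 4}) = card \<Sigma> * (CARD('f)\<^sup>2 - 1)"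
    unfolding cover[symmetric]
    by (rule card_Union_skew[OF _ skew]) (use lines card_proj_line_nonzero in blast)
  then have "CARD('f) ^ 4 - 1 = card \<Sigma> * (CARD('f)\<^sup>2 - 1)"
    by (simp add: card_Diff_subset card_vec_4)
  moreover have "CARD('f) ^ 4 - 1 = (CARD('f)\<^sup>2 + 1) * (CARD('f)\<^sup>2 - 1)"
  proof -
    have "CARD('f) ^ 4 = (CARD('f)\<^sup>2) * (CARD('f)\<^sup>2)"
      by (simp flip: power_add)
    then show ?thesis
      by (simp add: algebra_simps)
  qed
  moreover have "CARD('f)\<^sup>2 - 1 \<noteq> 0"
    using mult_le_mono[OF card_field_ge_2[where 'f='f] card_field_ge_2[where 'f='f]]
    by (simp add: power2_eq_square)
  ultimately have "card \<Sigma> = CARD('f)\<^sup>2 + 1"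
    by (metis mult_right_cancel)
  then show thesis
    using that lines skew cover by blast
qed

subsection \<open>Points outside a maximal partial spread\<close>

text \<open>Nonzero vectors instead of points: each point is counted \<open>q - 1\<close> times,
  which avoids quotients until \<open>card_hole_points\<close>.\<close>

definition holes :: "('f::field ^ 4) set set \<Rightarrow> ('f ^ 4) set" where
  "holes S = {x. x \<noteq> 0 \<and> x \<notin> \<Union>S}"

lemma holes_scale:
  assumes "S \<subseteq> proj_lines" "x \<in> holes S" "c \<noteq> 0"
  shows "c *s x \<in> holes S"
proof -
  have "x \<in> L" if "c *s x \<in> L" "L \<in> S" for L
    using vec.subspace_scale[OF proj_line_subspace, of L "c *s x" "inverse c"] that assms by auto
  then show ?thesis
    using assms by (auto simp: holes_def)
qed

lemma square_minus_1: "(q::nat)\<^sup>2 - 1 = (q - 1) * (q + 1)"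
  by (simp add: power2_eq_square algebra_simps)

locale maximal_spread =
  fixes S :: "('f::{field,finite} ^ 4) set set" and d :: nat
  assumes maximal: "maximal_partial_spread d S"
begin

lemma lines: "S \<subseteq> proj_lines" and skew: "pairwise skew S" and card_S: "card S + d = CARD('f)\<^sup>2 + 1"
  and d_pos: "d > 0"
  using maximal by (auto simp: maximal_partial_spread_def partial_spread_def)

lemma card_holes: "card (holes S) = d * (CARD('f) + 1) * (CARD('f) - 1)"
proof -
  obtain \<Sigma> :: "('f ^ 4) set set" where
    \<Sigma>: "\<Sigma> \<subseteq> proj_lines" "pairwise skew \<Sigma>" "\<Union>\<Sigma> = UNIV" "card \<Sigma> = CARD('f)\<^sup>2 + 1"
    by (rule spread_exists)
  have n: "card (L - {0}) = CARD('f)\<^sup>2 - 1" if "L \<in> proj_lines" for L :: "('f ^ 4) set"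
    using that by (rule card_proj_line_nonzero)
  have "holes S = (\<Union>\<Sigma> - {0}) - (\<Union>S - {0})"
    unfolding \<Sigma>(3) by (auto simp: holes_def)
  then have "card (holes S) = card (\<Union>\<Sigma> - {0}) - card (\<Union>S - {0})"
    by (simp only:) (rule card_Diff_subset, use \<Sigma>(3) in auto)
  also have "card (\<Union>\<Sigma> - {0}) = (card S + d) * (CARD('f)\<^sup>2 - 1)"
    unfolding card_S \<Sigma>(4)[symmetric]
    by (rule card_Union_skew[OF n \<Sigma>(2)]) (use \<Sigma>(1) in blast)
  also have "card (\<Union>S - {0}) = card S * (CARD('f)\<^sup>2 - 1)"
    by (rule card_Union_skew[OF n skew]) (use lines in blast)
  finally show ?thesis
    by (simp only: add_mult_distrib add_diff_cancel_left') (simp only: square_minus_1 mult_ac)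
qed

text \<open>Here maximality enters: a line consisting of holes could be added to \<open>S\<close>,
  lowering the deficiency to \<open>d - 1\<close>.\<close>

lemma line_meets_spread:
  assumes "L \<in> proj_lines"
  obtains x where "x \<in> L" "x \<noteq> 0" "x \<notin> holes S"
proof (rule ccontr)
  assume "\<not> thesis"
  then have L: "x \<in> holes S" if "x \<in> L" "x \<noteq> 0" for x
    using that \<open>\<not> thesis\<close> \<open>\<And>x. x \<in> L \<Longrightarrow> x \<noteq> 0 \<Longrightarrow> x \<notin> holes S \<Longrightarrow> thesis\<close> by blast
  have "skew L M" "skew M L" if "M \<in> S" for M
    using L that zero_in_proj_line[OF assms] zero_in_proj_line[of M] lines
    by (auto simp: skew_def holes_def)
  then have "pairwise skew (insert L S)"
    using skew by (auto simp: pairwise_insert)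
  moreover have "L \<noteq> {0}"
    using assms by (auto simp: proj_lines_def)
  then have "L \<notin> S"
    using L zero_in_proj_line[OF assms] by (auto simp: holes_def)
  moreover have "card (insert L S) + (d - 1) = CARD('f)\<^sup>2 + 1"
    using \<open>L \<notin> S\<close> card_S d_pos by simp
  ultimately have "partial_spread (d - 1) (insert L S)" "S \<subset> insert L S"
    using lines assms by (auto simp: partial_spread_def)
  then show False
    using maximal unfolding maximal_partial_spread_def by blast
qed

text \<open>At least one of the \<open>q + 1\<close> points of \<open>L\<close> lies on a line of
  \<open>S\<close>; all its multiples are lost as well.\<close>

lemma card_holes_line:
  assumes "L \<in> proj_lines"
  shows "card (holes S \<inter> L) \<le> CARD('f) * (CARD('f) - 1)"
proof -
  obtain x where x: "x \<in> L" "x \<noteq> 0" "x \<notin> holes S"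
    using line_meets_spread[OF assms] .
  have "vec.span {x} \<subseteq> L"
    using x(1) proj_line_subspace[OF assms] by (intro vec.span_minimal) auto
  moreover have "holes S \<inter> vec.span {x} = {}"
  proof -
    have "c *s x \<notin> holes S" for c
      using holes_scale[OF lines, of "c *s x" "inverse c"] x(3)
      by (cases "c = 0") (auto simp: holes_def)
    then show ?thesis
      by (auto simp: vec.span_singleton)
  qed
  ultimately have "card (holes S \<inter> L) \<le> card (L - vec.span {x})"
    by (intro card_mono) auto
  also have "\<dots> = CARD('f)\<^sup>2 - CARD('f)"
    using \<open>vec.span {x} \<subseteq> L\<close> card_span_independent[of "{x}"] x(2)
    by (simp add: card_Diff_subset card_proj_line[OF assms])
  finally show ?thesis
    by (simp add: power2_eq_square algebra_simps)
qed

text \<open>The number \<open>j\<close> counts the lines of \<open>S\<close> in the plane, at most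
  one because two skew lines are not coplanar. Every other line of \<open>S\<close> meets the plane
  in a single point.\<close>

lemma card_holes_hyperplane:
  assumes "m \<noteq> 0"
  obtains j :: nat where "j \<le> 1"
    "card {x \<in> holes S. dot m x = 0} + j * CARD('f) * (CARD('f) - 1) = (CARD('f) - 1) * (CARD('f) + d)"
proof -
  let ?q = "CARD('f)"
  let ?W = "{x. dot m x = 0}"
  have q2: "?q \<ge> 2"
    by (rule card_field_ge_2)
  define J where "J = {L \<in> S. L \<subseteq> ?W}"
  have "card J \<le> 1"
  proof (rule ccontr)
    assume "\<not> card J \<le> 1"
    then obtain L M where LM: "L \<in> J" "M \<in> J" "L \<noteq> M"
      by (metis One_nat_def card_le_Suc0_iff_eq finite)
    then have "L \<in> proj_lines" "M \<in> proj_lines" "L \<inter> M = {0}"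
      using lines skew by (auto simp: J_def pairwise_def skew_def)
    moreover have "L \<subseteq> ?W" "M \<subseteq> ?W"
      using LM by (auto simp: J_def)
    ultimately show False
      using skew_lines_not_in_hyperplane[OF _ _ _ assms] by blast
  qed
  have in_J: "card (L \<inter> ?W - {0}) = ?q\<^sup>2 - 1" if "L \<in> J" for L
  proof -
    have L: "L \<in> proj_lines" "L \<inter> ?W = L"
      using that lines by (auto simp: J_def)
    then show ?thesis
      by (simp add: card_proj_line_nonzero)
  qed
  have not_in_J: "card (L \<inter> ?W - {0}) = ?q - 1" if L_J: "L \<in> S - J" for L
  proof -
    have L: "L \<in> proj_lines"
      using L_J lines by auto
    obtain x where "x \<in> L" "dot m x \<noteq> 0"
      using L_J by (auto simp: J_def)
    from card_subspace_hyperplane[OF proj_line_subspace[OF L] this]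
    have "?q\<^sup>2 = ?q * card (L \<inter> ?W)"
      by (simp add: card_proj_line[OF L] Int_def)
    then have "card (L \<inter> ?W) = ?q"
      using q2 by (simp add: power2_eq_square)
    then show ?thesis
      using zero_in_proj_line[OF L] by (simp add: card_Diff_singleton)
  qed
  have disj: "(\<Union>L\<in>S. L \<inter> ?W - {0}) = \<Union>S \<inter> ?W - {0}"
    by auto
  have "card (\<Union>S \<inter> ?W - {0}) = (\<Sum>L\<in>S. card (L \<inter> ?W - {0}))"
    unfolding disj[symmetric]
    using skew by (intro card_UN_disjoint) (auto simp: pairwise_def skew_def)
  also have "\<dots> = (\<Sum>L\<in>J. card (L \<inter> ?W - {0})) + (\<Sum>L\<in>S - J. card (L \<inter> ?W - {0}))"
    by (subst sum.subset_diff[of J]) (auto simp: J_def)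
  also have "\<dots> = card J * (?q\<^sup>2 - 1) + card (S - J) * (?q - 1)"
    using in_J not_in_J by simp
  finally have U: "card (\<Union>S \<inter> ?W - {0}) = card J * (?q\<^sup>2 - 1) + card (S - J) * (?q - 1)" .
  have "?W - {0} = {x \<in> holes S. dot m x = 0} \<union> (\<Union>S \<inter> ?W - {0})"
    by (auto simp: holes_def)
  then have "card (?W - {0}) = card {x \<in> holes S. dot m x = 0} + card (\<Union>S \<inter> ?W - {0})"
    by (simp only:) (rule card_Un_disjoint, auto simp: holes_def)
  moreover have "card (?W - {0}) = ?q ^ 3 - 1"
    by (simp add: card_Diff_subset card_hyperplane[OF assms])
  ultimately have eq: "card {x \<in> holes S. dot m x = 0} + (card J * (?q\<^sup>2 - 1) + card (S - J) * (?q - 1)) = ?q ^ 3 - 1"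
    using U by simp
  have card_SJ: "card (S - J) + card J + d = ?q\<^sup>2 + 1"
    using card_S card_Diff_subset[of J S] card_mono[of S J] by (simp add: J_def)
  show thesis
  proof (rule that[of "card J"])
    show "card J \<le> 1" by fact
    \<comment> \<open>The identity is checked over the integers with \<open>q = n + 1\<close>, away
      from truncated subtraction.\<close>
    define n where "n = ?q - 1"
    have q: "?q = n + 1"
      using q2 by (simp add: n_def)
    have "int (card {x \<in> holes S. dot m x = 0}) + int (card J) * int ?q * int n = int n * (int ?q + int d)"
    proof -
      have e1: "int (card {x \<in> holes S. dot m x = 0}) + (int (card J) * ((int n + 1)\<^sup>2 - 1) + int (card (S - J)) * int n)
        = (int n + 1) ^ 3 - 1"
        using arg_cong[OF eq, of int] q by (simp add: of_nat_diff power2_eq_square power3_eq_cube algebra_simps)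
      have e2: "int (card (S - J)) = (int n + 1)\<^sup>2 + 1 - int d - int (card J)"
        using arg_cong[OF card_SJ, of int] q by (simp add: algebra_simps)
      show ?thesis
        using e1 unfolding e2 q by (simp add: power2_eq_square power3_eq_cube algebra_simps)
    qed
    then show "card {x \<in> holes S. dot m x = 0} + card J * ?q * (?q - 1) = (?q - 1) * (?q + d)"
      unfolding n_def[symmetric] by (simp flip: of_nat_mult of_nat_add)
  qed
qed

text \<open>With \<open>d = 1\<close> there are \<open>q + 1\<close> hole points, and a plane
  contains either all of them or exactly one. So two of them span a line that contains them all,
  contrary to \<open>card_holes_line\<close>.\<close>

lemma deficiency_neq_1: "d \<noteq> 1"
proof
  assume d: "d = 1"
  let ?q = "CARD('f)"
  have q2: "?q \<ge> 2"
    by (rule card_field_ge_2)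
  have card: "card (holes S) = (?q + 1) * (?q - 1)"
    using card_holes d by simp
  then have "card (holes S) > 0"
    using q2 by simp
  then obtain x where x: "x \<in> holes S"
    using card_gt_0_iff by (metis ex_in_conv)
  then have "x \<noteq> 0"
    by (simp add: holes_def)
  have card_x: "card (vec.span {x} - {0}) = ?q - 1"
    using card_span_independent[of "{x}"] \<open>x \<noteq> 0\<close> by (simp add: card_Diff_subset vec.span_zero)
  have "\<not> holes S \<subseteq> vec.span {x}"
  proof
    assume "holes S \<subseteq> vec.span {x}"
    then have "holes S \<subseteq> vec.span {x} - {0}"
      by (auto simp: holes_def)
    then have "card (holes S) \<le> ?q - 1"
      unfolding card_x[symmetric] by (intro card_mono) auto
    then have "(?q + 1) * (?q - 1) \<le> 1 * (?q - 1)"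
      unfolding card by (simp only: mult_1)
    then show False
      using q2 by (simp only: mult_le_cancel2) simp
  qed
  then obtain y where y: "y \<in> holes S" "y \<notin> vec.span {x}"
    by blast
  let ?L = "vec.span {x, y}"
  have L: "?L \<in> proj_lines"
    by (rule span_pair_proj_line) fact+
  have hyp: "holes S \<subseteq> {z. dot m z = 0}" if m: "m \<noteq> 0" "dot m x = 0" "dot m y = 0" for m
  proof -
    obtain j where j: "j \<le> 1" "card {x \<in> holes S. dot m x = 0} + j * ?q * (?q - 1) = (?q - 1) * (?q + d)"
      using card_holes_hyperplane[OF m(1)] .
    have "insert y (vec.span {x} - {0}) \<subseteq> {x \<in> holes S. dot m x = 0}"
      using x y m holes_scale[OF lines x] by (auto simp: vec.span_singleton)
    then have "card (insert y (vec.span {x} - {0})) \<le> card {x \<in> holes S. dot m x = 0}"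
      by (rule card_mono[rotated]) simp
    then have gt: "?q - 1 < card {x \<in> holes S. dot m x = 0}"
      using y(2) card_x q2 by simp
    have "j = 0"
    proof (rule ccontr)
      assume "j \<noteq> 0"
      then have "j = 1"
        using j(1) by simp
      moreover have "(?q - 1) * (?q + d) = (?q - 1) + 1 * ?q * (?q - 1)"
        unfolding d by (simp only: distrib_left mult_1_right mult_1 mult.commute add.commute)
      ultimately have "card {x \<in> holes S. dot m x = 0} = ?q - 1"
        using j(2) by (simp only: add_right_cancel)
      then show False
        using gt by simp
    qed
    then have "card {x \<in> holes S. dot m x = 0} = card (holes S)"
      using j(2) d card by (simp add: mult.commute)
    then have "{x \<in> holes S. dot m x = 0} = holes S"
      by (intro card_subset_eq) auto
    then show ?thesis
      by blast
  qed
  have "holes S \<subseteq> ?L"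
  proof
    fix z
    assume z: "z \<in> holes S"
    obtain m n where mn: "\<And>x. x \<in> ?L \<longleftrightarrow> dot m x = 0 \<and> dot n x = 0"
      "\<And>a b. a *s m = b *s n \<Longrightarrow> a = 0 \<and> b = 0"
      using proj_line_coordinates[OF L] by metis
    have "m \<noteq> 0" "n \<noteq> 0"
      using mn(2)[of 1 0] mn(2)[of 0 1] by auto
    then show "z \<in> ?L"
      using mn(1) hyp z vec.span_base[of x "{x, y}"] vec.span_base[of y "{x, y}"] by blast
  qed
  then have "holes S \<inter> ?L = holes S"
    by blast
  then have "(?q + 1) * (?q - 1) \<le> ?q * (?q - 1)"
    using card_holes_line[OF L] card by simp
  then show False
    using q2 by (simp only: mult_le_cancel2) simp
qed

text \<open>If a plane contained all holes, comparing the two counts would give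
  \<open>d + j = 1\<close>, so \<open>d = 1\<close>.\<close>

lemma holes_not_in_hyperplane:
  assumes "m \<noteq> 0"
  obtains x where "x \<in> holes S" "dot m x \<noteq> 0"
proof (rule ccontr)
  let ?q = "CARD('f)"
  assume "\<not> thesis"
  then have "{x \<in> holes S. dot m x = 0} = holes S"
    using that by blast
  moreover obtain j where "j \<le> 1" "card {x \<in> holes S. dot m x = 0} + j * ?q * (?q - 1) = (?q - 1) * (?q + d)"
    using card_holes_hyperplane[OF assms] .
  ultimately have "d * (?q + 1) * (?q - 1) + j * ?q * (?q - 1) = (?q - 1) * (?q + d)"
    using card_holes by metis
  then have "(?q - 1) * (d * (?q + 1) + j * ?q) = (?q - 1) * (?q + d)"
    by (simp only: add_mult_distrib2 mult.commute mult.left_commute)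
  then have "d * (?q + 1) + j * ?q = ?q + d"
    using card_field_ge_2[where 'f='f] by simp
  then have "?q * (d + j) = ?q * 1"
    by (simp add: algebra_simps)
  then have "d + j = 1"
    by (simp del: mult_1_right)
  then show False
    using deficiency_neq_1 d_pos by simp
qed

end

section \<open>Points outside the spread over the algebraic closure\<close>

lemma proj_pointE:
  assumes "P \<in> proj_points"
  obtains x where "x \<noteq> 0" "P = vec.span {x}"
proof -
  have P: "vec.subspace P" "vec.dim P = 1"
    using assms by (auto simp: proj_points_def)
  obtain B where B: "B \<subseteq> P" "vec.independent B" "P \<subseteq> vec.span B" "card B = vec.dim P"
    using vec.basis_exists[of P] .
  then have "P = vec.span B"
    by (metis P(1) antisym vec.span_minimal)
  moreover obtain x where "B = {x}"
    using B(4) P(2) by (metis card_1_singletonE)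
  ultimately show thesis
    using that B(2) by auto
qed

lemma span_singleton_proj_point: "x \<noteq> 0 \<Longrightarrow> vec.span {x} \<in> proj_points"
  by (simp add: proj_points_def)

lemma span_singleton_subset_iff: "vec.subspace W \<Longrightarrow> vec.span {x} \<subseteq> W \<longleftrightarrow> x \<in> W"
  by (metis insert_subset empty_subsetI vec.span_base vec.span_minimal singletonI subsetD)

lemma skew_lines_common_point:
  assumes "pairwise skew A" "L \<in> A" "M \<in> A" "P \<in> proj_points" "P \<subseteq> L" "P \<subseteq> M"
  shows "L = M"
proof (rule ccontr)
  assume "L \<noteq> M"
  then have "L \<inter> M = {0}"
    using assms by (auto simp: pairwise_def skew_def)
  moreover obtain x where "x \<noteq> 0" "P = vec.span {x}"
    using proj_pointE[OF assms(4)] .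
  ultimately show False
    using assms(5,6) vec.span_base[of x "{x}"] by auto
qed

section \<open>Rational vectors in subspaces over the closure\<close>

lemma base_change_span: "base_change (vec.span {x}) = vec.span {ext x}"
proof -
  have "base_change (vec.span {x}) = vec.span (ext ` vec.span {x})"
    by (simp add: base_change_def ext_def)
  also have "\<dots> = vec.span {ext x}"
  proof (rule antisym)
    have "ext ` vec.span {x} \<subseteq> vec.span {ext x}"
      by (auto simp: vec.span_singleton)
    then show "vec.span (ext ` vec.span {x}) \<subseteq> vec.span {ext x}"
      by (rule vec.span_minimal) simp
    show "vec.span {ext x} \<subseteq> vec.span (ext ` vec.span {x})"
      by (rule vec.span_mono) (simp add: vec.span_base)
  qed
  finally show ?thesis .
qed

lemma ext_span_eq_imp:
  assumes "x \<noteq> 0" "ext y \<in> vec.span {ext x}"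
  shows "y \<in> vec.span {x}"
proof -
  obtain k where k: "ext y = k *s ext x"
    using assms(2) by (auto simp: vec.span_singleton)
  obtain i where i: "x $ i \<noteq> 0"
    using assms(1) by (auto simp: vec_eq_iff)
  have "to_ac (y $ i) = k * to_ac (x $ i)"
    using arg_cong[OF k, of "\<lambda>v. v $ i"] by simp
  then have "k = to_ac (y $ i / x $ i)"
    using i by (simp add: field_simps)
  then have "ext y = ext ((y $ i / x $ i) *s x)"
    unfolding ext_scale using k by simp
  then have "y = (y $ i / x $ i) *s x"
    by (simp only: ext_eq_iff)
  then show ?thesis
    by (metis vec.span_base vec.span_scale singletonI)
qed

text \<open>The functionals dual to a basis extend to the closure and pick out the coefficients of
  any linear relation.\<close>

lemma ext_independent:
  assumes "vec.independent B"
  shows "vec.independent (ext ` B)"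
proof (rule vec.independent_if_scalars_zero)
  show "finite (ext ` B)"
    using assms vec.finiteI_independent by blast
  define C where "C = vec.extend_basis B"
  have C: "B \<subseteq> C" "vec.independent C" "vec.span C = UNIV"
    unfolding C_def using assms
    by (auto simp: vec.extend_basis_superset vec.independent_extend_basis)
  obtain \<phi> where \<phi>: "\<And>b c. b \<in> C \<Longrightarrow> c \<in> C \<Longrightarrow> dot (\<phi> b) c = (if b = c then 1 else 0)"
    using coordinate_functionals[OF C(2,3)] by metis
  fix f x
  assume sum: "(\<Sum>x\<in>ext ` B. f x *s x) = 0" and "x \<in> ext ` B"
  then obtain b where b: "b \<in> B" "x = ext b"
    by blast
  have "inj_on ext B"
    by (auto simp: inj_on_def)
  then have "(\<Sum>c\<in>B. f (ext c) *s ext c) = 0"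
    using sum by (simp add: sum.reindex)
  then have "dot (ext (\<phi> b)) (\<Sum>c\<in>B. f (ext c) *s ext c) = 0"
    by simp
  then have "(\<Sum>c\<in>B. f (ext c) * to_ac (dot (\<phi> b) c)) = 0"
    by (simp add: dot_sum_right)
  moreover have "(\<Sum>c\<in>B. f (ext c) * to_ac (dot (\<phi> b) c)) = (\<Sum>c\<in>B. if c = b then f (ext c) else 0)"
  proof (rule sum.cong)
    show "f (ext c) * to_ac (dot (\<phi> b) c) = (if c = b then f (ext c) else 0)" if "c \<in> B" for c
      using \<phi>[OF subsetD[OF C(1) b(1)] subsetD[OF C(1) that]] by auto
  qed simp
  ultimately show "f x = 0"
    using b vec.finiteI_independent[OF assms] by simp
qed

text \<open>Lines and planes over the closure need not be rational. Their rational vectors still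
  form a subspace of no larger dimension, because independence survives the extension.\<close>

lemma rational_trace:
  assumes "vec.subspace W"
  shows "vec.subspace {x. ext x \<in> W}" "vec.dim {x. ext x \<in> W} \<le> vec.dim W"
proof -
  show "vec.subspace {x. ext x \<in> W}"
    using assms by (intro vec.subspaceI) (auto simp: vec.subspace_0 vec.subspace_add vec.subspace_scale)
  obtain B where B: "B \<subseteq> {x. ext x \<in> W}" "vec.independent B" "card B = vec.dim {x. ext x \<in> W}"
    using vec.basis_exists[of "{x. ext x \<in> W}"] by metis
  have "card (ext ` B) = card B"
    by (rule card_image) (auto simp: inj_on_def)
  moreover have "card (ext ` B) \<le> vec.dim W"
    using B ext_independent by (intro vec.independent_card_le_dim) auto
  ultimately show "vec.dim {x. ext x \<in> W} \<le> vec.dim W"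
    using B(3) by simp
qed

lemma proj_line_eq_span:
  assumes L: "L \<in> proj_lines" and "ext a \<in> L" "ext b \<in> L" "a \<noteq> 0" "b \<notin> vec.span {a}"
  shows "L = vec.span {ext a, ext b}"
proof -
  have "vec.independent {b, a}"
    using assms(4,5) by (subst vec.independent_insert) (auto simp: vec.span_base)
  from ext_independent[OF this] have ind: "vec.independent {ext a, ext b}"
    by (simp add: insert_commute)
  have "a \<noteq> b"
    using assms(5) vec.span_base by blast
  then have "L \<subseteq> vec.span {ext a, ext b}"
    using L assms(2,3) by (intro vec.card_ge_dim_independent ind) (auto simp: proj_lines_def)
  moreover have "vec.span {ext a, ext b} \<subseteq> L"
    using assms(2,3) proj_line_subspace[OF L] by (intro vec.span_minimal) auto
  ultimately show ?thesis
    by blast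
qed

lemma grid_points_on_line:
  assumes Z: "Z = {L \<inter> M | L M. L \<in> A \<and> M \<in> B}" and "pairwise skew A" "pairwise skew B"
    and pt: "\<And>L M. L \<in> A \<Longrightarrow> M \<in> B \<Longrightarrow> L \<inter> M \<in> proj_points" and L: "L \<in> A"
  shows "{P \<in> Z. P \<subseteq> L} = (\<lambda>M. L \<inter> M) ` B" "card {P \<in> Z. P \<subseteq> L} = card B"
proof -
  show eq: "{P \<in> Z. P \<subseteq> L} = (\<lambda>M. L \<inter> M) ` B"
  proof (intro equalityI subsetI)
    fix P
    assume "P \<in> {P \<in> Z. P \<subseteq> L}"
    then obtain L' M where P: "P = L' \<inter> M" "L' \<in> A" "M \<in> B" "P \<subseteq> L"
      using Z by auto
    then have "L = L'"
      using skew_lines_common_point[OF assms(2) L P(2) pt[OF P(2,3)]] by auto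
    then show "P \<in> (\<lambda>M. L \<inter> M) ` B"
      using P by blast
  qed (use Z L in auto)
  have "inj_on (\<lambda>M. L \<inter> M) B"
  proof (rule inj_onI)
    fix M M'
    assume "M \<in> B" "M' \<in> B" "L \<inter> M = L \<inter> M'"
    then show "M = M'"
      using skew_lines_common_point[OF assms(3), of M M' "L \<inter> M"] pt[OF L] by blast
  qed
  then show "card {P \<in> Z. P \<subseteq> L} = card B"
    unfolding eq by (rule card_image)
qed

context maximal_spread
begin

definition hole_points :: "('f alg_closure ^ 4) set set" where
  "hole_points = base_change ` (proj_points - points_on S)"

lemma hole_points_eq: "hole_points = (\<lambda>x. vec.span {ext x}) ` holes S"
proof (intro equalityI subsetI)
  fix P
  assume "P \<in> hole_points"
  then obtain Q where Q: "Q \<in> proj_points" "Q \<notin> points_on S" "P = base_change Q"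
    by (auto simp: hole_points_def)
  obtain x where x: "x \<noteq> 0" "Q = vec.span {x}"
    using proj_pointE[OF Q(1)] .
  have "x \<notin> L" if "L \<in> S" for L
    using Q(1,2) that x(2) lines span_singleton_subset_iff[OF proj_line_subspace, of L x]
    by (auto simp: points_on_def)
  then have "x \<in> holes S"
    using x(1) by (auto simp: holes_def)
  then show "P \<in> (\<lambda>x. vec.span {ext x}) ` holes S"
    using Q(3) x(2) base_change_span by blast
next
  fix P
  assume "P \<in> (\<lambda>x. vec.span {ext x}) ` holes S"
  then obtain x where x: "x \<in> holes S" "P = base_change (vec.span {x})"
    using base_change_span by blast
  have "\<not> vec.span {x} \<subseteq> L" if "L \<in> S" for L
    using x(1) that vec.span_base[of x "{x}"] by (auto simp: holes_def)
  then have "vec.span {x} \<in> proj_points - points_on S"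
    using x(1) span_singleton_proj_point by (auto simp: points_on_def holes_def)
  then show "P \<in> hole_points"
    using x(2) by (auto simp: hole_points_def)
qed

lemma hole_pointE:
  assumes "P \<in> hole_points"
  obtains x where "x \<in> holes S" "x \<noteq> 0" "P = vec.span {ext x}" "ext x \<in> P"
  using assms unfolding hole_points_eq holes_def by (auto simp: vec.span_base)

lemma finite_hole_points: "finite hole_points"
  by (simp add: hole_points_eq)

lemma hole_points_subset: "hole_points \<subseteq> proj_points"
  by (auto elim!: hole_pointE intro!: span_singleton_proj_point)

lemma hole_points_neq:
  assumes "P = vec.span {ext x}" "Q = vec.span {ext y}" "P \<noteq> Q" "x \<noteq> 0" "y \<noteq> 0"
  shows "y \<notin> vec.span {x}"
proof
  assume "y \<in> vec.span {x}"
  then obtain c where "y = c *s x"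
    by (auto simp: vec.span_singleton)
  then have "ext y = to_ac c *s ext x" "c \<noteq> 0"
    using assms(5) by auto
  then have "vec.span {ext y} = vec.span {ext x}"
    using vec.span_image_scale[of "{ext x}" "\<lambda>_. to_ac c"] by simp
  then show False
    using assms by simp
qed

lemma card_hole_points:
  assumes "vec.subspace W"
  shows "card {P \<in> hole_points. P \<subseteq> W} * (CARD('f) - 1) = card {x \<in> holes S. ext x \<in> W}"
proof -
  let ?A = "{x \<in> holes S. ext x \<in> W}" and ?g = "\<lambda>x. vec.span {ext x}"
  have img: "?g ` ?A = {P \<in> hole_points. P \<subseteq> W}"
    unfolding hole_points_eq using span_singleton_subset_iff[OF assms] by auto
  have fib: "card {x \<in> ?A. ?g x = P} = CARD('f) - 1" if P: "P \<in> ?g ` ?A" for P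
  proof -
    obtain x where x: "x \<in> holes S" "ext x \<in> W" "P = ?g x"
      using P by auto
    then have "x \<noteq> 0"
      by (simp add: holes_def)
    have "{x \<in> ?A. ?g x = P} = vec.span {x} - {0}"
    proof (intro equalityI subsetI)
      fix y
      assume y: "y \<in> {x \<in> ?A. ?g x = P}"
      then have "ext y \<in> vec.span {ext x}"
        using x(3) vec.span_base[of "ext y" "{ext y}"] by auto
      then show "y \<in> vec.span {x} - {0}"
        using y ext_span_eq_imp[OF \<open>x \<noteq> 0\<close>] by (auto simp: holes_def)
    next
      fix y
      assume "y \<in> vec.span {x} - {0}"
      then obtain c where c: "y = c *s x" "c \<noteq> 0"
        by (auto simp: vec.span_singleton)
      have "?g y = ?g x"
        using c vec.span_image_scale[of "{ext x}" "\<lambda>_. to_ac c"] by simp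
      then show "y \<in> {x \<in> ?A. ?g x = P}"
        using x c holes_scale[OF lines x(1)] vec.subspace_scale[OF assms] by auto
    qed
    then show ?thesis
      using card_span_independent[of "{x}"] \<open>x \<noteq> 0\<close> by (simp add: card_Diff_singleton vec.span_zero)
  qed
  have "card ?A = (\<Sum>P\<in>?g ` ?A. \<Sum>x\<in>{x \<in> ?A. ?g x = P}. 1)"
    unfolding card_eq_sum by (rule sum.image_gen) simp
  also have "\<dots> = (\<Sum>P\<in>?g ` ?A. CARD('f) - 1)"
    using fib by (intro sum.cong) auto
  finally show ?thesis
    unfolding img by simp
qed

lemma card_all_hole_points: "card hole_points = d * (CARD('f) + 1)"
proof -
  have "card hole_points * (CARD('f) - 1) = d * (CARD('f) + 1) * (CARD('f) - 1)"
    using card_hole_points[OF vec.subspace_UNIV] card_holes by simp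
  then show ?thesis
    using card_field_ge_2[where 'f='f] by simp
qed

text \<open>The rational vectors of \<open>L\<close> either form a rational line, where maximality
  gives the bound, or a space of dimension at most 1, which contains at most one point.\<close>

lemma card_hole_points_line:
  assumes "L \<in> proj_lines"
  shows "card {P \<in> hole_points. P \<subseteq> L} \<le> CARD('f)"
proof -
  let ?q = "CARD('f)"
  have q2: "?q \<ge> 2"
    by (rule card_field_ge_2)
  let ?M = "{x. ext x \<in> L}"
  have M: "vec.subspace ?M" "vec.dim ?M \<le> 2"
    using rational_trace[OF proj_line_subspace[OF assms]] assms by (auto simp: proj_lines_def)
  have "card {x \<in> holes S. ext x \<in> L} \<le> ?q * (?q - 1)"
  proof (cases "vec.dim ?M = 2")
    case True
    then have "?M \<in> proj_lines"
      using M(1) by (simp add: proj_lines_def)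
    from card_holes_line[OF this] show ?thesis
      by (simp add: Int_def)
  next
    case False
    then have "vec.dim ?M \<le> 1"
      using M(2) by simp
    then have "card ?M \<le> ?q ^ 1"
      unfolding card_subspace[OF M(1)] using q2 by (intro power_increasing) auto
    moreover have "card {x \<in> holes S. ext x \<in> L} \<le> card (?M - {0})"
      by (intro card_mono) (auto simp: holes_def)
    moreover have "card (?M - {0}) = card ?M - 1"
      using vec.subspace_0[OF M(1)] by (simp add: card_Diff_singleton)
    ultimately have "card {x \<in> holes S. ext x \<in> L} \<le> 1 * (?q - 1)"
      by simp
    also have "\<dots> \<le> ?q * (?q - 1)"
      using q2 by (intro mult_le_mono1) simp
    finally show ?thesis .
  qed
  then have "card {P \<in> hole_points. P \<subseteq> L} * (?q - 1) \<le> ?q * (?q - 1)"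
    using card_hole_points[OF proj_line_subspace[OF assms]] by simp
  then show ?thesis
    using q2 by (simp only: mult_le_cancel2)
qed

lemma hole_points_not_planar:
  assumes "H \<in> proj_planes"
  shows "\<exists>P\<in>hole_points. \<not> P \<subseteq> H"
proof -
  let ?W = "{x. ext x \<in> H}"
  have H: "vec.subspace H" "vec.dim H = 3"
    using assms by (auto simp: proj_planes_def)
  have "vec.dim ?W \<le> 3"
    using rational_trace(2)[OF H(1)] H(2) by simp
  then have "?W \<noteq> UNIV"
    using vec_dim_card[where 'a='f and 'n=4] by auto
  then obtain m where m: "m \<noteq> 0" "\<And>x. x \<in> ?W \<Longrightarrow> dot m x = 0"
    using proper_subspace_in_hyperplane[OF rational_trace(1)[OF H(1)]] by metis
  obtain x where x: "x \<in> holes S" "dot m x \<noteq> 0"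
    using holes_not_in_hyperplane[OF m(1)] .
  then have "ext x \<notin> H"
    using m(2) by auto
  then have "\<not> vec.span {ext x} \<subseteq> H"
    using vec.span_base by blast
  then show ?thesis
    using x(1) unfolding hole_points_eq by blast
qed

lemma hole_points_not_grid: "\<not> grid m n hole_points"
proof
  let ?q = "CARD('f)"
  have q2: "?q \<ge> 2"
    by (rule card_field_ge_2)
  assume "grid m n hole_points"
  then obtain A B where A: "A \<subseteq> proj_lines" "finite A" "card A = m" "pairwise skew A"
    and B: "B \<subseteq> proj_lines" "finite B" "card B = n" "pairwise skew B"
    and pt: "\<And>L M. L \<in> A \<Longrightarrow> M \<in> B \<Longrightarrow> L \<inter> M \<in> proj_points"
    and Z: "hole_points = {L \<inter> M | L M. L \<in> A \<and> M \<in> B}"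
    unfolding grid_def by auto
  have Z': "hole_points = {L \<inter> M | L M. L \<in> B \<and> M \<in> A}"
    unfolding Z by (auto simp: Int_commute)
  have pt': "L \<inter> M \<in> proj_points" if "L \<in> B" "M \<in> A" for L M
    using pt[OF that(2,1)] by (simp add: Int_commute)
  have on_A: "card {P \<in> hole_points. P \<subseteq> L} = n" if "L \<in> A" for L
    using grid_points_on_line(2)[OF Z A(4) B(4) pt that] B(3) by simp
  have on_B: "card {P \<in> hole_points. P \<subseteq> M} = m" if "M \<in> B" for M
    using grid_points_on_line(2)[OF Z' B(4) A(4) pt' that] A(3) by simp
  have "inj_on (\<lambda>(L, M). L \<inter> M) (A \<times> B)"
  proof (rule inj_onI, clarify)
    fix L M L' M'
    assume "L \<in> A" "M \<in> B" "L' \<in> A" "M' \<in> B" and eq: "L \<inter> M = L' \<inter> M'"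
    then have "L \<inter> M \<subseteq> L'" "L \<inter> M \<subseteq> M'"
      by auto
    then show "L = L' \<and> M = M'"
      using skew_lines_common_point[OF A(4) \<open>L \<in> A\<close> \<open>L' \<in> A\<close> pt[OF \<open>L \<in> A\<close> \<open>M \<in> B\<close>]]
        skew_lines_common_point[OF B(4) \<open>M \<in> B\<close> \<open>M' \<in> B\<close> pt[OF \<open>L \<in> A\<close> \<open>M \<in> B\<close>]] by auto
  qed
  moreover have "hole_points = (\<lambda>(L, M). L \<inter> M) ` (A \<times> B)"
    unfolding Z by auto
  ultimately have mn: "m * n = d * (?q + 1)"
    using card_all_hole_points A(3) B(3) by (simp add: card_image card_cartesian_product)
  have "m * n > 0"
    unfolding mn using d_pos by simp
  then obtain L M where L: "L \<in> A" and M: "M \<in> B"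
    using A(3) B(3) by fastforce
  have le: "n \<le> ?q" "m \<le> ?q"
    using on_A[OF L] on_B[OF M] card_hole_points_line[of L] card_hole_points_line[of M] L M A(1) B(1)
    by auto
  have "?q < m * n"
    unfolding mn using d_pos by (cases d) auto
  \<comment> \<open>If one of the factors were at most 1, the product would be at most
    \<open>?q\<close>.\<close>
  then have ge: "m \<ge> 2" "n \<ge> 2"
    using le by (metis One_nat_def Suc_1 le_neq_implies_less less_Suc_eq_0_disj mult.commute
        mult_1 mult_is_0 not_less not_less_eq_eq less_nat_zero_code)+
  have "\<not> B \<subseteq> {M}" "\<not> A \<subseteq> {L}"
    using card_mono[of "{M}" B] card_mono[of "{L}" A] ge A(3) B(3) by auto
  then obtain M' L' where M': "M' \<in> B" "M' \<noteq> M" and L': "L' \<in> A" "L' \<noteq> L"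
    by blast
  have in_Z: "L \<inter> M \<in> hole_points" if "L \<in> A" "M \<in> B" for L M
    using that unfolding Z by auto
  \<comment> \<open>Grid points are rational, so the plane spanned by \<open>L\<close> and
    \<open>M\<close> is spanned by the rational points \<open>x\<close>, \<open>y\<close>,
    \<open>z\<close> and has a rational equation \<open>k\<close>.\<close>
  obtain x where x: "x \<noteq> 0" "L \<inter> M = vec.span {ext x}" "ext x \<in> L \<inter> M"
    using hole_pointE[OF in_Z[OF L M]] by metis
  obtain y where y: "y \<noteq> 0" "L \<inter> M' = vec.span {ext y}" "ext y \<in> L \<inter> M'"
    using hole_pointE[OF in_Z[OF L M'(1)]] by metis
  obtain z where z: "z \<noteq> 0" "L' \<inter> M = vec.span {ext z}" "ext z \<in> L' \<inter> M"
    using hole_pointE[OF in_Z[OF L'(1) M]] by metis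
  have neq_L: "L1 \<inter> M1 \<noteq> L1 \<inter> M2" if "L1 \<in> A" "M1 \<in> B" "M2 \<in> B" "M1 \<noteq> M2" for L1 M1 M2
    using skew_lines_common_point[OF B(4) that(2,3) pt[OF that(1,2)]] that(4) by blast
  have neq_M: "L1 \<inter> M1 \<noteq> L2 \<inter> M1" if "L1 \<in> A" "L2 \<in> A" "M1 \<in> B" "L1 \<noteq> L2" for L1 L2 M1
    using skew_lines_common_point[OF A(4) that(1,2) pt[OF that(1,3)]] that(4) by blast
  have xy: "y \<notin> vec.span {x}"
    using hole_points_neq[OF x(2) y(2) _ x(1) y(1)] neq_L[OF L M M'(1)] M'(2) by metis
  have xz: "z \<notin> vec.span {x}"
    using hole_points_neq[OF x(2) z(2) _ x(1) z(1)] neq_M[OF L L'(1) M] L'(2) by metis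
  have L_span: "L = vec.span {ext x, ext y}"
    using L A(1) x(3) y(3) by (intro proj_line_eq_span[OF _ _ _ x(1) xy]) auto
  have M_span: "M = vec.span {ext x, ext z}"
    using M B(1) x(3) z(3) by (intro proj_line_eq_span[OF _ _ _ x(1) xz]) auto

  have "vec.dim (vec.span {x, y, z}) \<le> card {x, y, z}"
    by (rule vec.dim_le_card) auto
  also have "\<dots> < 4"
    by (simp add: card_insert_if)
  finally have dim: "vec.dim (vec.span {x, y, z}) < 4" .
  have "vec.span {x, y, z} \<noteq> UNIV"
  proof
    assume eq: "vec.span {x, y, z} = UNIV"
    show False
      using dim unfolding eq vec_dim_card by simp
  qed
  then obtain k where k: "k \<noteq> 0" "\<And>v. v \<in> vec.span {x, y, z} \<Longrightarrow> dot k v = 0"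
    using proper_subspace_in_hyperplane[OF vec.subspace_span] by metis
  let ?H = "{v. dot (ext k) v = 0}"
  have H: "vec.subspace ?H"
    by (rule subspace_hyperplane)
  have k0: "dot k x = 0" "dot k y = 0" "dot k z = 0"
    using k(2) by (auto simp: vec.span_base)
  have LH: "L \<subseteq> ?H" and MH: "M \<subseteq> ?H"
    unfolding L_span M_span using k0 by (intro vec.span_minimal H; auto)+

  \<comment> \<open>A point of \<open>L1\<close> in the plane, other than that on \<open>M\<close>,
    would put all of \<open>L1\<close> into it. Then \<open>L\<close> and \<open>L1\<close> would
    come from two skew rational lines in one rational plane.\<close>
  have off: False if L1: "L1 \<in> A" "L1 \<noteq> L" and M1: "M1 \<in> B" "M1 \<noteq> M" and sub: "L1 \<inter> M1 \<subseteq> ?H" for L1 M1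
  proof -
    obtain a where a: "a \<noteq> 0" "L1 \<inter> M = vec.span {ext a}" "ext a \<in> L1 \<inter> M"
      using hole_pointE[OF in_Z[OF L1(1) M]] by metis
    obtain b where b: "b \<noteq> 0" "L1 \<inter> M1 = vec.span {ext b}" "ext b \<in> L1 \<inter> M1"
      using hole_pointE[OF in_Z[OF L1(1) M1(1)]] by metis
    have ab: "b \<notin> vec.span {a}"
      using hole_points_neq[OF a(2) b(2) _ a(1) b(1)] neq_L[OF L1(1) M M1(1)] M1(2) by metis
    have lines': "vec.span {x, y} \<in> proj_lines" "vec.span {a, b} \<in> proj_lines"
      using span_pair_proj_line x(1) xy a(1) ab by auto
    have ext_span: "ext v \<in> N" if "v \<in> vec.span {s, t}" "ext s \<in> N" "ext t \<in> N" "N \<in> proj_lines"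
      for v s t N
    proof -
      have "vec.span {s, t} \<subseteq> {x. ext x \<in> N}"
        using that(2,3) rational_trace(1)[OF proj_line_subspace[OF that(4)]]
        by (intro vec.span_minimal) auto
      then show ?thesis
        using that(1) by auto
    qed
    have "L \<inter> L1 = {0}"
      using A(4) L L1 by (auto simp: pairwise_def skew_def)
    moreover have "ext v \<in> L \<inter> L1" if "v \<in> vec.span {x, y} \<inter> vec.span {a, b}" for v
      using ext_span[of v x y L] ext_span[of v a b L1] that x(3) y(3) a(3) b(3) L L1(1) A(1) by auto
    ultimately have "v = 0" if "v \<in> vec.span {x, y} \<inter> vec.span {a, b}" for v
      using that by (metis ext_eq_0_iff singletonD)
    then have int: "vec.span {x, y} \<inter> vec.span {a, b} = {0}"
      using vec.span_zero by blast
    have "dot (ext k) (ext a) = 0" "dot (ext k) (ext b) = 0"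
      using a(3) b(3) MH sub by auto
    then have "dot k a = 0" "dot k b = 0"
      by simp_all
    then have "vec.span {x, y} \<subseteq> {v. dot k v = 0}" "vec.span {a, b} \<subseteq> {v. dot k v = 0}"
      using k0 by (intro vec.span_minimal subspace_hyperplane; auto)+
    then show False
      using skew_lines_not_in_hyperplane[OF lines' int k(1)] by blast
  qed
  have pts_H: "{P \<in> hole_points. P \<subseteq> ?H} = {P \<in> hole_points. P \<subseteq> L} \<union> {P \<in> hole_points. P \<subseteq> M}"
  proof (intro equalityI subsetI)
    fix P
    assume P: "P \<in> {P \<in> hole_points. P \<subseteq> ?H}"
    then obtain L1 M1 where LM: "P = L1 \<inter> M1" "L1 \<in> A" "M1 \<in> B"
      unfolding Z by auto
    then have "L1 = L \<or> M1 = M"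
      using off[of L1 M1] P by blast
    then show "P \<in> {P \<in> hole_points. P \<subseteq> L} \<union> {P \<in> hole_points. P \<subseteq> M}"
      using P LM by blast
  qed (use LH MH in blast)
  have pts_LM: "{P \<in> hole_points. P \<subseteq> L} \<inter> {P \<in> hole_points. P \<subseteq> M} = {L \<inter> M}"
  proof (intro equalityI subsetI)
    fix P
    assume P: "P \<in> {P \<in> hole_points. P \<subseteq> L} \<inter> {P \<in> hole_points. P \<subseteq> M}"
    then obtain L1 M1 where LM: "P = L1 \<inter> M1" "L1 \<in> A" "M1 \<in> B"
      unfolding Z by auto
    have "L1 = L" "M1 = M"
      using skew_lines_common_point[OF A(4) LM(2) L pt[OF LM(2,3)]]
        skew_lines_common_point[OF B(4) LM(3) M pt[OF LM(2,3)]] P LM(1) by auto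
    then show "P \<in> {L \<inter> M}"
      using LM by simp
  qed (use in_Z[OF L M] in auto)
  \<comment> \<open>The plane contains exactly the grid points on \<open>L\<close> or
    \<open>M\<close>, which share one point.\<close>
  have "n + m = card {P \<in> hole_points. P \<subseteq> ?H} + 1"
    using card_Un_Int[of "{P \<in> hole_points. P \<subseteq> L}" "{P \<in> hole_points. P \<subseteq> M}"]
      on_A[OF L] on_B[OF M] finite_hole_points unfolding pts_H[symmetric] pts_LM by simp
  moreover obtain j where j: "j \<le> 1"
    "card {x \<in> holes S. dot k x = 0} + j * ?q * (?q - 1) = (?q - 1) * (?q + d)"
    using card_holes_hyperplane[OF k(1)] .
  have "card {P \<in> hole_points. P \<subseteq> ?H} * (?q - 1) = card {x \<in> holes S. dot k x = 0}"
    using card_hole_points[OF H] by simp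
  then have "(?q - 1) * (card {P \<in> hole_points. P \<subseteq> ?H} + j * ?q) = (?q - 1) * (?q + d)"
    using j(2) by (simp only: add_mult_distrib2 mult.commute mult.left_commute)
  then have "card {P \<in> hole_points. P \<subseteq> ?H} + j * ?q = ?q + d"
    using q2 by simp
  ultimately have sum: "n + m + j * ?q = ?q + d + 1"
    by simp
  show False
  proof (cases "j = 0")
    case True
    have e1: "int m = int ?q + int d + 1 - int n"
      using arg_cong[OF sum, of int] True by simp
    have e2: "int m * int n = int d * (int ?q + 1)"
      using arg_cong[OF mn, of int] by (simp add: algebra_simps)
    \<comment> \<open>Sum and product of \<open>m\<close> and \<open>n\<close> are those of
      \<open>q + 1\<close> and \<open>d\<close>, so one of \<open>m\<close>, \<open>n\<close> would
      be \<open>q + 1\<close>, but both are at most \<open>q\<close>.\<close>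
    have "(int ?q + 1 - int n) * (int d - int n) = 0"
      using e2 unfolding e1 by (simp add: algebra_simps)
    moreover have "int ?q + 1 - int n > 0" "int ?q + 1 - int m > 0"
      using le by simp_all
    ultimately show False
      using e1 by simp
  next
    case False
    then have "j = 1"
      using j(1) by simp
    then have "d + 1 = n + m"
      using sum by simp
    \<comment> \<open>Now \<open>n < d\<close>, so the number of points would be at least
      \<open>n * (q + 1)\<close>, while \<open>m \<le> q\<close> bounds it by
      \<open>q * n\<close>.\<close>
    then have "n * (?q + 1) \<le> d * (?q + 1)"
      using ge by (intro mult_le_mono1) simp
    also have "\<dots> = m * n"
      using mn by simp
    also have "\<dots> \<le> ?q * n"
      using le by (intro mult_le_mono1)
    finally show False
      using ge by simp
  qed
qed

end

section \<open>Ideals and complete intersections\<close>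

lemma module_times: "Modules.module ((*) :: 'r::comm_ring_1 \<Rightarrow> 'r \<Rightarrow> 'r)"
  by unfold_locales (simp_all add: algebra_simps)

lemma ideal_gen_subset_iff:
  assumes "\<And>x y. x \<in> I \<Longrightarrow> y \<in> I \<Longrightarrow> x + y \<in> I" "\<And>r x. x \<in> I \<Longrightarrow> r * x \<in> I" "0 \<in> I"
  shows "ideal_gen B \<subseteq> I \<longleftrightarrow> B \<subseteq> I"
proof
  show "ideal_gen B \<subseteq> I" if "B \<subseteq> I"
    unfolding ideal_gen_def
    by (rule Modules.module.span_minimal[OF module_times that]) (simp add: Modules.module.subspace_def[OF module_times] assms)
  show "B \<subseteq> I" if "ideal_gen B \<subseteq> I"
    using that Modules.module.span_base[OF module_times] unfolding ideal_gen_def by blast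
qed

lemma ideal_gen_add: "x \<in> ideal_gen B \<Longrightarrow> y \<in> ideal_gen B \<Longrightarrow> x + y \<in> ideal_gen B"
  unfolding ideal_gen_def by (rule Modules.module.span_add[OF module_times])

lemma ideal_gen_mult: "x \<in> ideal_gen B \<Longrightarrow> r * x \<in> ideal_gen B"
  unfolding ideal_gen_def by (rule Modules.module.span_scale[OF module_times])

lemma ideal_gen_0: "0 \<in> ideal_gen B"
  unfolding ideal_gen_def by (rule Modules.module.span_zero[OF module_times])

lemma ideal_gen_base: "x \<in> B \<Longrightarrow> x \<in> ideal_gen B"
  unfolding ideal_gen_def by (rule Modules.module.span_base[OF module_times])

lemma homogeneous_ideal_vanishes:
  assumes "f \<in> homogeneous_ideal V" "P \<in> V"
  shows "vanishes_at f P"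
proof -
  have "homogeneous_ideal V \<subseteq> {f. vanishes_at f P}"
    unfolding homogeneous_ideal_def
    by (subst ideal_gen_subset_iff)
      (use assms(2) in \<open>auto simp: vanishes_at_def mpoly_eval_add mpoly_eval_mult\<close>)
  then show ?thesis
    using assms(1) by blast
qed

lemma mpoly_eval_one: "mpoly_eval 1 v = 1"
  using mpoly_eval_single[of 0 1 v] by simp

text \<open>The zero polynomial is a form of every degree and must be excluded: if
  \<open>g = 0\<close>, then \<open>f\<close> is a common divisor, hence a unit, and 1 would lie in
  an ideal whose members all vanish at a point.\<close>

lemma complete_intersection_second_generator:
  assumes "complete_intersection a b V" "V \<noteq> {}" "V \<subseteq> proj_points"
  obtains g where "is_form b g" "g \<noteq> 0" "\<And>P. P \<in> V \<Longrightarrow> vanishes_at g P"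
proof -
  obtain f g where fg: "is_form a f" "is_form b g" "\<And>h. h dvd f \<Longrightarrow> h dvd g \<Longrightarrow> h dvd 1"
    "homogeneous_ideal V = ideal_gen {f, g}"
    using assms(1) unfolding complete_intersection_def by blast
  have in_ideal: "f \<in> homogeneous_ideal V" "g \<in> homogeneous_ideal V"
    unfolding fg(4) by (simp_all add: ideal_gen_base)
  show thesis
  proof (rule that[OF fg(2)])
    show "g \<noteq> 0"
    proof
      assume "g = 0"
      then have "f dvd 1"
        using fg(3)[of f] by simp
      then obtain k where "1 = k * f"
        by (metis dvdE mult.commute)
      then have "1 \<in> homogeneous_ideal V"
        using in_ideal(1) ideal_gen_mult unfolding fg(4) by metis
      moreover obtain P where P: "P \<in> V"
        using assms(2) by blast
      ultimately have "vanishes_at 1 P"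
        using homogeneous_ideal_vanishes by blast
      moreover have "0 \<in> P"
        using P assms(3) by (auto simp: proj_points_def vec.subspace_0)
      ultimately show False
        by (auto simp: vanishes_at_def mpoly_eval_one)
    qed
    show "vanishes_at g P" if "P \<in> V" for P
      using homogeneous_ideal_vanishes[OF in_ideal(2) that] .
  qed
qed

lemma vanishes_at_span_singleton:
  assumes "is_form k f"
  shows "vanishes_at f (vec.span {v}) \<longleftrightarrow> mpoly_eval f v = 0"
proof
  show "mpoly_eval f v = 0" if "vanishes_at f (vec.span {v})"
    using that vec.span_base[of v "{v}"] by (auto simp: vanishes_at_def)
next
  assume v: "mpoly_eval f v = 0"
  show "vanishes_at f (vec.span {v})"
    unfolding vanishes_at_def
  proof
    fix x
    assume "x \<in> vec.span {v}"
    then obtain c where "x = c *s v"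
      by (auto simp: vec.span_singleton)
    then show "mpoly_eval f x = 0"
      using form_fun_scale[OF form_fun_mpoly_eval[OF assms], of c v] v by simp
  qed
qed

lemma form_fun_matrix: "form_fun 1 (\<lambda>x. (A *v x) $ i)"
  unfolding matrix_vector_mult_def by (simp add: form_fun_linear)

lemma vec_linearI:
  "(\<And>x y. f (x + y) = f x + f y) \<Longrightarrow> (\<And>c x. f (c *s x) = c *s f x) \<Longrightarrow>
    Vector_Spaces.linear (*s) (*s) f"
  by (simp add: Vector_Spaces.linear_iff vec.vector_space_axioms)

lemma lift_add: "lift (x + y) = lift x + lift (y :: 'a::field ^ 3)"
  by (simp add: vec_eq_iff forall_4)

lemma lift_scale: "lift (c *s x) = c *s lift (x :: 'a::field ^ 3)"
  by (simp add: vec_eq_iff forall_4)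

section \<open>Projection to an arbitrary plane\<close>

context generic_vertex
begin

lemma vertex_not_rational: "p \<notin> vec.span {ext x}"
proof
  assume "p \<in> vec.span {ext x}"
  then obtain c where c: "p = c *s ext x"
    by (auto simp: vec.span_singleton)
  have "vec.dim (vec.span {x}) \<le> card {x}"
    by (rule vec.dim_le_card) auto
  then have "vec.dim (vec.span {x}) \<noteq> vec.dim (UNIV :: ('f ^ 4) set)"
    unfolding vec_dim_card by simp
  then have "vec.span {x} \<noteq> UNIV"
    by metis
  then obtain a where a: "a \<noteq> 0" "\<And>y. y \<in> vec.span {x} \<Longrightarrow> dot a y = 0"
    using proper_subspace_in_hyperplane[OF vec.subspace_span] by metis
  then have "dot (ext a) p = 0"
    unfolding c using a(2)[of x] by (simp add: vec.span_base)
  then show False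
    using generic a(1) by blast
qed

lemma proj_ext_neq_0:
  assumes "x \<noteq> 0"
  shows "proj (ext x) \<noteq> 0"
proof
  assume "proj (ext x) = 0"
  then have "lift (proj (ext x)) = lift 0"
    by (rule arg_cong)
  also have "\<dots> = 0"
    by (simp add: vec_eq_iff forall_4)
  finally have "lift (proj (ext x)) = 0" .
  then have eq: "ext x = to_ac (x $ 4) *s p"
    unfolding lift_proj by simp
  then have "x $ 4 \<noteq> 0"
    using assms by (metis ext_eq_0_iff to_ac_0 vec.scale_zero_left)
  then have "p = inverse (to_ac (x $ 4)) *s ext x"
    unfolding eq by simp
  then show False
    using vertex_not_rational by (metis insertI1 vec.span_base vec.span_scale)
qed

text \<open>For \<open>dot h p = 1\<close> this is the linear projection along \<open>p\<close> to
  the plane with equation \<open>h\<close>. By \<open>plane_functional\<close> every plane off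
  \<open>p\<close> is of this kind.\<close>

definition shadow :: "'f alg_closure ^ 4 \<Rightarrow> 'f alg_closure ^ 4 \<Rightarrow> 'f alg_closure ^ 4" where
  "shadow h x = x - dot h x *s p"

lemma shadow_scale: "shadow h (c *s x) = c *s shadow h x"
  by (simp add: shadow_def vec.scale_right_diff_distrib)

lemma shadow_add: "shadow h (x + y) = shadow h x + shadow h y"
  by (simp add: shadow_def vec.scale_left_distrib)

lemma proj_shadow: "proj (shadow h x) = proj x"
  by (simp add: shadow_def proj_diff proj_scale)

lemma shadow_lift_proj:
  assumes "dot h p = 1"
  shows "shadow h (lift (proj x)) = shadow h x"
  using assms unfolding lift_proj
  by (simp add: shadow_def vec.scale_left_diff_distrib)

lemma proj_from_span:
  assumes "dot h p = 1"
  shows "proj_from (vec.span {p}) {x. dot h x = 0} (vec.span {z}) = vec.span {shadow h z}"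
proof (intro equalityI subsetI)
  fix x
  assume x: "x \<in> proj_from (vec.span {p}) {x. dot h x = 0} (vec.span {z})"
  have "vec.span {p} \<union> vec.span {z} \<subseteq> vec.span {p, z}"
    using vec.span_mono[of "{p}" "{p, z}"] vec.span_mono[of "{z}" "{p, z}"] by auto
  then have "vec.span (vec.span {p} \<union> vec.span {z}) \<subseteq> vec.span {p, z}"
    by (rule vec.span_minimal) simp
  then have "x \<in> vec.span {p, z}"
    using x by (auto simp: proj_from_def)
  then obtain a b where x_eq: "x = a *s p + b *s z"
    by (rule span_pairE)
  then have "a = - (b * dot h z)"
    using x assms by (simp add: proj_from_def eq_neg_iff_add_eq_0)
  then have "x = b *s shadow h z"
    unfolding x_eq by (simp add: shadow_def vec.scale_right_diff_distrib)
  then show "x \<in> vec.span {shadow h z}"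
    by (simp add: vec.span_base vec.span_scale)
next
  fix x
  assume "x \<in> vec.span {shadow h z}"
  then obtain b where x: "x = b *s shadow h z"
    by (auto simp: vec.span_singleton)
  have "p \<in> vec.span {p} \<union> vec.span {z}" "z \<in> vec.span {p} \<union> vec.span {z}"
    by (simp_all add: vec.span_base)
  then have "x \<in> vec.span (vec.span {p} \<union> vec.span {z})"
    unfolding x shadow_def by (intro vec.span_scale vec.span_diff vec.span_base)
  then show "x \<in> proj_from (vec.span {p}) {x. dot h x = 0} (vec.span {z})"
    using assms by (simp add: proj_from_def x shadow_def)
qed

lemma plane_functional:
  assumes H: "H \<in> proj_planes" "\<not> vec.span {p} \<subseteq> H"
  obtains h where "dot h p = 1" "H = {x. dot h x = 0}"
proof -
  have sub: "vec.subspace H" "vec.dim H = 3"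
    using H(1) by (auto simp: proj_planes_def)
  then have pH: "p \<notin> H"
    using H(2) span_singleton_subset_iff by blast
  then have "H \<noteq> UNIV"
    by blast
  then obtain k where k: "k \<noteq> 0" "\<And>x. x \<in> H \<Longrightarrow> dot k x = 0"
    using proper_subspace_in_hyperplane[OF sub(1)] by metis
  obtain B where B: "B \<subseteq> H" "vec.independent B" "H \<subseteq> vec.span B" "card B = vec.dim H"
    using vec.basis_exists[of H] .
  then have HB: "H = vec.span B"
    by (metis sub(1) antisym vec.span_minimal)
  have "p \<notin> B"
    using pH B(1) by blast
  have ind: "vec.independent (insert p B)"
    using pH B(2) unfolding HB by (intro vec.independent_insertI)
  moreover have "card (insert p B) = 4"
    using \<open>p \<notin> B\<close> B(4) sub(2) vec.finiteI_independent[OF B(2)] by simp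
  ultimately have "UNIV \<subseteq> vec.span (insert p B)"
    by (intro vec.card_ge_dim_independent) (simp_all only: vec_dim_card, simp_all)
  then have full: "\<exists>c. x - c *s p \<in> H" for x
    unfolding HB vec.span_insert by blast
  have kp: "dot k p \<noteq> 0"
  proof
    assume "dot k p = 0"
    moreover have "dot k (x - c *s p) = 0" if "x - c *s p \<in> H" for x c
      using k(2) that by blast
    ultimately have "dot k x = 0" for x
      using full[of x] by auto
    then have "k $ i = 0" for i
      using \<open>\<And>x. dot k x = 0\<close>[of "axis i 1"]
      by (simp add: dot_def axis_def if_distrib[of "(*) _"] cong: if_cong)
    then show False
      using k(1) by (simp add: vec_eq_iff)
  qed
  show thesis
  proof
    show "dot (inverse (dot k p) *s k) p = 1"
      using kp by simp
    show "H = {x. dot (inverse (dot k p) *s k) x = 0}"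
    proof (intro equalityI subsetI)
      fix x
      assume "x \<in> {x. dot (inverse (dot k p) *s k) x = 0}"
      then have "dot k x = 0"
        using kp by simp
      moreover obtain c where c: "x - c *s p \<in> H"
        using full by blast
      ultimately have "c = 0"
        using k(2)[OF c] kp by simp
      then show "x \<in> H"
        using c by simp
    qed (use k(2) in auto)
  qed
qed

end

locale generic_projection = generic_vertex p + maximal_spread S d
  for p :: "'f::{field,finite} alg_closure ^ 4" and S :: "('f ^ 4) set set" and d
begin

definition shadows :: "('f alg_closure ^ 3) set set" where
  "shadows = (\<lambda>x. vec.span {proj (ext x)}) ` holes S"

lemma holes_nonempty: "holes S \<noteq> {}"
proof -
  have "card (holes S) > 0"
    unfolding card_holes using d_pos card_field_ge_2[where 'f='f] by simp
  then show ?thesis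
    by (metis card.empty less_nat_zero_code)
qed

lemma generators:
  obtains h where "form_fun (int d) h" "\<And>x. x \<in> holes S \<Longrightarrow> h (proj (ext x)) = 0"
    "\<And>k u. form_fun k u \<Longrightarrow> (\<And>x. x \<in> holes S \<Longrightarrow> u (proj (ext x)) = 0) \<Longrightarrow>
      \<exists>a b. form_fun (k - int (CARD('f) + 1)) a \<and> form_fun (k - int d) b \<and>
        (\<forall>y. u y = a y * frob_form y + b y * h y)"
    "\<And>w a b. poly_fun w \<Longrightarrow> poly_fun a \<Longrightarrow> poly_fun b \<Longrightarrow> (\<And>y. frob_form y = w y * a y) \<Longrightarrow>
      (\<And>y. h y = w y * b y) \<Longrightarrow> \<exists>c. poly_fun c \<and> (\<forall>y. w y * c y = 1)"
proof -
  obtain \<Sigma> :: "('f ^ 4) set set" where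
    \<Sigma>: "\<Sigma> \<subseteq> proj_lines" "pairwise skew \<Sigma>" "\<Union>\<Sigma> = UNIV" "card \<Sigma> = CARD('f)\<^sup>2 + 1"
    by (rule spread_exists)
  have card: "card \<Sigma> = card S + d"
    using \<Sigma>(4) card_S by simp
  obtain h where h: "form_fun (int d) h" "\<And>x. x \<notin> \<Union>S \<Longrightarrow> h (proj (ext x)) = 0"
    "\<And>k u. form_fun k u \<Longrightarrow> (\<And>x. x \<notin> \<Union>S \<Longrightarrow> u (proj (ext x)) = 0) \<Longrightarrow>
      \<exists>a b. form_fun (k - int (CARD('f) + 1)) a \<and> form_fun (k - int d) b \<and>
        (\<forall>y. u y = a y * frob_form y + b y * h y)"
    "\<And>w a b. poly_fun w \<Longrightarrow> poly_fun a \<Longrightarrow> poly_fun b \<Longrightarrow> (\<And>y. frob_form y = w y * a y) \<Longrightarrow>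
      (\<And>y. h y = w y * b y) \<Longrightarrow> \<exists>c. poly_fun c \<and> (\<forall>y. w y * c y = 1)"
    using complement_generators[OF finite lines skew finite \<Sigma>(1-3) card] by blast
  show thesis
  proof (rule that[OF h(1) _ h(3) h(4)])
    show "h (proj (ext x)) = 0" if "x \<in> holes S" for x
      using h(2) that by (auto simp: holes_def)
    show "u (proj (ext x)) = 0"
      if u: "form_fun k u" "\<And>x. x \<in> holes S \<Longrightarrow> u (proj (ext x)) = 0" and x: "x \<notin> \<Union>S" for k u x
    proof (cases "x = 0")
      \<comment> \<open>The zero vector is not a hole, but \<open>u\<close> has a zero at some hole
        and so vanishes at the origin too.\<close>
      case True
      obtain y where "y \<in> holes S"
        using holes_nonempty by blast
      then show ?thesis
        using form_fun_eq_0_at_0[OF u(1) u(2)] True by simp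
    next
      case False
      then show ?thesis
        using u(2) x by (simp add: holes_def)
    qed
  qed
qed

text \<open>Transfers \<open>generators\<close> from functions to polynomials, which are determined
  by their values because the closure is infinite.\<close>

lemma complete_intersection_shadows: "complete_intersection (CARD('f) + 1) d shadows"
proof -
  obtain h where h: "form_fun (int d) h" "\<And>x. x \<in> holes S \<Longrightarrow> h (proj (ext x)) = 0"
    and gen: "\<And>k u. form_fun k u \<Longrightarrow> (\<And>x. x \<in> holes S \<Longrightarrow> u (proj (ext x)) = 0) \<Longrightarrow>
      \<exists>a b. form_fun (k - int (CARD('f) + 1)) a \<and> form_fun (k - int d) b \<and>
        (\<forall>y. u y = a y * frob_form y + b y * h y)"
    and coprime: "\<And>w a b. poly_fun w \<Longrightarrow> poly_fun a \<Longrightarrow> poly_fun b \<Longrightarrow>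
      (\<And>y. frob_form y = w y * a y) \<Longrightarrow> (\<And>y. h y = w y * b y) \<Longrightarrow> \<exists>c. poly_fun c \<and> (\<forall>y. w y * c y = 1)"
    using generators by blast
  obtain F where F: "is_form (CARD('f) + 1) F" "mpoly_eval F = frob_form"
    using form_fun_imp_mpoly_eval[OF form_fun_frob_form] .
  obtain G where G: "is_form d G" "mpoly_eval G = h"
    using form_fun_imp_mpoly_eval[OF h(1)] .
  have inj: "a = b" if "mpoly_eval a = mpoly_eval b" for a b :: "('f alg_closure, 3) mpoly"
    using mpoly_eval_inject[OF infinite_UNIV_alg_closed that] .
  show ?thesis
    unfolding complete_intersection_def
  proof (intro exI conjI allI impI)
    show "is_form (CARD('f) + 1) F" "is_form d G"
      by fact+
    fix w
    assume "w dvd F \<and> w dvd G"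
    then obtain a b where ab: "F = w * a" "G = w * b"
      by (auto elim!: dvdE)
    have "\<exists>c. poly_fun c \<and> (\<forall>y. mpoly_eval w y * c y = 1)"
    proof (rule coprime)
      show "frob_form y = mpoly_eval w y * mpoly_eval a y" for y
        unfolding F(2)[symmetric] ab(1) by (rule mpoly_eval_mult)
      show "h y = mpoly_eval w y * mpoly_eval b y" for y
        unfolding G(2)[symmetric] ab(2) by (rule mpoly_eval_mult)
    qed (rule poly_fun_mpoly_eval)+
    then obtain c where c: "poly_fun c" "\<And>y. mpoly_eval w y * c y = 1"
      by blast
    obtain C where "mpoly_eval C = c"
      using poly_fun_imp_mpoly_eval[OF c(1)] .
    then have "1 = w * C"
      using c(2) by (intro inj) (auto simp: fun_eq_iff mpoly_eval_mult mpoly_eval_one)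
    then show "w dvd 1"
      by (rule dvdI)
  next
    show "homogeneous_ideal shadows = ideal_gen {F, G}"
    proof (rule antisym)
      show "homogeneous_ideal shadows \<subseteq> ideal_gen {F, G}"
        unfolding homogeneous_ideal_def
      proof (subst ideal_gen_subset_iff)
        show "{f. (\<exists>k. is_form k f) \<and> (\<forall>P\<in>shadows. vanishes_at f P)} \<subseteq> ideal_gen {F, G}"
        proof
          fix u
          assume u: "u \<in> {f. (\<exists>k. is_form k f) \<and> (\<forall>P\<in>shadows. vanishes_at f P)}"
          then obtain k where k: "is_form k u"
            by blast
          have "mpoly_eval u (proj (ext x)) = 0" if "x \<in> holes S" for x
            using u that vanishes_at_span_singleton[OF k] unfolding shadows_def by auto
          from gen[OF form_fun_mpoly_eval[OF k] this]
          obtain a b where a: "form_fun (int k - int (CARD('f) + 1)) a"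
            and b: "form_fun (int k - int d) b"
            and eq: "\<And>y. mpoly_eval u y = a y * frob_form y + b y * h y"
            by blast
          obtain A where A: "mpoly_eval A = a"
            using poly_fun_imp_mpoly_eval[OF form_fun_poly_fun[OF a]] .
          obtain B where B: "mpoly_eval B = b"
            using poly_fun_imp_mpoly_eval[OF form_fun_poly_fun[OF b]] .
          have "u = A * F + B * G"
            by (intro inj) (simp add: fun_eq_iff mpoly_eval_add mpoly_eval_mult A B F(2) G(2) eq)
          then show "u \<in> ideal_gen {F, G}"
            by (simp add: ideal_gen_add ideal_gen_mult ideal_gen_base)
        qed
      qed (simp_all add: ideal_gen_add ideal_gen_mult ideal_gen_0)
      have "vanishes_at F P" "vanishes_at G P" if "P \<in> shadows" for P
        using that F G h(2) frob_form_rational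
        by (auto simp: shadows_def vanishes_at_span_singleton[OF F(1)] vanishes_at_span_singleton[OF G(1)])
      then have "{F, G} \<subseteq> homogeneous_ideal shadows"
        unfolding homogeneous_ideal_def using F(1) G(1) by (auto intro!: ideal_gen_base)
      then show "ideal_gen {F, G} \<subseteq> homogeneous_ideal shadows"
        unfolding homogeneous_ideal_def
        by (subst ideal_gen_subset_iff) (simp_all add: ideal_gen_add ideal_gen_mult ideal_gen_0)
    qed
  qed
qed

text \<open>Both cofactors have negative degree.\<close>

lemma no_form_of_small_degree:
  assumes "form_fun (int k) u" "\<And>x. x \<in> holes S \<Longrightarrow> u (proj (ext x)) = 0" "k \<le> CARD('f)" "k < d"
  shows "u y = 0"
proof -
  obtain h where h: "form_fun (int d) h" "\<And>x. x \<in> holes S \<Longrightarrow> h (proj (ext x)) = 0"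
    and gen: "\<And>k u. form_fun k u \<Longrightarrow> (\<And>x. x \<in> holes S \<Longrightarrow> u (proj (ext x)) = 0) \<Longrightarrow>
      \<exists>a b. form_fun (k - int (CARD('f) + 1)) a \<and> form_fun (k - int d) b \<and>
        (\<forall>y. u y = a y * frob_form y + b y * h y)"
    and coprime: "\<And>w a b. poly_fun w \<Longrightarrow> poly_fun a \<Longrightarrow> poly_fun b \<Longrightarrow>
      (\<And>y. frob_form y = w y * a y) \<Longrightarrow> (\<And>y. h y = w y * b y) \<Longrightarrow> \<exists>c. poly_fun c \<and> (\<forall>y. w y * c y = 1)"
    using generators by blast
  obtain a b where a: "form_fun (int k - int (CARD('f) + 1)) a" and b: "form_fun (int k - int d) b"
    and eq: "\<And>y. u y = a y * frob_form y + b y * h y"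
    using gen[OF assms(1,2)] by blast
  have "a y = 0"
    by (rule form_fun_neg[OF a]) (use assms(3) in simp)
  moreover have "b y = 0"
    by (rule form_fun_neg[OF b]) (use assms(4) in simp)
  ultimately show ?thesis
    by (simp add: eq)
qed

lemma proj_from_hole_points:
  assumes "dot h p = 1"
  shows "proj_from (vec.span {p}) {x. dot h x = 0} ` hole_points
    = (\<lambda>x. vec.span {shadow h (ext x)}) ` holes S"
  unfolding hole_points_eq image_image proj_from_span[OF assms] ..

text \<open>The map \<open>shadow h (lift y)\<close> identifies the coordinate plane with
  \<open>H\<close>, with inverse \<open>proj\<close>, and matches the two projections from
  \<open>p\<close>. So the choice of \<open>H\<close> does not matter.\<close>

lemma complete_intersection_in_plane:
  assumes H: "H \<in> proj_planes" "\<not> vec.span {p} \<subseteq> H"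
  shows "complete_intersection_in H (CARD('f) + 1) d (proj_from (vec.span {p}) H ` hole_points)"
proof -
  obtain h where h: "dot h p = 1" "H = {x. dot h x = 0}"
    using plane_functional[OF H] .
  have "Vector_Spaces.linear (*s) (*s) (\<lambda>y. shadow h (lift y))"
    by (rule vec_linearI) (simp_all add: lift_add lift_scale shadow_add shadow_scale)
  then have A: "matrix (\<lambda>y. shadow h (lift y)) *v y = shadow h (lift y)" for y
    by (rule matrix_works)
  let ?A = "matrix (\<lambda>y. shadow h (lift y))"
  have lin: "Vector_Spaces.linear (*s) (*s) ((*v) ?A)"
    by (rule matrix_vector_mul_linear_gen)
  have range: "range ((*v) ?A) = H"
  proof (intro equalityI subsetI)
    fix x
    assume "x \<in> range ((*v) ?A)"
    then obtain y where "x = shadow h (lift y)"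
      by (metis A imageE)
    then show "x \<in> H"
      using h by (simp add: shadow_def)
  next
    fix x
    assume "x \<in> H"
    then have "?A *v proj x = x"
      unfolding A shadow_lift_proj[OF h(1)] using h(2) by (simp add: shadow_def)
    then show "x \<in> range ((*v) ?A)"
      by (metis rangeI)
  qed
  have injA: "inj ((*v) ?A)"
    by (rule injI) (metis A proj_shadow proj_lift)
  have img: "(*v) ?A ` vec.span {proj (ext x)} = vec.span {shadow h (ext x)}" for x
    using vec.linear_span_image[OF lin, of "{proj (ext x)}"] by (simp add: A shadow_lift_proj[OF h(1)])
  have "{Q \<in> proj_points. (*v) ?A ` Q \<in> proj_from (vec.span {p}) H ` hole_points} = shadows"
  proof (intro equalityI subsetI)
    fix Q
    assume "Q \<in> {Q \<in> proj_points. (*v) ?A ` Q \<in> proj_from (vec.span {p}) H ` hole_points}"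
    then obtain x where x: "x \<in> holes S" "(*v) ?A ` Q = vec.span {shadow h (ext x)}"
      unfolding h(2) proj_from_hole_points[OF h(1)] by auto
    then have "Q = vec.span {proj (ext x)}"
      unfolding img[symmetric] by (simp add: inj_image_eq_iff[OF injA])
    then show "Q \<in> shadows"
      using x(1) by (simp add: shadows_def)
  next
    fix Q
    assume "Q \<in> shadows"
    then obtain x where x: "x \<in> holes S" "Q = vec.span {proj (ext x)}"
      by (auto simp: shadows_def)
    then have "Q \<in> proj_points"
      using proj_ext_neq_0 by (auto simp: holes_def intro!: span_singleton_proj_point)
    then show "Q \<in> {Q \<in> proj_points. (*v) ?A ` Q \<in> proj_from (vec.span {p}) H ` hole_points}"
      unfolding h(2) proj_from_hole_points[OF h(1)] using x img by auto
  qed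
  then have "complete_intersection (CARD('f) + 1) d
      {Q \<in> proj_points. (*v) ?A ` Q \<in> proj_from (vec.span {p}) H ` hole_points}"
    using complete_intersection_shadows by simp
  then show ?thesis
    unfolding complete_intersection_in_def by (intro exI[of _ ?A] conjI range)
qed

lemma second_degree_bound:
  assumes H: "H \<in> proj_planes" "\<not> vec.span {p} \<subseteq> H"
    and ci: "complete_intersection_in H a b (proj_from (vec.span {p}) H ` hole_points)"
    and b: "b \<le> CARD('f)" "b < d"
  shows False
proof -
  obtain h where h: "dot h p = 1" "H = {x. dot h x = 0}"
    using plane_functional[OF H] .
  obtain A :: "'f alg_closure ^ 3 ^ 4" where A: "range ((*v) A) = H"
    and ci': "complete_intersection a b {Q \<in> proj_points. (*v) A ` Q \<in> proj_from (vec.span {p}) H ` hole_points}"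
    using ci unfolding complete_intersection_in_def by blast
  define V where "V = {Q \<in> proj_points. (*v) A ` Q \<in> proj_from (vec.span {p}) H ` hole_points}"
  \<comment> \<open>The coordinates \<open>A\<close> on \<open>H\<close> are arbitrary. Followed by
    the projection from \<open>p\<close> they give an automorphism \<open>T\<close>, and its inverse
    \<open>B\<close> transports \<open>g\<close> to a form of degree \<open>b\<close> that vanishes
    at the projected holes.\<close>
  define T where "T = (\<lambda>y. proj (A *v y))"
  have T_lin: "Vector_Spaces.linear (*s) (*s) T"
    by (rule vec_linearI)
      (simp_all add: T_def matrix_vector_right_distrib vector_scalar_commute proj_add proj_scale)
  have A_H: "shadow h (A *v y) = A *v y" for y
    using A h(2) by (auto simp: shadow_def)
  have "\<exists>x. y = T x" for y
  proof -
    have "shadow h (lift y) \<in> range ((*v) A)"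
      unfolding A h(2) using h(1) by (simp add: shadow_def)
    then obtain x where "A *v x = shadow h (lift y)"
      by (metis rangeE)
    then have "y = T x"
      by (simp add: T_def proj_shadow)
    then show ?thesis ..
  qed
  then have "surj T"
    by (simp add: surj_def)
  from vec.linear_surjective_isomorphism[OF T_lin this]
  obtain B where B: "Vector_Spaces.linear (*s) (*s) B" "\<And>y. B (T y) = y" "\<And>y. T (B y) = y"
    by auto
  have AB: "A *v B y = shadow h (lift y)" for y
    using shadow_lift_proj[OF h(1), of "A *v B y"] B(3)[of y] by (simp add: A_H T_def)
  have V: "vec.span {B (proj (ext x))} \<in> V" if "x \<in> holes S" for x
  proof -
    have "proj (ext x) \<noteq> 0"
      using that proj_ext_neq_0 by (simp add: holes_def)
    then have "B (proj (ext x)) \<noteq> 0"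
      using B(3)[of "proj (ext x)"] by (auto simp: T_def)
    moreover have "(*v) A ` vec.span {B (proj (ext x))} = vec.span {shadow h (ext x)}"
      using vec.linear_span_image[OF matrix_vector_mul_linear_gen, of A "{B (proj (ext x))}"]
      by (simp add: AB shadow_lift_proj[OF h(1)])
    ultimately show ?thesis
      using that unfolding V_def h(2) proj_from_hole_points[OF h(1)]
      by (auto intro!: span_singleton_proj_point)
  qed
  then have "V \<noteq> {}"
    using holes_nonempty by blast
  then obtain g where g: "is_form b g" "g \<noteq> 0" "\<And>P. P \<in> V \<Longrightarrow> vanishes_at g P"
    using complete_intersection_second_generator[OF ci'[folded V_def]] by (auto simp: V_def)
  have "form_fun (int b) (\<lambda>y. mpoly_eval g (matrix B *v y))"
    by (rule form_fun_compose[OF form_fun_mpoly_eval[OF g(1)] form_fun_matrix])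
  then have "form_fun (int b) (\<lambda>y. mpoly_eval g (B y))"
    by (simp add: matrix_works[OF B(1)])
  moreover have "mpoly_eval g (B (proj (ext x))) = 0" if "x \<in> holes S" for x
    using g(3)[OF V[OF that]] by (simp add: vanishes_at_span_singleton[OF g(1)])
  ultimately have "mpoly_eval g (B y) = 0" for y
    using no_form_of_small_degree b by blast
  then have "mpoly_eval g y = 0" for y
    using B(2)[of y] by metis
  then show False
    using mpoly_eval_eq_0_imp[OF infinite_UNIV_alg_closed] g(2) by blast
qed

end

section \<open>Generic points\<close>

lemma poly_fun_prod_nonzero:
  fixes u :: "'i \<Rightarrow> 'k::alg_closed_field ^ 'n::finite \<Rightarrow> 'k"
  assumes "finite A" "\<And>i. i \<in> A \<Longrightarrow> poly_fun (u i)" "\<And>i. i \<in> A \<Longrightarrow> \<exists>x. u i x \<noteq> 0"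
  shows "\<exists>x. (\<Prod>i\<in>A. u i x) \<noteq> 0"
  using assms
proof (induction A)
  case (insert i A)
  then have "poly_fun (u i)" "poly_fun (\<lambda>x. \<Prod>i\<in>A. u i x)" "\<exists>x. u i x \<noteq> 0" "\<exists>x. (\<Prod>i\<in>A. u i x) \<noteq> 0"
    by (auto intro: poly_fun_prod)
  from poly_fun_mult_eq_0[OF infinite_UNIV_alg_closed this(1,2)] this(3,4)
  have "\<exists>x. u i x * (\<Prod>i\<in>A. u i x) \<noteq> 0"
    by blast
  then show ?case
    using insert.hyps by simp
qed simp

text \<open>The product of the equations of all rational planes, so its nonzero points are the
  generic ones. Each plane occurs once for every scalar multiple of its equation.\<close>

definition generic_form :: "'f::{field,finite} alg_closure ^ 4 \<Rightarrow> 'f alg_closure" where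
  "generic_form v = (\<Prod>a\<in>UNIV - {0}. dot (ext a) v)"

lemma form_fun_dot: "form_fun 1 (dot a)"
  unfolding dot_def[abs_def] by (rule form_fun_linear)

lemma form_fun_generic_form:
  obtains k where "form_fun (int k) (generic_form :: 'f::{field,finite} alg_closure ^ 4 \<Rightarrow> _)"
proof
  show "form_fun (int (card (UNIV - {0 :: 'f ^ 4}))) (generic_form :: 'f alg_closure ^ 4 \<Rightarrow> _)"
    unfolding generic_form_def[abs_def]
    using form_fun_prod[of "UNIV - {0 :: 'f ^ 4}" "\<lambda>_. 1" "\<lambda>a. dot (ext a)"] form_fun_dot by auto
qed

lemma dot_axis: "dot a (axis i 1) = a $ i" "dot (axis i 1) x = x $ i"
  by (simp_all add: dot_def axis_def if_distrib[of "(*) _"] if_distrib[of "\<lambda>y. y * _"] cong: if_cong)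

lemma generic_form_nonzero: "\<exists>v. generic_form v \<noteq> (0 :: 'f::{field,finite} alg_closure)"
  unfolding generic_form_def
proof (rule poly_fun_prod_nonzero)
  show "poly_fun (dot (ext a))" for a :: "'f ^ 4"
    by (rule form_fun_poly_fun[OF form_fun_dot])
  show "\<exists>x. dot (ext a) x \<noteq> 0" if "a \<in> UNIV - {0}" for a :: "'f ^ 4"
  proof -
    obtain i where "a $ i \<noteq> 0"
      using \<open>a \<in> UNIV - {0}\<close> by (auto simp: vec_eq_iff)
    then have "dot (ext a) (axis i 1) \<noteq> 0"
      by (simp add: dot_axis)
    then show ?thesis ..
  qed
qed simp

lemma generic_form_zero: "generic_form (0 :: 'f::{field,finite} alg_closure ^ 4) = 0"
proof -
  have "axis 1 1 \<in> UNIV - {0 :: 'f ^ 4}"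
    by (simp add: axis_eq_0_iff)
  then show ?thesis
    unfolding generic_form_def by (intro prod_zero bexI[of _ "axis 1 1"]) auto
qed

lemma generic_vertexE:
  fixes v :: "'f::{field,finite} alg_closure ^ 4"
  assumes "P \<in> proj_points" "v \<in> P" "generic_form v \<noteq> 0"
  obtains p where "generic_vertex p" "P = vec.span {p}"
proof -
  have v: "dot (ext a) v \<noteq> 0" if "a \<noteq> 0" for a :: "'f ^ 4"
    using assms(3) that by (auto simp: generic_form_def)
  have "ext (axis 4 1 :: 'f ^ 4) = axis 4 1"
    by (simp add: vec_eq_iff axis_def)
  then have v4: "v $ 4 \<noteq> 0"
    using v[of "axis 4 1"] by (simp add: dot_axis axis_eq_0_iff)
  obtain x where x: "P = vec.span {x}"
    using proj_pointE[OF assms(1)] .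
  then obtain c where c: "v = c *s x"
    using assms(2) by (auto simp: vec.span_singleton)
  then have "c \<noteq> 0"
    using v4 by auto
  let ?p = "inverse (v $ 4) *s v"
  show thesis
  proof
    show "generic_vertex ?p"
      by unfold_locales (use v v4 in auto)
    have "?p = (inverse (v $ 4) * c) *s x"
      by (simp add: c)
    then show "P = vec.span {?p}"
      using vec.span_image_scale[of "{x}" "\<lambda>_. inverse (v $ 4) * c"] \<open>c \<noteq> 0\<close> v4 x by simp
  qed
qed

text \<open>Ensures that the condition on planes in \<open>geproci\<close> is not vacuous when it is
  used as a hypothesis.\<close>

lemma plane_avoiding_point:
  fixes p :: "'a::field ^ 4"
  assumes "p \<noteq> 0"
  obtains H where "H \<in> proj_planes" "\<not> vec.span {p} \<subseteq> H"
proof -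
  define C where "C = vec.extend_basis {p}"
  have C: "p \<in> C" "vec.independent C" "vec.span C = UNIV"
    unfolding C_def using assms vec.extend_basis_superset[of "{p}"]
    by (auto simp: vec.independent_extend_basis)
  have "card C = 4"
    using vec.dim_span_eq_card_independent[OF C(2)] unfolding C(3) vec_dim_card by simp
  then have "card (C - {p}) = 3"
    using C(1) vec.finiteI_independent[OF C(2)] by (simp add: card_Diff_singleton)
  moreover have "vec.independent (C - {p})"
    using C(2) by (rule vec.independent_mono) auto
  ultimately have "vec.span (C - {p}) \<in> proj_planes"
    using vec.dim_span_eq_card_independent[of "C - {p}"] by (simp add: proj_planes_def)
  moreover have "p \<notin> vec.span (C - {p})"
    using C(1,2) unfolding vec.dependent_def by blast
  then have "\<not> vec.span {p} \<subseteq> vec.span (C - {p})"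
    using vec.span_base[of p "{p}"] by blast
  ultimately show thesis
    using that by blast
qed

section \<open>The complement of a maximal partial spread\<close>

context maximal_spread
begin

lemma geproci_hole_points: "geproci (CARD('f) + 1) d hole_points"
proof -
  obtain k where "form_fun (int k) (generic_form :: 'f alg_closure ^ 4 \<Rightarrow> _)"
    using form_fun_generic_form .
  then obtain G where G: "is_form k G" "mpoly_eval G = (generic_form :: 'f alg_closure ^ 4 \<Rightarrow> _)"
    using form_fun_imp_mpoly_eval by blast
  \<comment> \<open>The complement of the rational planes serves as the open set of general
    points.\<close>
  define U where "U = {P \<in> proj_points. \<not> vanishes_at G P}"
  have "zariski_open U"
    unfolding zariski_open_def U_def using G(1) by (intro exI[of _ "{G}"]) auto
  moreover have "U \<noteq> {}"
  proof -
    obtain v :: "'f alg_closure ^ 4" where v: "generic_form v \<noteq> 0"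
      using generic_form_nonzero by blast
    then have "v \<noteq> 0"
      using generic_form_zero by auto
    then have "vec.span {v} \<in> U"
      using v G(2) vanishes_at_span_singleton[OF G(1)]
      by (simp add: U_def span_singleton_proj_point)
    then show ?thesis
      by blast
  qed
  moreover have "P \<notin> hole_points \<and> (\<forall>H\<in>proj_planes. \<not> P \<subseteq> H \<longrightarrow>
      complete_intersection_in H (CARD('f) + 1) d (proj_from P H ` hole_points))" if P: "P \<in> U" for P
  proof -
    obtain v where v: "P \<in> proj_points" "v \<in> P" "generic_form v \<noteq> 0"
      using P G(2) by (auto simp: U_def vanishes_at_def)
    obtain p where p: "generic_vertex p" "P = vec.span {p}"
      using generic_vertexE[OF v] .
    then interpret generic_projection p S d
      by (intro generic_projection.intro maximal_spread_axioms)
    have "P \<notin> hole_points"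
    proof
      assume "P \<in> hole_points"
      then obtain x where "P = vec.span {ext x}"
        by (auto simp: hole_points_eq)
      then show False
        using p(2) vertex_not_rational vec.span_base[of p "{p}"] by auto
    qed
    then show ?thesis
      using complete_intersection_in_plane p(2) by blast
  qed
  ultimately show ?thesis
    unfolding geproci_def using d_pos finite_hole_points hole_points_subset
    by (intro conjI exI[of _ U] ballI) (simp, blast+)
qed

lemma nontrivial_geproci_hole_points: "nontrivial_geproci (CARD('f) + 1) d hole_points"
  unfolding nontrivial_geproci_def
  using geproci_hole_points hole_points_not_planar hole_points_not_grid by blast

text \<open>The parameters \<open>m\<close>, \<open>l\<close> of a half grid are not known to be
  \<open>q + 1\<close> and \<open>d\<close>. The bound \<open>l \<le> q\<close> on the points of a
  line suffices, as \<open>second_degree_bound\<close> excludes a second generator of such a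
  degree.\<close>

lemma not_half_grid_hole_points:
  assumes "d > CARD('f) + 1"
  shows "\<not> half_grid m l hole_points"
proof
  assume "half_grid m l hole_points"
  then have gep: "geproci m l hole_points" and "\<exists>M. M \<subseteq> proj_lines \<and> finite M \<and> card M = m \<and> pairwise skew M \<and>
      hole_points \<subseteq> points_on M \<and> (\<forall>L\<in>M. card {P \<in> hole_points. P \<subseteq> L} = l)"
    by (simp_all add: half_grid_def nontrivial_geproci_def)
  from this(2) obtain M where M_all: "M \<subseteq> proj_lines \<and> finite M \<and> card M = m \<and> pairwise skew M \<and>
      hole_points \<subseteq> points_on M \<and> (\<forall>L\<in>M. card {P \<in> hole_points. P \<subseteq> L} = l)" ..
  then have M: "M \<subseteq> proj_lines" "card M = m"
    by simp_all
  have l: "card {P \<in> hole_points. P \<subseteq> L} = l" if "L \<in> M" for L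
    using M_all that by simp
  have "card M > 0"
    using gep M(2) by (simp add: geproci_def)
  then obtain L where L: "L \<in> M"
    by (metis card.empty ex_in_conv less_nat_zero_code)
  have l_le: "l \<le> CARD('f)"
    using card_hole_points_line[of L] l[OF L] L M(1) by auto
  obtain U where U: "zariski_open U" "U \<noteq> {}" "\<And>P H. P \<in> U \<Longrightarrow> H \<in> proj_planes \<Longrightarrow> \<not> P \<subseteq> H \<Longrightarrow>
      complete_intersection_in H m l (proj_from P H ` hole_points)"
    using gep unfolding geproci_def by blast
  obtain F where F: "\<And>f. f \<in> F \<Longrightarrow> \<exists>k. is_form k f" "U = {P \<in> proj_points. \<exists>f\<in>F. \<not> vanishes_at f P}"
    using U(1) unfolding zariski_open_def by blast
  obtain f P0 where f: "f \<in> F" "\<not> vanishes_at f P0"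
    using U(2) unfolding F(2) by blast
  obtain k where k: "is_form k f"
    using F(1)[OF f(1)] by blast
  obtain j where j: "form_fun (int j) (generic_form :: 'f alg_closure ^ 4 \<Rightarrow> _)"
    using form_fun_generic_form .
  have "\<exists>v. mpoly_eval f v \<noteq> 0"
    using f(2) by (auto simp: vanishes_at_def)
  \<comment> \<open>The open set supplied by the half grid need not consist of generic points; a
    nonzero value of the product gives a point that is generic and lies in it.\<close>
  with poly_fun_mult_eq_0[OF infinite_UNIV_alg_closed poly_fun_mpoly_eval[of f] form_fun_poly_fun[OF j]]
    generic_form_nonzero
  obtain v where v: "mpoly_eval f v * generic_form v \<noteq> 0"
    by blast
  then have "v \<noteq> 0"
    using generic_form_zero by auto
  then have P: "vec.span {v} \<in> proj_points"
    by (rule span_singleton_proj_point)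
  then have "vec.span {v} \<in> U"
    using f(1) v vanishes_at_span_singleton[OF k, of v] unfolding F(2) by auto
  moreover obtain p where p: "generic_vertex p" "vec.span {v} = vec.span {p}"
    using generic_vertexE[OF P, of v] v by (auto simp: vec.span_base)
  moreover have "p \<noteq> 0"
    using p(2) P by (auto simp: proj_points_def)
  then obtain H where H: "H \<in> proj_planes" "\<not> vec.span {p} \<subseteq> H"
    using plane_avoiding_point by blast
  ultimately have ci: "complete_intersection_in H m l (proj_from (vec.span {p}) H ` hole_points)"
    using U(3) by simp
  interpret generic_projection p S d
    by (intro generic_projection.intro maximal_spread_axioms p(1))
  show False
    using ci second_degree_bound[OF H] l_le assms by simp
qed

end

theorem theorem2:
  fixes S :: "('f::{field,finite} ^ 4) set set"
    and Z :: "('f alg_closure ^ 4) set set"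
    and q d :: nat
  assumes "q = CARD('f)"
    and "maximal_partial_spread d S"
    and "Z = base_change ` (proj_points - points_on S)"
  shows "nontrivial_geproci (q + 1) d Z \<and>
         (d > q + 1 \<longrightarrow> \<not> (\<exists>m l. half_grid m l Z))"
proof -
  interpret maximal_spread S d
    by unfold_locales (rule assms(2))
  have "Z = hole_points"
    unfolding assms(3) hole_points_def ..
  then show ?thesis
    using nontrivial_geproci_hole_points not_half_grid_hole_points assms(1) by simp
qed

end
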